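(* (i) Let $n\ge1$. The assignment $\mathfrak q^{\sf C}_n(\underline a\mid\underline b)\mapsto\mathfrak q^{\sf A}(\underline a'\mid\underline b)\cap\mathfrak{sl}_n$, where $\underline a'=(\underline a,1)$ is obtained by appending a last part $1$ to $\underline a$, is a bijection from the set of Frobenius seaweeds $\mathfrak q^{\sf C}_n(\underline a\mid\underline b)\in\boldsymbol{\mathcal F}_{n,1}$, written so that $\sum a_i=n-1$ and $\sum b_j=n$, onto the set of standard Frobenius seaweeds $\mathfrak q^{\sf A}(\underline a'\mid\underline b)\cap\mathfrak{sl}_n$ of $\mathfrak{sl}_n$ such that the last part of $\underline a'$ equals $1$. (ii) Let $n\ge2$. The assignment $\mathfrak q^{\sf C}_n(\underline a\mid\underline b)\mapsto\mathfrak q^{\sf A}(\underline a'\mid\underline b)\cap\mathfrak{sl}_n$, where $\underline a'=(\underline a,2)$ is obtained by appending a last part $2$ to $\underline a$, is a bijection from the set of Frobenius seaweeds $\mathfrak q^{\sf C}_n(\underline a\mid\underline b)\in\boldsymbol{\mathcal F}_{n,2}$, written so that $\sum a_i=n-2$ and $\sum b_j=n$, onto the set of standard Frobenius seaweeds $\mathfrak q^{\sf A}(\underline a'\mid\underline b)\cap\mathfrak{sl}_n$ of $\mathfrak{sl}_n$ such that the last part of $\underline a'$ equals $2$.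
   Context: The ground field is algebraically closed of characteristic zero. The index $\mathrm{ind}\,\mathfrak q$ of a Lie algebra $\mathfrak q$ is the minimum over $\gamma\in\mathfrak q^*$ of $\dim\mathfrak q_\gamma$, where $\mathfrak q_\gamma=\{x\in\mathfrak q:\gamma([x,y])=0\ \forall y\in\mathfrak q\}$. A Lie algebra is Frobenius if its index is $0$. A composition is a finite (possibly empty) sequence of positive integers. **Type A seaweeds.** For compositions $\underline a,\underline b$ of $n$, $\mathfrak q^{\sf A}(\underline a\mid\underline b)\subset\mathfrak{gl}_n$ is the intersection of the algebra of block upper-triangular matrices with consecutive diagonal block sizes $\underline a$ and the algebra of block lower-triangular matrices with consecutive diagonal block sizes $\underline b$. The standard seaweeds of $\mathfrak{sl}_n$ are the algebras $\mathfrak q^{\sf A}(\underline a\mid\underline b)\cap\mathfrak{sl}_n$. **Symplectic seaweeds.** Realise $$\mathfrak{sp}_{2n}=\left\{\begin{pmatrix}A&B\\ C&-\hat A\end{pmatrix}: A,B,C\in\mathfrak{gl}_n,\ B=\hat B,\ C=\hat C\right\}\subset\mathfrak{gl}_{2n},$$ where $\hat{\ }$ denotes the transpose with respect to the antidiagonal. Given a composition $\underline a=(a_1,\dots,a_s)$ with $\sum a_i\le n$, put $d=n-\sum a_i$ and $\underline{\tilde a}=(a_1,\dots,a_s,2d,a_s,\dots,a_1)$, a symmetric composition of $2n$ (the part $2d$ is omitted if $d=0$). For compositions $\underline a,\underline b$ with $\sum a_i\le n$, $\sum b_j\le n$, the standard seaweed of $\mathfrak{sp}_{2n}$ is $\mathfrak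 q^{\sf C}_n(\underline a\mid\underline b)=\mathfrak q^{\sf A}(\underline{\tilde a}\mid\underline{\tilde b})\cap\mathfrak{sp}_{2n}$. **Type-C meander graph.** $\Gamma^{\sf C}_n(\underline a\mid\underline b)$ has vertices $1,\dots,2n$ placed consecutively on a horizontal line. Cut $1,\dots,2n$ into consecutive intervals of lengths given by $\underline{\tilde a}$; for each interval $\{p,\dots,q\}$ draw above the line the nested arcs joining $p$ with $q$, $p+1$ with $q-1$, etc. (the middle vertex of an odd interval gets no arc). Draw arcs below the line in the same way using $\underline{\tilde b}$. An arc is central if it crosses the vertical line between vertices $n$ and $n+1$; there are $n-\sum a_i$ central arcs above and $n-\sum b_j$ central arcs below the line. **Frobenius sets.** $\boldsymbol{\mathcal F}_{n,k}$ is the set of Frobenius standard seaweeds $\mathfrak q^{\sf C}_n(\underline a\mid\underline b)\subset\mathfrak{sp}_{2n}$ whose meander graph has exactly $k$ central arcs, where $\mathfrak q^{\sf C}_n(\underline a\mid\underline b)$ and $\mathfrak q^{\sf C}_n(\underline b\mid\underline a)$ are not distinguished. For a Frobenius standard seaweed exactly one of the two compositions sums to $n$, so for an element of $\boldsymbol{\mathcal F}_{n,k}$ one may (uniquely) order the compositions so that $\sum a_i=n-k$ and $\sum b_j=n$. *)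

theory Defs
  imports
    "Jordan_Normal_Form.VS_Connect"
    "HOL-Computational_Algebra.Polynomial"
begin

section \<open>Index of a Lie subalgebra of $\mathfrak{gl}_m$\<close>

definition lie_bracket :: "'a :: field mat \<Rightarrow> 'a mat \<Rightarrow> 'a mat" where
  "lie_bracket x y = x * y - y * x"

definition subspace_dim :: "nat \<Rightarrow> 'a :: field mat set \<Rightarrow> nat" where
  "subspace_dim m W = vectorspace.dim class_ring (module_mat TYPE('a) m m\<lparr>carrier := W\<rparr>)"

text \<open>Functionals are represented by total functions; only their values on \<open>q\<close> matter.\<close>

definition linear_functionals :: "'a :: field mat set \<Rightarrow> ('a mat \<Rightarrow> 'a) set" where
  "linear_functionals q =
     {\<gamma>. (\<forall>x\<in>q. \<forall>y\<in>q. \<gamma> (x + y) = \<gamma> x + \<gamma> y) \<and>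
         (\<forall>c. \<forall>x\<in>q. \<gamma> (c \<cdot>\<^sub>m x) = c * \<gamma> x)}"

definition lie_stabilizer :: "'a :: field mat set \<Rightarrow> ('a mat \<Rightarrow> 'a) \<Rightarrow> 'a mat set" where
  "lie_stabilizer q \<gamma> = {x \<in> q. \<forall>y\<in>q. \<gamma> (lie_bracket x y) = 0}"

definition lie_index :: "nat \<Rightarrow> 'a :: field mat set \<Rightarrow> nat" where
  "lie_index m q =
     (LEAST d. \<exists>\<gamma>\<in>linear_functionals q. d = subspace_dim m (lie_stabilizer q \<gamma>))"

definition frobenius :: "nat \<Rightarrow> 'a :: field mat set \<Rightarrow> bool" where
  "frobenius m q \<longleftrightarrow> lie_index m q = 0"

section \<open>Compositions\<close>

definition composition_of :: "nat \<Rightarrow> nat list \<Rightarrow> bool" where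
  "composition_of n a \<longleftrightarrow> (\<forall>p\<in>set a. 0 < p) \<and> sum_list a = n"

text \<open>
  Matrix indices and meander vertices are numbered from 0, so vertex \<open>i\<close> below is the usual
  vertex \<open>i + 1\<close>, and the \<open>k\<close>-th consecutive interval of a composition is
  \<open>{part_start a k..<part_start a (Suc k)}\<close>.
\<close>

definition part_start :: "nat list \<Rightarrow> nat \<Rightarrow> nat" where
  "part_start a k = sum_list (take k a)"

definition part_interval :: "nat list \<Rightarrow> nat \<Rightarrow> nat set" where
  "part_interval a k = {part_start a k..<part_start a (Suc k)}"

section \<open>Seaweeds of type A\<close>

definition block_upper_triangular :: "nat \<Rightarrow> nat list \<Rightarrow> 'a :: field mat set" where
  "block_upper_triangular n a =
     {M \<in> carrier_mat n n.
        \<forall>k l i j. l < k \<and> k < length a \<and> i \<in> part_interval a k \<and> j \<in> part_interval a l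
          \<longrightarrow> M $$ (i, j) = 0}"

definition block_lower_triangular :: "nat \<Rightarrow> nat list \<Rightarrow> 'a :: field mat set" where
  "block_lower_triangular n b =
     {M \<in> carrier_mat n n.
        \<forall>k l i j. k < l \<and> l < length b \<and> i \<in> part_interval b k \<and> j \<in> part_interval b l
          \<longrightarrow> M $$ (i, j) = 0}"

definition seaweed_A :: "nat \<Rightarrow> nat list \<Rightarrow> nat list \<Rightarrow> 'a :: field mat set" where
  "seaweed_A n a b = block_upper_triangular n a \<inter> block_lower_triangular n b"

definition sl :: "nat \<Rightarrow> 'a :: field mat set" where
  "sl n = {M \<in> carrier_mat n n. (\<Sum>i<n. M $$ (i, i)) = 0}"

section \<open>Seaweeds of type C\<close>

definition antitranspose :: "nat \<Rightarrow> 'a mat \<Rightarrow> 'a mat" where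
  "antitranspose n A = mat n n (\<lambda>(i, j). A $$ (n - 1 - j, n - 1 - i))"

text \<open>The argument \<open>n\<close> is the rank: \<open>sp n\<close> consists of matrices of size \<open>2 * n\<close>.\<close>

definition sp :: "nat \<Rightarrow> 'a :: field mat set" where
  "sp n = {four_block_mat A B C (- antitranspose n A) | A B C.
             A \<in> carrier_mat n n \<and> B \<in> carrier_mat n n \<and> C \<in> carrier_mat n n \<and>
             B = antitranspose n B \<and> C = antitranspose n C}"

definition symmetrized :: "nat \<Rightarrow> nat list \<Rightarrow> nat list" where
  "symmetrized n a =
     (let d = n - sum_list a in a @ (if d = 0 then [] else [2 * d]) @ rev a)"

definition seaweed_C :: "nat \<Rightarrow> nat list \<Rightarrow> nat list \<Rightarrow> 'a :: field mat set" where
  "seaweed_C n a b = seaweed_A (2 * n) (symmetrized n a) (symmetrized n b) \<inter> sp n"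

section \<open>The type C meander graph and its central arcs\<close>

text \<open>
  The arcs on one side of the line; the arc joining \<open>i < j\<close> is the pair \<open>(i, j)\<close>. An arc above and
  an arc below with the same end points are different arcs, so the two sides are kept apart.
\<close>

definition arcs :: "nat list \<Rightarrow> (nat \<times> nat) set" where
  "arcs c = {(p + t, q - t) | k p q t.
               k < length c \<and> p = part_start c k \<and> q = part_start c (Suc k) - 1 \<and> p + t < q - t}"

definition meander_graph_C ::
  "nat \<Rightarrow> nat list \<Rightarrow> nat list \<Rightarrow> (nat \<times> nat) set \<times> (nat \<times> nat) set" where
  "meander_graph_C n a b = (arcs (symmetrized n a), arcs (symmetrized n b))"

definition central_arcs :: "nat \<Rightarrow> (nat \<times> nat) set \<Rightarrow> (nat \<times> nat) set" where
  "central_arcs n E = {(i, j) \<in> E. i < n \<and> n \<le> j}"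

definition num_central_arcs :: "nat \<Rightarrow> nat list \<Rightarrow> nat list \<Rightarrow> nat" where
  "num_central_arcs n a b =
     (case meander_graph_C n a b of (upper, lower) \<Rightarrow>
        card (central_arcs n upper) + card (central_arcs n lower))"

section \<open>Frobenius sets\<close>

text \<open>
  The unordered pair identifies \<open>seaweed_C n a b\<close> with \<open>seaweed_C n b a\<close>.
\<close>

definition seaweed_C_class :: "nat \<Rightarrow> nat list \<Rightarrow> nat list \<Rightarrow> 'a :: field mat set set" where
  "seaweed_C_class n a b = {seaweed_C n a b, seaweed_C n b a}"

definition frobenius_set :: "nat \<Rightarrow> nat \<Rightarrow> 'a :: field mat set set set" where
  "frobenius_set n k =
     {seaweed_C_class n a b | a b.
        (\<exists>r\<le>n. composition_of r a) \<and> (\<exists>s\<le>n. composition_of s b) \<and>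
        frobenius (2 * n) (seaweed_C n a b :: 'a mat set) \<and> num_central_arcs n a b = k}"

text \<open>Frobenius standard seaweeds of \<open>sl n\<close> for which the first composition ends in \<open>k\<close>.\<close>

definition frobenius_sl_last :: "nat \<Rightarrow> nat \<Rightarrow> 'a :: field mat set set" where
  "frobenius_sl_last n k =
     {seaweed_A n a' b \<inter> sl n | a' b.
        composition_of n a' \<and> composition_of n b \<and> a' \<noteq> [] \<and> last a' = k \<and>
        frobenius n (seaweed_A n a' b \<inter> sl n :: 'a mat set)}"

end

theory Submission
  imports Defs "HOL-Library.Function_Algebras" "HOL-Library.Product_Plus" "Jordan_Normal_Form.Determinant"
begin

text \<open>
  A subalgebra is Frobenius iff some linear functional \<open>\<gamma>\<close> makes the skew form \<open>\<gamma>([x, y])\<close>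
  nondegenerate, and both parts of the theorem follow from the statement that, for \<open>k \<in> {1, 2}\<close>
  and compositions \<open>a\<close> of \<open>n - k\<close> and \<open>b\<close> of \<open>n\<close>, the symplectic seaweed of \<open>a, b\<close> is Frobenius
  iff the traceless seaweed of \<open>(a, k), b\<close> is.

  Since \<open>b\<close> sums to \<open>n\<close>, the upper right block of a matrix in the symplectic seaweed vanishes, and
  since \<open>a\<close> sums to \<open>n - k\<close>, its lower left block lives in one \<open>k\<close> by \<open>k\<close> corner. So the symplectic
  seaweed is the semidirect product of the seaweed of \<open>(a, k), b\<close> in \<open>gl n\<close> with the space of
  symmetric forms on the last block \<open>L\<close> of size \<open>k\<close> (\<open>seaweed_C_image\<close>, \<open>sp_mat_bracket\<close>).
  The main tool is symplectic reduction (\<open>nondeg_reduction_iso\<close>): if \<open>V\<close> is isotropic for a skew form,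
  the form is nondegenerate iff it restricts to a nondegenerate form on the orthogonal space of \<open>V\<close>
  modulo \<open>V\<close> and no nonzero element of \<open>V\<close> is in its radical.

  If the module is a line on which the identity matrix acts by a nonzero scalar, reduction along this
  line cuts the seaweed down to a complement of the scalar matrices, and such a complement is
  isomorphic to the traceless part (\<open>frob_one_dimensional\<close>). For \<open>k = 1\<close> the symmetric forms
  are such a line, and the equivalence follows. For \<open>k = 2\<close> the symmetric forms have dimension
  three, but the alternating forms are such a line. It remains to see that the products of the seaweed
  with the symmetric and with the alternating forms on \<open>L\<close> are simultaneously Frobenius
  (\<open>frob_sym_iff_alt\<close>).

  This is proved by working from the end of the seaweed opposite to \<open>L\<close>, where the module is not seen.
  Let the first blocks of the two compositions be \<open>A\<close> and \<open>A \<union> W\<close>. Then the matrices supported on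
  \<open>A \<times> W\<close> form an abelian ideal, a generic functional can be conjugated so that on this ideal it is
  a standard pairing of maximal rank between \<open>A\<close> and \<open>W\<close>, and the reduction along the ideal is a
  seaweed on fewer indices with the same module (\<open>frob_reduction_iff\<close>, \<open>sw_reduce\<close>): this is
  Panyushev's inductive step for the index of seaweeds. If the first blocks coincide and avoid \<open>L\<close>,
  there is a central element and neither product is Frobenius (\<open>central_not_frob\<close>). Otherwise the induction
  ends when only the indices in \<open>L\<close> are left. Then the seaweed is either all of \<open>gl 2\<close>,
  where both products have odd dimension and are not Frobenius (\<open>full_block_not_frob\<close>), or a Borel
  subalgebra of \<open>gl 2\<close>, where both are Frobenius (\<open>borel_frob\<close>).

  For the bijections one needs two more facts. A seaweed determines its pair of compositions,
  because it determines which matrix units next to the diagonal it contains. And a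
  Frobenius seaweed with two central arcs has both of them on the same side, since otherwise a copy
  of \<open>sl 2\<close> splits off as a direct factor (\<open>not_frobenius_middle\<close>).
\<close>

section \<open>Bilinear forms on subspaces\<close>

definition linear_form :: "('a::field \<Rightarrow> 'b::ab_group_add \<Rightarrow> 'b) \<Rightarrow> ('b \<Rightarrow> 'a) \<Rightarrow> bool" where
  "linear_form sc f \<longleftrightarrow> (\<forall>x y. f (x + y) = f x + f y) \<and> (\<forall>c x. f (sc c x) = c * f x)"

definition bilin :: "('a::field \<Rightarrow> 'b::ab_group_add \<Rightarrow> 'b) \<Rightarrow> ('b \<Rightarrow> 'b \<Rightarrow> 'a) \<Rightarrow> bool" where
  "bilin sc B \<longleftrightarrow> (\<forall>x. linear_form sc (B x)) \<and> (\<forall>y. linear_form sc (\<lambda>x. B x y))"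

definition nondeg :: "('b::zero \<Rightarrow> 'b \<Rightarrow> 'a::zero) \<Rightarrow> 'b set \<Rightarrow> bool" where
  "nondeg B Q \<longleftrightarrow> (\<forall>x\<in>Q. (\<forall>y\<in>Q. B x y = 0) \<longrightarrow> x = 0)"

context vector_space
begin

lemma functional_add: "linear_form scale f \<Longrightarrow> f (x + y) = f x + f y"
  by (simp add: linear_form_def)

lemma functional_scale: "linear_form scale f \<Longrightarrow> f (c *s x) = c * f x"
  by (simp add: linear_form_def)

lemma functional_zero: "linear_form scale f \<Longrightarrow> f 0 = 0"
  using functional_scale[of f 0 0] by simp

lemma functional_minus: "linear_form scale f \<Longrightarrow> f (- x) = - f x"
  using functional_scale[of f "-1" x] by simp

lemma functional_diff: "linear_form scale f \<Longrightarrow> f (x - y) = f x - f y"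
  using functional_add[of f x "- y"] functional_minus[of f y] by simp

lemma functional_sum: "linear_form scale f \<Longrightarrow> f (\<Sum>i\<in>J. g i) = (\<Sum>i\<in>J. f (g i))"
  by (induction J rule: infinite_finite_induct) (simp_all add: functional_zero functional_add)

lemma functional_comb:
  "linear_form scale f \<Longrightarrow> f (\<Sum>i\<in>J. c i *s g i) = (\<Sum>i\<in>J. c i * f (g i))"
  by (simp add: functional_sum functional_scale)

lemma functional_sum_fun:
  assumes "\<And>j. j \<in> J \<Longrightarrow> linear_form scale (f j)"
  shows "linear_form scale (\<lambda>x. \<Sum>j\<in>J. c j * f j x)"
  using assms
  by (auto simp: linear_form_def algebra_simps sum.distrib sum_distrib_left intro!: sum.cong)

lemma functional_diff_fun:
  "linear_form scale f \<Longrightarrow> linear_form scale g \<Longrightarrow> linear_form scale (\<lambda>x. f x - g x)"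
  by (auto simp: linear_form_def algebra_simps)

text \<open>
  Induction on the family: pass to the kernel of one of the functionals \<open>f k\<close>; the difference that
  remains vanishes on that kernel and hence is a multiple of \<open>f k\<close>.
\<close>

lemma functional_vanishing_on_common_kernel:
  assumes "finite J" and "subspace Q" and "\<And>j. j \<in> J \<Longrightarrow> linear_form scale (f j)" and "linear_form scale h"
    and "\<And>x. x \<in> Q \<Longrightarrow> (\<forall>j\<in>J. f j x = 0) \<Longrightarrow> h x = 0"
  shows "\<exists>c. \<forall>x\<in>Q. h x = (\<Sum>j\<in>J. c j * f j x)"
  using assms
proof (induction J arbitrary: Q rule: finite_induct)
  case empty
  then show ?case by auto
next
  case (insert k J)
  define Qk where "Qk = {x \<in> Q. f k x = 0}"
  have fk: "linear_form scale (f k)" using insert.prems by simp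
  have "subspace Qk"
    using insert.prems(1) fk
    by (auto simp: subspace_def Qk_def functional_zero functional_add functional_scale)
  then obtain c where c: "\<forall>x\<in>Qk. h x = (\<Sum>j\<in>J. c j * f j x)"
    using insert.IH[of Qk] insert.prems unfolding Qk_def by auto
  define g where "g x = h x - (\<Sum>j\<in>J. c j * f j x)" for x
  have g: "linear_form scale g"
    unfolding g_def using insert.prems by (intro functional_diff_fun functional_sum_fun) auto
  show ?case
  proof (cases "\<exists>x0\<in>Q. f k x0 \<noteq> 0")
    case False
    then have "Qk = Q" by (auto simp: Qk_def)
    with c False insert.hyps show ?thesis
      by (intro exI[of _ c]) auto
  next
    case True
    then obtain x0 where x0: "x0 \<in> Q" "f k x0 \<noteq> 0" by blast
    define d where "d = g x0 / f k x0"
    have "g x = d * f k x" if "x \<in> Q" for x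
    proof -
      let ?z = "x - (f k x / f k x0) *s x0"
      have "?z \<in> Qk"
        using that x0 insert.prems(1) fk
        by (auto simp: Qk_def functional_diff functional_scale subspace_diff subspace_scale)
      then have "g ?z = 0" using c by (simp add: g_def)
      moreover have "g ?z = g x - (f k x / f k x0) * g x0"
        by (simp add: functional_diff[OF g] functional_scale[OF g])
      ultimately show ?thesis by (simp add: d_def)
    qed
    then have "h x = (\<Sum>j\<in>insert k J. (if j = k then d else c j) * f j x)" if "x \<in> Q" for x
    proof -
      have "(\<Sum>j\<in>J. (if j = k then d else c j) * f j x) = (\<Sum>j\<in>J. c j * f j x)"
        using insert.hyps by (intro sum.cong) auto
      with insert.hyps \<open>\<And>x. x \<in> Q \<Longrightarrow> g x = d * f k x\<close>[OF that] show ?thesis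
        by (simp add: algebra_simps g_def)
    qed
    then show ?thesis by (intro exI[of _ "\<lambda>j. if j = k then d else c j"]) simp
  qed
qed

lemma bilin_left: "bilin scale B \<Longrightarrow> linear_form scale (\<lambda>x. B x y)"
  and bilin_right: "bilin scale B \<Longrightarrow> linear_form scale (B x)"
  by (simp_all add: bilin_def)

text \<open>
  A nonzero vector \<open>x t\<close> in the radical of \<open>B + t B'\<close> satisfies \<open>B x = - t B' x\<close>, so it is an
  eigenvector of \<open>B\<inverse> B'\<close> for the eigenvalue \<open>- 1 / t\<close>. Eigenvectors for distinct eigenvalues are
  linearly independent, and so there are at most as many such \<open>t\<close> as the dimension allows. This is
  what makes generic functionals available over an infinite field.
\<close>

lemma nondeg_perturbation:
  assumes B: "bilin scale B" and B': "bilin scale B'" and Q: "subspace Q" and fin: "finite F" "Q \<subseteq> span F"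
    and nd: "nondeg B Q"
  shows "finite {t. \<not> nondeg (\<lambda>x y. B x y + t * B' x y) Q}" (is "finite ?T")
proof -
  note Bl = bilin_left[OF B] and B'l = bilin_left[OF B']
  have "\<exists>x. x \<in> Q \<and> x \<noteq> 0 \<and> (\<forall>y\<in>Q. B x y + t * B' x y = 0)" if "t \<in> ?T" for t
    using that by (auto simp: nondeg_def)
  then have "\<forall>t\<in>?T. \<exists>x. x \<in> Q \<and> x \<noteq> 0 \<and> (\<forall>y\<in>Q. B x y + t * B' x y = 0)" by blast
  from bchoice[OF this]
  obtain x where xQ: "\<And>t. t \<in> ?T \<Longrightarrow> x t \<in> Q" and x0: "\<And>t. t \<in> ?T \<Longrightarrow> x t \<noteq> 0"
    and x: "\<And>t y. t \<in> ?T \<Longrightarrow> y \<in> Q \<Longrightarrow> B (x t) y + t * B' (x t) y = 0"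
    by blast
  have nz: "t \<noteq> 0" if "t \<in> ?T" for t
    using that nd by (cases "t = 0") simp_all
  have eig: "B (x t) y = - (t * B' (x t) y)" if "t \<in> ?T" "y \<in> Q" for t y
    using x[OF that] unfolding eq_neg_iff_add_eq_0 .
  have indep: "\<forall>t\<in>J. c t = 0"
    if "finite J" "J \<subseteq> ?T" "(\<Sum>t\<in>J. c t *s x t) = 0" for J c
    using that
  proof (induction J arbitrary: c rule: finite_induct)
    case empty
    then show ?case by simp
  next
    case (insert k J)
    let ?J = "insert k J"
    have kT: "k \<in> ?T" and JT: "J \<subseteq> ?T" using insert.prems by auto
    let ?z = "\<Sum>t\<in>?J. (c t / t) *s x t"
    have "?z \<in> Q"
      using insert.prems(1) xQ by (intro subspace_sum[OF Q] subspace_scale[OF Q]) auto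
    moreover have "B ?z y = 0" if "y \<in> Q" for y
    proof -
      have "B ?z y = (\<Sum>t\<in>?J. (c t / t) * B (x t) y)" by (rule functional_comb[OF Bl])
      also have "\<dots> = (\<Sum>t\<in>?J. - (c t * B' (x t) y))"
        using insert.prems(1) nz eig[OF _ that] by (intro sum.cong) auto
      also have "\<dots> = - B' (\<Sum>t\<in>?J. c t *s x t) y"
        by (subst functional_comb[OF B'l]) (simp add: sum_negf)
      also have "\<dots> = 0" using insert.prems(2) functional_zero[OF B'l] by simp
      finally show ?thesis .
    qed
    ultimately have z: "?z = 0" using nd unfolding nondeg_def by blast
    have "(\<Sum>t\<in>J. (c t / t - c t / k) *s x t) = 0"
    proof -
      have "(\<Sum>t\<in>?J. (c t / t - c t / k) *s x t) = ?z - (1 / k) *s (\<Sum>t\<in>?J. c t *s x t)"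
        by (simp add: scale_left_diff_distrib sum_subtractf scale_sum_right divide_inverse mult.commute
            del: sum.insert)
      also have "\<dots> = 0" by (simp only: z insert.prems(2)) simp
      finally show ?thesis using insert.hyps nz[OF kT] by simp
    qed
    from insert.IH[OF JT this] have *: "\<forall>t\<in>J. c t / t - c t / k = 0" .
    have c0: "c t = 0" if "t \<in> J" for t
    proof -
      have "t \<noteq> k" "t \<noteq> 0" "k \<noteq> 0" using that insert.hyps nz JT kT by auto
      with * that show ?thesis by (auto simp: divide_simps split: if_splits)
    qed
    then have "c k *s x k = 0" using insert.prems(2) insert.hyps by simp
    then have "c k = 0" using x0[OF kT] by simp
    with c0 show ?case by auto
  qed
  have inj: "inj_on x ?T"
  proof (rule inj_onI, rule ccontr)
    fix s t assume st: "s \<in> ?T" "t \<in> ?T" "x s = x t" "s \<noteq> t"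
    have "(\<Sum>r\<in>{s, t}. (if r = s then 1 else - 1) *s x r) = 0" using st by simp
    from indep[OF _ _ this] st show False by force
  qed
  have ind: "independent (x ` J)" if J: "finite J" "J \<subseteq> ?T" for J
  proof (rule independent_if_scalars_zero)
    fix f y assume s: "(\<Sum>x\<in>x ` J. f x *s x) = 0" and y: "y \<in> x ` J"
    have "(\<Sum>t\<in>J. f (x t) *s x t) = 0"
      using s sum.reindex[OF inj_on_subset[OF inj J(2)], of "\<lambda>y. f y *s y"] by simp
    from indep[OF J this] y show "f y = 0" by auto
  qed (use J in auto)
  have "card J \<le> card F" if J: "finite J" "J \<subseteq> ?T" for J
  proof -
    have "x ` J \<subseteq> span F" using J xQ fin by auto
    from independent_span_bound[OF fin(1) ind[OF J] this]
    show ?thesis using card_image[OF inj_on_subset[OF inj J(2)]] by simp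
  qed
  then show ?thesis
    by (metis (no_types, lifting) infinite_arbitrarily_large not_less_eq_eq order_refl)
qed

text \<open>
  Symplectic reduction along the isotropic subspace \<open>V\<close> with orthogonal space \<open>U\<close>. If \<open>x\<close> is in the
  radical of \<open>U\<close>, then \<open>B x\<close> vanishes on the common kernel of the functionals \<open>B v\<close> and so agrees
  with one of them on all of \<open>Q\<close>.
\<close>

lemma nondeg_reduction:
  assumes B: "bilin scale B" and skew: "\<And>x y. x \<in> Q \<Longrightarrow> y \<in> Q \<Longrightarrow> B y x = - B x y"
    and Q: "subspace Q" and F: "finite F" "F \<subseteq> V" and V: "subspace V" "V \<subseteq> Q" "V \<subseteq> span F"
    and iso: "\<And>v w. v \<in> V \<Longrightarrow> w \<in> V \<Longrightarrow> B v w = 0"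
    and U: "U = {x \<in> Q. \<forall>v\<in>V. B x v = 0}"
  shows "nondeg B Q \<longleftrightarrow>
    (\<forall>v\<in>V. (\<forall>x\<in>Q. B v x = 0) \<longrightarrow> v = 0) \<and> (\<forall>x\<in>U. (\<forall>y\<in>U. B x y = 0) \<longrightarrow> x \<in> V)"
proof (intro iffI conjI ballI impI)
  fix v assume "nondeg B Q" "v \<in> V" "\<forall>x\<in>Q. B v x = 0"
  with V show "v = 0" by (auto simp: nondeg_def)
next
  fix x assume nd: "nondeg B Q" and x: "x \<in> U" "\<forall>y\<in>U. B x y = 0"
  have xQ: "x \<in> Q" using x U by auto
  have "\<exists>c. \<forall>y\<in>Q. B x y = (\<Sum>v\<in>F. c v * B v y)"
  proof (rule functional_vanishing_on_common_kernel)
    fix y assume y: "y \<in> Q" "\<forall>v\<in>F. B v y = 0"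
    have "B y v = 0" if "v \<in> V" for v
    proof -
      have "v \<in> span F" using that V by auto
      then show ?thesis
      proof (rule span_induct_alt)
        show "B y 0 = 0" using functional_zero[OF bilin_right[OF B]] .
        fix c z w assume "z \<in> F" "B y w = 0"
        moreover have "B y z = - B z y" using skew[of z y] y F V \<open>z \<in> F\<close> by auto
        ultimately show "B y (c *s z + w) = 0"
          using y functional_add[OF bilin_right[OF B]] functional_scale[OF bilin_right[OF B]] by simp
      qed
    qed
    with x y U show "B x y = 0" by simp
  qed (use F Q bilin_right[OF B] in auto)
  then obtain c where c: "\<And>y. y \<in> Q \<Longrightarrow> B x y = (\<Sum>v\<in>F. c v * B v y)" by blast
  let ?w = "\<Sum>v\<in>F. c v *s v"
  have w: "?w \<in> V" using F V by (intro subspace_sum subspace_scale) auto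
  have "x - ?w \<in> Q" using w xQ V Q by (intro subspace_diff) auto
  moreover have "B (x - ?w) y = 0" if "y \<in> Q" for y
    using c[OF that] functional_diff[OF bilin_left[OF B]]
      functional_comb[OF bilin_left[OF B], of c "\<lambda>v. v" F]
    by simp
  ultimately have "x - ?w = 0" using nd unfolding nondeg_def by blast
  with w show "x \<in> V" by simp
next
  assume a: "(\<forall>v\<in>V. (\<forall>x\<in>Q. B v x = 0) \<longrightarrow> v = 0) \<and> (\<forall>x\<in>U. (\<forall>y\<in>U. B x y = 0) \<longrightarrow> x \<in> V)"
  show "nondeg B Q"
    unfolding nondeg_def
  proof (intro ballI impI)
    fix x assume x: "x \<in> Q" "\<forall>y\<in>Q. B x y = 0"
    then have "x \<in> U" "\<forall>y\<in>U. B x y = 0" using U V by auto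
    with a have "x \<in> V" by blast
    with a x show "x = 0" by blast
  qed
qed

end

text \<open>
  The quotient of the orthogonal space of \<open>V\<close> by \<open>V\<close> is replaced by any model \<open>Q'\<close> mapping to a
  complement of \<open>V\<close> in that orthogonal space.
\<close>

lemma nondeg_reduction_iso:
  fixes sc :: "'a :: field \<Rightarrow> 'v :: ab_group_add \<Rightarrow> 'v" and sc' :: "'a \<Rightarrow> 'w :: ab_group_add \<Rightarrow> 'w"
  assumes vs: "vector_space sc" and vs': "vector_space sc'"
    and B: "bilin sc B" and skew: "\<And>x y. x \<in> Q \<Longrightarrow> y \<in> Q \<Longrightarrow> B y x = - B x y"
    and Q: "module.subspace sc Q" and F: "finite F" "F \<subseteq> V"
    and V: "module.subspace sc V" "V \<subseteq> Q" "V \<subseteq> module.span sc F"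
    and iso: "\<And>v w. v \<in> V \<Longrightarrow> w \<in> V \<Longrightarrow> B v w = 0"
    and \<pi>Q: "\<And>z. z \<in> Q' \<Longrightarrow> \<pi> z \<in> Q"
    and \<pi>V: "\<And>z v. z \<in> Q' \<Longrightarrow> v \<in> V \<Longrightarrow> B (\<pi> z) v = 0"
    and onto: "\<And>x. x \<in> Q \<Longrightarrow> (\<forall>v\<in>V. B x v = 0) \<Longrightarrow> \<exists>z\<in>Q'. x - \<pi> z \<in> V"
    and inj: "\<And>z. z \<in> Q' \<Longrightarrow> \<pi> z \<in> V \<Longrightarrow> z = 0"
    and zero: "\<pi> 0 \<in> V"
    and comp: "\<And>z z'. z \<in> Q' \<Longrightarrow> z' \<in> Q' \<Longrightarrow> B (\<pi> z) (\<pi> z') = B' z z'"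
  shows "nondeg B Q \<longleftrightarrow>
    (\<forall>v\<in>V. (\<forall>x\<in>Q. B v x = 0) \<longrightarrow> v = 0) \<and> nondeg B' Q'"
proof -
  interpret vector_space sc by fact
  interpret W: vector_space sc' by fact
  define U where "U = {x \<in> Q. \<forall>v\<in>V. B x v = 0}"
  note red = nondeg_reduction[OF B skew Q F V iso U_def]
  have VU: "v \<in> U" if "v \<in> V" for v using that V iso by (auto simp: U_def)
  have sU: "B y v = 0" "B v y = 0" if "v \<in> V" "y \<in> U" for v y
  proof -
    show "B y v = 0" using that by (auto simp: U_def)
    then show "B v y = 0" using skew[of y v] that V by (auto simp: U_def)
  qed
  have dec: "B x y = B' z z'"
    if "x \<in> U" "y \<in> U" "z \<in> Q'" "z' \<in> Q'" "x - \<pi> z \<in> V" "y - \<pi> z' \<in> V" for x y z z'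
  proof -
    have "\<pi> z \<in> U" "\<pi> z' \<in> U" using that \<pi>Q \<pi>V by (auto simp: U_def)
    then have "B (x - \<pi> z) y = 0" "B (\<pi> z) (y - \<pi> z') = 0" using sU that by blast+
    then have "B x y = B (\<pi> z) y" "B (\<pi> z) y = B (\<pi> z) (\<pi> z')"
      by (simp_all add: functional_diff[OF bilin_left[OF B]] functional_diff[OF bilin_right[OF B]])
    with comp that show ?thesis by simp
  qed
  have eq: "(\<forall>x\<in>U. (\<forall>y\<in>U. B x y = 0) \<longrightarrow> x \<in> V) \<longleftrightarrow> nondeg B' Q'"
  proof
    assume a: "\<forall>x\<in>U. (\<forall>y\<in>U. B x y = 0) \<longrightarrow> x \<in> V"
    show "nondeg B' Q'" unfolding nondeg_def
    proof (intro ballI impI)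
      fix z assume z: "z \<in> Q'" "\<forall>y\<in>Q'. B' z y = 0"
      have zU: "\<pi> z \<in> U" using z \<pi>Q \<pi>V by (auto simp: U_def)
      have "B (\<pi> z) y = 0" if "y \<in> U" for y
      proof -
        obtain z' where z': "z' \<in> Q'" "y - \<pi> z' \<in> V"
          using onto[of y] \<open>y \<in> U\<close> unfolding U_def by blast
        have "\<pi> z - \<pi> z \<in> V" using V(1) by (simp add: subspace_0)
        from dec[OF zU \<open>y \<in> U\<close> z(1) z'(1) this z'(2)] z z' show ?thesis by simp
      qed
      with a zU have "\<pi> z \<in> V" by blast
      with inj z show "z = 0" by blast
    qed
  next
    assume nd: "nondeg B' Q'"
    show "\<forall>x\<in>U. (\<forall>y\<in>U. B x y = 0) \<longrightarrow> x \<in> V"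
    proof (intro ballI impI)
      fix x assume x: "x \<in> U" "\<forall>y\<in>U. B x y = 0"
      have "\<exists>z\<in>Q'. x - \<pi> z \<in> V" using onto[of x] x(1) by (simp add: U_def)
      then obtain z where z: "z \<in> Q'" "x - \<pi> z \<in> V" by blast
      have "B' z z' = 0" if "z' \<in> Q'" for z'
      proof -
        have "\<pi> z' \<in> U" using that \<pi>Q \<pi>V by (auto simp: U_def)
        moreover have "\<pi> z' - \<pi> z' \<in> V" using V(1) by (simp add: subspace_0)
        ultimately show ?thesis using dec[OF x(1) _ z(1) that z(2)] x by auto
      qed
      then have "z = 0" using nd z by (auto simp: nondeg_def)
      then have "\<pi> z \<in> V" using zero by simp
      then have "(x - \<pi> z) + \<pi> z \<in> V" using z V(1) subspace_add by blast
      then show "x \<in> V" by simp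
    qed
  qed
  show ?thesis by (simp only: red eq)
qed

section \<open>Matrices over finite index sets\<close>

text \<open>
  Matrices are total functions of two indices, with a finite set \<open>I\<close> of indices given separately: the
  induction deletes indices, and the algebra on the smaller index set has to be of the same type.
\<close>

type_synonym 'a mt = "nat \<Rightarrow> nat \<Rightarrow> 'a"

definition mscale :: "'a::field \<Rightarrow> 'a mt \<Rightarrow> 'a mt" where
  "mscale c x = (\<lambda>i j. c * x i j)"

definition pscale :: "'a::field \<Rightarrow> 'a mt \<times> 'a mt \<Rightarrow> 'a mt \<times> 'a mt" where
  "pscale c p = (mscale c (fst p), mscale c (snd p))"

lemma mscale_apply [simp]: "mscale c x i j = c * x i j"
  by (simp add: mscale_def)

lemma pscale_Pair [simp]: "pscale c (x, s) = (mscale c x, mscale c s)"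
  by (simp add: pscale_def)

lemma mt_eqI: "(\<And>i j. x i j = y i j) \<Longrightarrow> (x :: 'a mt) = y"
  by (intro ext)

lemma vector_space_mscale: "vector_space (mscale :: 'a::field \<Rightarrow> 'a mt \<Rightarrow> 'a mt)"
  by unfold_locales (auto intro!: mt_eqI simp: algebra_simps)

lemma vector_space_pscale: "vector_space (pscale :: 'a::field \<Rightarrow> 'a mt \<times> 'a mt \<Rightarrow> 'a mt \<times> 'a mt)"
  by unfold_locales (auto intro!: mt_eqI prod_eqI simp: algebra_simps pscale_def)

interpretation M: vector_space "mscale :: 'a::field \<Rightarrow> 'a mt \<Rightarrow> 'a mt"
  by (rule vector_space_mscale)

interpretation P: vector_space "pscale :: 'a::field \<Rightarrow> 'a mt \<times> 'a mt \<Rightarrow> 'a mt \<times> 'a mt"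
  by (rule vector_space_pscale)

definition mmul :: "nat set \<Rightarrow> 'a::field mt \<Rightarrow> 'a mt \<Rightarrow> 'a mt" where
  "mmul I x y = (\<lambda>i j. \<Sum>k\<in>I. x i k * y k j)"

definition comm :: "nat set \<Rightarrow> 'a::field mt \<Rightarrow> 'a mt \<Rightarrow> 'a mt" where
  "comm I x y = mmul I x y - mmul I y x"

definition supp :: "(nat \<times> nat) set \<Rightarrow> 'a::field mt set" where
  "supp R = {x. \<forall>i j. x i j \<noteq> 0 \<longrightarrow> (i, j) \<in> R}"

definition unit_mt :: "nat \<Rightarrow> nat \<Rightarrow> 'a::field mt" where
  "unit_mt a b = (\<lambda>i j. if i = a \<and> j = b then 1 else 0)"

lemma unit_mt_apply: "unit_mt a b i j = (if i = a \<and> j = b then 1 else 0)"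
  by (simp add: unit_mt_def)

lemma mmul_apply: "mmul I x y i j = (\<Sum>k\<in>I. x i k * y k j)"
  by (simp add: mmul_def)

lemma mmul_add_left: "mmul I (x + y) z = mmul I x z + mmul I y z"
  and mmul_add_right: "mmul I x (y + z) = mmul I x y + mmul I x z"
  and mmul_scale_left: "mmul I (mscale c x) y = mscale c (mmul I x y)"
  and mmul_scale_right: "mmul I x (mscale c y) = mscale c (mmul I x y)"
  by (auto intro!: mt_eqI simp: mmul_def algebra_simps sum.distrib sum_distrib_left)

lemma mmul_diff_left: "mmul I (x - y) z = mmul I x z - mmul I y z"
  and mmul_diff_right: "mmul I x (y - z) = mmul I x y - mmul I x z"
  by (auto intro!: mt_eqI simp: mmul_def algebra_simps sum_subtractf)

lemma mmul_assoc: "mmul I (mmul I x y) z = mmul I x (mmul I y z)"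
proof (rule mt_eqI)
  fix i j
  have "mmul I (mmul I x y) z i j = (\<Sum>k\<in>I. \<Sum>l\<in>I. x i l * y l k * z k j)"
    by (simp add: mmul_def sum_distrib_right)
  also have "\<dots> = (\<Sum>l\<in>I. \<Sum>k\<in>I. x i l * y l k * z k j)" by (rule sum.swap)
  also have "\<dots> = mmul I x (mmul I y z) i j"
    by (simp add: mmul_def sum_distrib_left mult.assoc)
  finally show "mmul I (mmul I x y) z i j = mmul I x (mmul I y z) i j" .
qed

lemma mmul_unit_left:
  "finite I \<Longrightarrow> l \<in> I \<Longrightarrow> mmul I (unit_mt k l) x i j = (if i = k then x l j else 0)"
  by (simp add: mmul_def unit_mt_def if_distrib[of "\<lambda>t. t * _"] cong: if_cong)

lemma mmul_unit_right:
  "finite I \<Longrightarrow> k \<in> I \<Longrightarrow> mmul I x (unit_mt k l) i j = (if j = l then x i k else 0)"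
  by (simp add: mmul_def unit_mt_def if_distrib[of "\<lambda>t. _ * t"] cong: if_cong)

lemma suppI: "(\<And>i j. x i j \<noteq> 0 \<Longrightarrow> (i, j) \<in> R) \<Longrightarrow> x \<in> supp R"
  by (auto simp: supp_def)

lemma suppD: "x \<in> supp R \<Longrightarrow> x i j \<noteq> 0 \<Longrightarrow> (i, j) \<in> R"
  by (auto simp: supp_def)

lemma supp_zero: "x \<in> supp R \<Longrightarrow> (i, j) \<notin> R \<Longrightarrow> x i j = 0"
  by (auto simp: supp_def)

lemma supp_mono: "R \<subseteq> R' \<Longrightarrow> supp R \<subseteq> supp R'"
  by (auto simp: supp_def)

lemma unit_mt_supp: "(a, b) \<in> R \<Longrightarrow> unit_mt a b \<in> supp R"
  by (auto simp: supp_def unit_mt_def split: if_splits)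

lemma subspace_supp: "M.subspace (supp R)"
  unfolding M.subspace_def
proof (intro conjI ballI allI)
  fix x y :: "'a mt" assume xy: "x \<in> supp R" "y \<in> supp R"
  show "x + y \<in> supp R"
  proof (rule suppI)
    fix i j assume "(x + y) i j \<noteq> 0"
    then have "x i j \<noteq> 0 \<or> y i j \<noteq> 0" by auto
    then show "(i, j) \<in> R" using xy by (auto dest: suppD)
  qed
qed (auto simp: supp_def)

lemma mmul_supp:
  assumes "trans R" "x \<in> supp R" "y \<in> supp R" shows "mmul I x y \<in> supp R"
proof (rule suppI)
  fix i j assume "mmul I x y i j \<noteq> 0"
  then obtain k where "x i k * y k j \<noteq> 0" by (auto simp: mmul_def elim: sum.not_neutral_contains_not_neutral)
  then have "(i, k) \<in> R" "(k, j) \<in> R" using assms by (auto dest: suppD)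
  with assms show "(i, j) \<in> R" by (meson transD)
qed

lemma sum_fun_apply: "(\<Sum>k\<in>K. f k) i = (\<Sum>k\<in>K. f k i)"
  by (induction K rule: infinite_finite_induct) auto

lemma supp_expand:
  assumes "finite R" "x \<in> supp R"
  shows "x = (\<Sum>(a, b)\<in>R. mscale (x a b) (unit_mt a b))"
proof (rule mt_eqI)
  fix i j
  have "(\<Sum>(a, b)\<in>R. mscale (x a b) (unit_mt a b)) i j = (\<Sum>p\<in>R. if p = (i, j) then x i j else 0)"
    by (auto simp: sum_fun_apply case_prod_unfold unit_mt_def intro!: sum.cong)
  also have "\<dots> = x i j" using assms by (auto simp: supp_zero)
  finally show "x i j = (\<Sum>(a, b)\<in>R. mscale (x a b) (unit_mt a b)) i j" by simp
qed

definition units :: "(nat \<times> nat) set \<Rightarrow> 'a::field mt set" where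
  "units R = (\<lambda>(a, b). unit_mt a b) ` R"

lemma supp_span: "finite R \<Longrightarrow> supp R \<subseteq> M.span (units R)"
proof
  fix x :: "'a mt" assume R: "finite R" and x: "x \<in> supp R"
  have "(\<Sum>(a, b)\<in>R. mscale (x a b) (unit_mt a b)) \<in> M.span (units R)"
    unfolding units_def by (intro M.span_sum) (auto intro!: M.span_scale intro: M.span_base)
  with supp_expand[OF R x] show "x \<in> M.span (units R)" by simp
qed

lemma span_left:
  assumes "x \<in> M.span U" "(\<lambda>x. (x, 0)) ` U \<subseteq> G" shows "(x, 0) \<in> P.span G"
  using assms(1)
proof (induction rule: M.span_induct_alt)
  case base
  show ?case using P.span_zero by (metis zero_prod_def)
next
  case (step c x y)
  have "(x, 0) \<in> G" using step.hyps assms(2) by blast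
  with step have "pscale c (x, 0) + (y, 0) \<in> P.span G"
    by (blast intro: P.span_add P.span_scale P.span_base)
  moreover have "pscale c (x, 0) + (y, 0) = (mscale c x + y, 0)"
    by (simp add: prod_eq_iff M.scale_zero_right)
  ultimately show ?case by metis
qed

lemma span_right:
  assumes "x \<in> M.span U" "Pair 0 ` U \<subseteq> G" shows "(0, x) \<in> P.span G"
  using assms(1)
proof (induction rule: M.span_induct_alt)
  case base
  show ?case using P.span_zero by (metis zero_prod_def)
next
  case (step c x y)
  have "(0, x) \<in> G" using step.hyps assms(2) by blast
  with step have "pscale c (0, x) + (0, y) \<in> P.span G"
    by (blast intro: P.span_add P.span_scale P.span_base)
  moreover have "pscale c (0, x) + (0, y) = (0, mscale c x + y)"
    by (simp add: prod_eq_iff M.scale_zero_right)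
  ultimately show ?case by metis
qed

lemma subspace_Times: "M.subspace X \<Longrightarrow> M.subspace Y \<Longrightarrow> P.subspace (X \<times> Y)"
  unfolding P.subspace_def M.subspace_def by (auto simp only: mem_Times_iff zero_prod_def pscale_def fst_conv snd_conv fst_add snd_add)

section \<open>Semidirect products\<close>

text \<open>
  The bracket of the semidirect product of matrices with a space \<open>S\<close> of matrices on which \<open>y\<close> acts
  from the right by \<open>s \<mapsto> \<rho> y s\<close>, as in \<open>s \<mapsto> s y + y\<^sup>T s\<close>; this is where the order of the two terms
  comes from.
\<close>

definition sbr :: "nat set \<Rightarrow> ('a::field mt \<Rightarrow> 'a mt \<Rightarrow> 'a mt) \<Rightarrow> 'a mt \<times> 'a mt \<Rightarrow> 'a mt \<times> 'a mt \<Rightarrow> 'a mt \<times> 'a mt"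
  where "sbr I \<rho> p q = (comm I (fst p) (fst q), \<rho> (fst q) (snd p) - \<rho> (fst p) (snd q))"

definition frob :: "nat set \<Rightarrow> (nat \<times> nat) set \<Rightarrow> ('a::field mt \<Rightarrow> 'a mt \<Rightarrow> 'a mt) \<Rightarrow> 'a mt set \<Rightarrow> bool" where
  "frob I R \<rho> S \<longleftrightarrow>
     (\<exists>\<gamma>. linear_form pscale \<gamma> \<and> nondeg (\<lambda>p q. \<gamma> (sbr I \<rho> p q)) (supp R \<times> S))"

text \<open>
  The module sees only the \<open>L \<times> L\<close> corner of a matrix, so that changes away from \<open>L\<close> leave it alone.
\<close>

locale local_action =
  fixes \<rho> :: "'a::field mt \<Rightarrow> 'a mt \<Rightarrow> 'a mt" and L :: "nat set" and S :: "'a mt set"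
  assumes act_add_left: "\<rho> (x + y) s = \<rho> x s + \<rho> y s"
    and act_add_right: "\<rho> x (s + t) = \<rho> x s + \<rho> x t"
    and act_scale_left: "\<rho> (mscale c x) s = mscale c (\<rho> x s)"
    and act_scale_right: "\<rho> x (mscale c s) = mscale c (\<rho> x s)"
    and act_local: "(\<And>i j. i \<in> L \<Longrightarrow> j \<in> L \<Longrightarrow> x i j = y i j) \<Longrightarrow> \<rho> x s = \<rho> y s"
    and S_subspace: "M.subspace S"
    and S_fin: "\<exists>F. finite F \<and> S \<subseteq> M.span F"
begin

lemma act_zero_right: "\<rho> x 0 = 0"
  using act_scale_right[of x 0 0] by simp

lemma act_vanish: "(\<And>i j. i \<in> L \<Longrightarrow> j \<in> L \<Longrightarrow> x i j = 0) \<Longrightarrow> \<rho> x s = 0"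
  using act_local[of x "mscale 0 x" s] act_scale_left[of 0 x s] by simp

lemma sbr_bilinear:
  shows "sbr I \<rho> (p + p') q = sbr I \<rho> p q + sbr I \<rho> p' q"
    and "sbr I \<rho> p (q + q') = sbr I \<rho> p q + sbr I \<rho> p q'"
    and "sbr I \<rho> (pscale c p) q = pscale c (sbr I \<rho> p q)"
    and "sbr I \<rho> p (pscale c q) = pscale c (sbr I \<rho> p q)"
  by (auto simp: sbr_def comm_def mmul_add_left mmul_add_right mmul_scale_left mmul_scale_right
      act_add_left act_add_right act_scale_left act_scale_right pscale_def M.scale_right_diff_distrib)

lemma bilin_sbr: "linear_form pscale \<gamma> \<Longrightarrow> bilin pscale (\<lambda>p q. \<gamma> (sbr I \<rho> p q))"
  by (simp add: bilin_def linear_form_def sbr_bilinear del: split_paired_All)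

lemma sbr_skew: "sbr I \<rho> q p = - sbr I \<rho> p q"
  by (simp add: sbr_def comm_def)

lemma subspace_prod: "P.subspace (supp R \<times> S)"
  by (intro subspace_Times subspace_supp S_subspace)

lemma prod_span: "finite R \<Longrightarrow> \<exists>F. finite F \<and> supp R \<times> S \<subseteq> P.span F"
proof -
  assume R: "finite R"
  obtain F where F: "finite F" "S \<subseteq> M.span F" using S_fin by blast
  let ?F = "(\<lambda>x. (x, 0)) ` units R \<union> Pair 0 ` F"
  have "supp R \<times> S \<subseteq> P.span ?F"
  proof (rule subsetI)
    fix p :: "'a mt \<times> 'a mt" assume "p \<in> supp R \<times> S"
    then have p: "fst p \<in> M.span (units R)" "snd p \<in> M.span F" using supp_span[OF R] F by auto
    have "(fst p, 0) + (0, snd p) \<in> P.span ?F"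
      by (intro P.span_add span_left[OF p(1)] span_right[OF p(2)]) auto
    moreover have "(fst p, 0) + (0, snd p) = p" by (simp add: prod_eq_iff)
    ultimately show "p \<in> P.span ?F" by metis
  qed
  moreover have "finite ?F" using R F by (auto simp: units_def)
  ultimately show ?thesis by blast
qed

end

section \<open>The reduction step\<close>

text \<open>
  One step of Panyushev's reduction. In a seaweed \<open>A\<close> is the smaller of the two first blocks and \<open>A
  \<union> W\<close> the larger one, so that the matrices supported on \<open>A \<times> W\<close> form an abelian ideal \<open>V\<close>. A
  functional in general position pairs \<open>A\<close> with \<open>W\<close> with maximal rank; after a change of basis it is
  the trace of the pairing \<open>\<sigma>\<close> of \<open>A2\<close> with \<open>W2\<close>. Maximality of the rank is the dichotomy \<open>A2 = A\<close>
  or \<open>W2 = W\<close>.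

  Orthogonality to \<open>V\<close> ties the rows and columns of a matrix at \<open>A2\<close> to those at \<open>W2\<close>. The indices
  in \<open>A2\<close> can therefore be dropped, which leaves \<open>I'\<close>, while the block \<open>W\<close> is cut into \<open>W - W2\<close> and
  \<open>W2\<close>, which leaves \<open>R'\<close>. The map \<open>\<pi>\<close> restores the dropped rows and columns by copying those of the
  partners in \<open>W2\<close> (\<open>\<tau>\<close> sends an index to its partner), \<open>\<kappa>\<close> is a left inverse of \<open>\<pi>\<close>, and \<open>\<pi>\<close>
  identifies the algebra on \<open>I'\<close> with a complement of \<open>V\<close> in its orthogonal space.
\<close>

locale block_reduction = local_action \<rho> L S for \<rho> :: "'a::field mt \<Rightarrow> 'a mt \<Rightarrow> 'a mt" and L S +
  fixes I :: "nat set" and R :: "(nat \<times> nat) set" and A W A2 W2 :: "nat set" and \<sigma> :: "nat \<Rightarrow> nat"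
  assumes finI: "finite I" and RI: "R \<subseteq> I \<times> I" and transR: "trans R" and reflR: "i \<in> I \<Longrightarrow> (i, i) \<in> R"
    and AI: "A \<subseteq> I" and WI: "W \<subseteq> I" and disj: "A \<inter> W = {}" and Ane: "A \<noteq> {}"
    and rowA: "(i, j) \<in> R \<Longrightarrow> i \<in> A \<Longrightarrow> j \<in> A \<union> W" and colA: "(i, j) \<in> R \<Longrightarrow> j \<in> A \<Longrightarrow> i \<in> A"
    and AA: "A \<times> A \<subseteq> R" and AW: "A \<times> W \<subseteq> R"
    and A2: "A2 \<subseteq> A" and W2: "W2 \<subseteq> W" and \<sigma>: "bij_betw \<sigma> A2 W2"
    and dich: "(A2 = A \<and> (W - W2) \<times> W2 \<subseteq> R) \<or> W2 = W"
    and LA: "L \<inter> A = {}"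
begin

definition "I' = I - A2"
definition "R' = {(i, j) \<in> R. i \<notin> A2 \<and> j \<notin> A2 \<and> \<not> (i \<in> W - W2 \<and> j \<in> W2)}"
definition "\<tau> i = (if i \<in> A2 then \<sigma> i else i)"
definition "\<sigma>' = inv_into A2 \<sigma>"
definition \<pi> :: "'a mt \<Rightarrow> 'a mt" where
  "\<pi> z = (\<lambda>i j. if (i \<in> A) = (j \<in> A) then z (\<tau> i) (\<tau> j) else 0)"
definition \<kappa> :: "'a mt \<Rightarrow> 'a mt" where
  "\<kappa> x = (\<lambda>i j. if i \<in> A - A2 \<and> j \<in> W2 then x i (\<sigma>' j) else if (i, j) \<in> R' then x i j else 0)"

lemma rowW: "(i, j) \<in> R \<Longrightarrow> i \<in> W \<Longrightarrow> j \<in> W"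
proof -
  assume ij: "(i, j) \<in> R" "i \<in> W"
  obtain a where "a \<in> A" using Ane by blast
  then have "(a, j) \<in> R" using AW ij transR by (meson SigmaI subsetD transD)
  with rowA \<open>a \<in> A\<close> colA ij disj show "j \<in> W" by blast
qed

lemma \<sigma>W: "i \<in> A2 \<Longrightarrow> \<sigma> i \<in> W2" and \<sigma>'A: "j \<in> W2 \<Longrightarrow> \<sigma>' j \<in> A2"
  and \<sigma>\<sigma>': "j \<in> W2 \<Longrightarrow> \<sigma> (\<sigma>' j) = j" and \<sigma>'\<sigma>: "i \<in> A2 \<Longrightarrow> \<sigma>' (\<sigma> i) = i"
  using \<sigma> by (auto simp: \<sigma>'_def bij_betw_def inv_into_into f_inv_into_f inv_into_f_f)

lemma notA: "j \<in> W2 \<Longrightarrow> j \<notin> A" "j \<in> W2 \<Longrightarrow> j \<notin> A2" "j \<in> W \<Longrightarrow> j \<notin> A"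
  using A2 W2 disj by blast+

lemma R'R: "(i, j) \<in> R' \<Longrightarrow> (i, j) \<in> R"
  by (simp add: R'_def)

lemma finR: "finite R"
  using RI finI by (meson finite_SigmaI finite_subset)

lemma \<pi>_add: "\<pi> (x + y) = \<pi> x + \<pi> y" and \<pi>_diff: "\<pi> (x - y) = \<pi> x - \<pi> y"
  and \<pi>_scale: "\<pi> (mscale c x) = mscale c (\<pi> x)"
  by (auto intro!: mt_eqI simp: \<pi>_def)

lemma \<kappa>_add: "\<kappa> (x + y) = \<kappa> x + \<kappa> y" and \<kappa>_scale: "\<kappa> (mscale c x) = mscale c (\<kappa> x)"
  by (auto intro!: mt_eqI simp: \<kappa>_def)

lemma \<tau>A: "i \<in> A \<Longrightarrow> \<tau> i \<in> (A - A2) \<union> W2"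
  using \<sigma>W by (auto simp: \<tau>_def)

lemma \<tau>_id: "i \<notin> A \<Longrightarrow> \<tau> i = i"
  using A2 by (auto simp: \<tau>_def)

lemma \<tau>_image: "\<tau> ` A = (A - A2) \<union> W2"
proof
  show "\<tau> ` A \<subseteq> (A - A2) \<union> W2" using \<tau>A by blast
  show "(A - A2) \<union> W2 \<subseteq> \<tau> ` A"
  proof
    fix j assume "j \<in> (A - A2) \<union> W2"
    then show "j \<in> \<tau> ` A"
    proof
      assume "j \<in> A - A2"
      then show ?thesis by (intro image_eqI[of _ _ j]) (auto simp: \<tau>_def)
    next
      assume "j \<in> W2"
      then show ?thesis using \<sigma>'A \<sigma>\<sigma>' A2
        by (intro image_eqI[of _ _ "\<sigma>' j"]) (auto simp: \<tau>_def)
    qed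
  qed
qed

lemma \<tau>_inj: "inj_on \<tau> A"
proof (rule inj_onI)
  fix i j assume "i \<in> A" "j \<in> A" "\<tau> i = \<tau> j"
  then show "i = j"
    using \<sigma>'\<sigma> \<sigma>W notA unfolding \<tau>_def by (metis (full_types))
qed

lemma \<pi>_supp: "z \<in> supp R' \<Longrightarrow> \<pi> z \<in> supp R"
proof (rule suppI)
  fix i j assume z: "z \<in> supp R'" and nz: "\<pi> z i j \<noteq> 0"
  then have s: "(i \<in> A) = (j \<in> A)" "z (\<tau> i) (\<tau> j) \<noteq> 0" by (auto simp: \<pi>_def split: if_splits)
  show "(i, j) \<in> R"
  proof (cases "i \<in> A")
    case True
    then show ?thesis using s AA by blast
  next
    case False
    then show ?thesis using s \<tau>_id suppD[OF z s(2)] R'R by auto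
  qed
qed

lemma \<pi>_mmul:
  assumes z: "z \<in> supp R'" and z': "z' \<in> supp R'"
  shows "mmul I (\<pi> z) (\<pi> z') = \<pi> (mmul I' z z')"
proof (rule mt_eqI)
  fix i j
  consider "i \<in> A" "j \<in> A" | "i \<notin> A" "j \<notin> A" | "(i \<in> A) \<noteq> (j \<in> A)" by blast
  then show "mmul I (\<pi> z) (\<pi> z') i j = \<pi> (mmul I' z z') i j"
  proof cases
    case 1
    \<comment> \<open>An index outside the image of \<open>\<tau>\<close> contributes only if it is in \<open>W - W2\<close> and sits between two
      elements of \<open>W2\<close>, but \<open>R'\<close> has no entries from \<open>W - W2\<close> to \<open>W2\<close>.\<close>
    have zero: "z (\<tau> i) k * z' k (\<tau> j) = 0" if k: "k \<in> I' - \<tau> ` A" for k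
    proof (rule ccontr)
      assume "z (\<tau> i) k * z' k (\<tau> j) \<noteq> 0"
      then have r: "(\<tau> i, k) \<in> R'" "(k, \<tau> j) \<in> R'" using z z' by (auto dest: suppD)
      have k2: "k \<notin> A" "k \<notin> W2" using k unfolding \<tau>_image I'_def by auto
      have "\<tau> i \<in> W2"
      proof (rule ccontr)
        assume "\<tau> i \<notin> W2"
        then have "\<tau> i \<in> A - A2" using \<tau>A 1 by blast
        then show False using rowA[OF R'R[OF r(1)]] k2 dich by blast
      qed
      then have kW: "k \<in> W - W2" using rowW[OF R'R[OF r(1)]] W2 k2 by blast
      have "\<tau> j \<in> W2"
      proof (rule ccontr)
        assume "\<tau> j \<notin> W2"
        then have "\<tau> j \<in> A" using \<tau>A 1 by blast
        then show False using colA[OF R'R[OF r(2)]] k2 by blast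
      qed
      with r(2) kW show False by (auto simp: R'_def)
    qed
    have "mmul I (\<pi> z) (\<pi> z') i j = (\<Sum>k\<in>A. \<pi> z i k * \<pi> z' k j)"
      unfolding mmul_apply using 1 finI AI
      by (intro sum.mono_neutral_right) (auto simp: \<pi>_def)
    also have "\<dots> = (\<Sum>k\<in>A. z (\<tau> i) (\<tau> k) * z' (\<tau> k) (\<tau> j))"
      using 1 by (intro sum.cong) (auto simp: \<pi>_def)
    also have "\<dots> = (\<Sum>k\<in>\<tau> ` A. z (\<tau> i) k * z' k (\<tau> j))"
      by (simp add: sum.reindex[OF \<tau>_inj])
    also have "\<dots> = (\<Sum>k\<in>I'. z (\<tau> i) k * z' k (\<tau> j))"
      using zero finI AI WI W2 notA
      by (intro sum.mono_neutral_left) (auto simp: \<tau>_image I'_def)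
    finally show ?thesis using 1 by (simp add: \<pi>_def mmul_apply)
  next
    case 2
    have "mmul I (\<pi> z) (\<pi> z') i j = (\<Sum>k\<in>I - A. \<pi> z i k * \<pi> z' k j)"
      unfolding mmul_apply using 2 finI
      by (intro sum.mono_neutral_right) (auto simp: \<pi>_def)
    also have "\<dots> = (\<Sum>k\<in>I - A. z i k * z' k j)"
      using 2 \<tau>_id by (intro sum.cong) (auto simp: \<pi>_def)
    also have "\<dots> = (\<Sum>k\<in>I'. z i k * z' k j)"
    proof (rule sum.mono_neutral_left)
      show "\<forall>k\<in>I' - (I - A). z i k * z' k j = 0"
      proof
        fix k assume "k \<in> I' - (I - A)"
        then have "(i, k) \<notin> R'" using colA 2 R'R by (auto simp: I'_def)
        then show "z i k * z' k j = 0" using supp_zero[OF z] by simp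
      qed
    qed (use finI A2 in \<open>auto simp: I'_def\<close>)
    finally show ?thesis using 2 \<tau>_id by (simp add: \<pi>_def mmul_apply)
  next
    case 3
    then have "\<pi> z i k * \<pi> z' k j = 0" for k by (auto simp: \<pi>_def)
    with 3 show ?thesis by (simp add: mmul_apply \<pi>_def)
  qed
qed

lemma \<pi>_comm: "z \<in> supp R' \<Longrightarrow> z' \<in> supp R' \<Longrightarrow> comm I (\<pi> z) (\<pi> z') = \<pi> (comm I' z z')"
  by (simp add: comm_def \<pi>_mmul \<pi>_diff)

lemma act_\<pi>: "\<rho> (\<pi> z) s = \<rho> z s"
  using LA \<tau>_id by (intro act_local) (auto simp: \<pi>_def)

lemma \<pi>_sbr: "z \<in> supp R' \<Longrightarrow> z' \<in> supp R' \<Longrightarrow>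
  sbr I \<rho> (\<pi> z, s) (\<pi> z', s') = map_prod \<pi> id (sbr I' \<rho> (z, s) (z', s'))"
  by (simp add: sbr_def \<pi>_comm act_\<pi>)

lemma \<pi>_inj:
  assumes z: "z \<in> supp R'" and V: "\<pi> z \<in> supp (A \<times> W)" shows "z = 0"
proof (rule mt_eqI, rule ccontr)
  fix i j assume "z i j \<noteq> 0 i j"
  then have nz: "z i j \<noteq> 0" by simp
  then have ij: "(i, j) \<in> R'" using z by (rule suppD[rotated])
  then have ni: "i \<notin> A2" "j \<notin> A2" by (auto simp: R'_def)
  consider "i \<in> A" "j \<in> A" | "i \<notin> A" "j \<notin> A" | "i \<in> A" "j \<notin> A" | "i \<notin> A" "j \<in> A" by blast
  then show False
  proof cases
    case 1
    then have "\<pi> z i j \<noteq> 0" using nz ni by (simp add: \<pi>_def \<tau>_def)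
    with suppD[OF V this] 1 notA show False by blast
  next
    case 2
    then have "\<pi> z i j \<noteq> 0" using nz ni by (simp add: \<pi>_def \<tau>_def)
    with suppD[OF V this] 2 show False by blast
  next
    case 3
    then have "j \<in> W2" using rowA[OF R'R[OF ij]] dich ni by blast
    then have "\<pi> z i (\<sigma>' j) \<noteq> 0" using nz ni 3 \<sigma>'A \<sigma>\<sigma>' A2 by (auto simp: \<pi>_def \<tau>_def)
    from suppD[OF V this] \<open>j \<in> W2\<close> \<sigma>'A A2 notA show False by blast
  next
    case 4
    with colA[OF R'R[OF ij]] show False by blast
  qed
qed

lemma \<kappa>_\<pi>: assumes z: "z \<in> supp R'" shows "\<kappa> (\<pi> z) = z"
proof (rule mt_eqI)
  fix i j
  show "\<kappa> (\<pi> z) i j = z i j"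
  proof (cases "i \<in> A - A2 \<and> j \<in> W2")
    case True
    then show ?thesis using \<sigma>'A \<sigma>\<sigma>' A2 by (auto simp: \<kappa>_def \<pi>_def \<tau>_def)
  next
    case F: False
    show ?thesis
    proof (cases "(i, j) \<in> R'")
      case True
      then have "i \<notin> A2" "j \<notin> A2" by (auto simp: R'_def)
      moreover have "(i \<in> A) = (j \<in> A)"
        using F True rowA[OF R'R[OF True]] colA[OF R'R[OF True]] dich calculation by blast
      ultimately show ?thesis using True F by (auto simp: \<kappa>_def \<pi>_def \<tau>_def)
    next
      case False
      then show ?thesis using F supp_zero[OF z False] by (auto simp: \<kappa>_def)
    qed
  qed
qed

lemma \<kappa>_V: assumes v: "v \<in> supp (A \<times> W)" shows "\<kappa> v = 0"
proof (rule mt_eqI)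
  fix i j
  show "\<kappa> v i j = 0 i j"
  proof (cases "i \<in> A - A2 \<and> j \<in> W2")
    case True
    then have "(i, \<sigma>' j) \<notin> A \<times> W" using \<sigma>'A A2 notA by blast
    then show ?thesis using True supp_zero[OF v] by (simp add: \<kappa>_def)
  next
    case F: False
    have "v i j = 0" if "(i, j) \<in> R'"
    proof (rule supp_zero[OF v], rule notI)
      assume "(i, j) \<in> A \<times> W"
      with F dich that show False by (auto simp: R'_def)
    qed
    with F show ?thesis by (auto simp: \<kappa>_def)
  qed
qed

lemma \<pi>_trace: "(\<Sum>i\<in>A2. \<pi> z i (\<sigma> i)) = 0"
  using \<sigma>W notA A2 by (intro sum.neutral) (auto simp: \<pi>_def)

lemma finA: "finite A2" "finite A" "finite W"
  using finite_subset[OF AI finI] finite_subset[OF WI finI] finite_subset[OF A2] by auto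

lemma comm_V:
  assumes x: "x \<in> supp R" and v: "v \<in> supp (A \<times> W)"
  shows "comm I x v \<in> supp (A \<times> W)"
proof (rule suppI)
  fix i j assume "comm I x v i j \<noteq> 0"
  then have "mmul I x v i j \<noteq> 0 \<or> mmul I v x i j \<noteq> 0" by (auto simp: comm_def)
  then obtain k where "x i k * v k j \<noteq> 0 \<or> v i k * x k j \<noteq> 0"
    unfolding mmul_apply by (metis (no_types, lifting) sum.not_neutral_contains_not_neutral)
  then have "(i, k) \<in> R \<and> (k, j) \<in> A \<times> W \<or> (i, k) \<in> A \<times> W \<and> (k, j) \<in> R"
    using suppD[OF x] suppD[OF v] by auto
  then show "(i, j) \<in> A \<times> W" using colA rowW by blast
qed

context
  fixes \<gamma> :: "'a mt \<times> 'a mt \<Rightarrow> 'a"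
  assumes lin: "linear_form pscale \<gamma>"
    and normal: "\<And>v. v \<in> supp (A \<times> W) \<Longrightarrow> \<gamma> (v, 0) = (\<Sum>i\<in>A2. v i (\<sigma> i))"
begin

lemma sbr_V:
  assumes x: "x \<in> supp R" and v: "v \<in> supp (A \<times> W)"
  shows "\<gamma> (sbr I \<rho> (x, s) (v, 0)) = (\<Sum>i\<in>A2. comm I x v i (\<sigma> i))"
proof -
  have "\<rho> v s = 0"
    using LA by (intro act_vanish supp_zero[OF v]) blast
  then have "sbr I \<rho> (x, s) (v, 0) = (comm I x v, 0)"
    by (simp add: sbr_def act_zero_right)
  with normal[OF comm_V[OF x v]] show ?thesis by simp
qed

lemma sbr_unit:
  assumes x: "x \<in> supp R" and a: "a \<in> A" and w: "w \<in> W"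
  shows "\<gamma> (sbr I \<rho> (x, s) (unit_mt a w, 0)) =
    (if w \<in> W2 then x (\<sigma>' w) a else 0) - (if a \<in> A2 then x w (\<sigma> a) else 0)"
proof -
  have "\<gamma> (sbr I \<rho> (x, s) (unit_mt a w, 0)) = (\<Sum>i\<in>A2. comm I x (unit_mt a w) i (\<sigma> i))"
    using a w by (intro sbr_V[OF x] unit_mt_supp) auto
  also have "\<dots> = (\<Sum>i\<in>A2. (if \<sigma> i = w then x i a else 0) - (if i = a then x w (\<sigma> i) else 0))"
    using a w AI WI finI
    by (intro sum.cong) (auto simp: comm_def mmul_unit_left mmul_unit_right subset_iff)
  also have "\<dots> = (\<Sum>i\<in>A2. if \<sigma> i = w then x i a else 0) - (\<Sum>i\<in>A2. if i = a then x w (\<sigma> i) else 0)"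
    by (simp add: sum_subtractf)
  also have "(\<Sum>i\<in>A2. if i = a then x w (\<sigma> i) else 0) = (if a \<in> A2 then x w (\<sigma> a) else 0)"
    using finA by simp
  also have "(\<Sum>i\<in>A2. if \<sigma> i = w then x i a else 0) = (if w \<in> W2 then x (\<sigma>' w) a else 0)"
  proof (cases "w \<in> W2")
    case True
    have "(\<Sum>i\<in>A2. if \<sigma> i = w then x i a else 0) = (\<Sum>i\<in>A2. if i = \<sigma>' w then x i a else 0)"
      using True \<sigma>'\<sigma> \<sigma>\<sigma>' by (intro sum.cong) auto
    also have "\<dots> = x (\<sigma>' w) a" using finA True \<sigma>'A by simp
    finally show ?thesis using True by simp
  next
    case False
    then have "(\<Sum>i\<in>A2. if \<sigma> i = w then x i a else 0) = 0"
      using \<sigma>W by (intro sum.neutral) auto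
    with False show ?thesis by simp
  qed
  finally show ?thesis .
qed

lemma V_inj:
  assumes v: "v \<in> supp (A \<times> W)"
    and rad: "\<And>x. x \<in> supp R \<Longrightarrow> \<gamma> (sbr I \<rho> (x, 0) (v, 0)) = 0"
  shows "v = 0"
proof (rule mt_eqI)
  fix a w
  show "v a w = 0 a w"
  proof (cases "a \<in> A \<and> w \<in> W")
    case False
    then show ?thesis using supp_zero[OF v] by auto
  next
    case True
    have formula: "(\<Sum>i\<in>A2. (if i = k then v l (\<sigma> i) else 0) - (if \<sigma> i = l then v i k else 0)) = 0"
      if "(k, l) \<in> R" for k l
    proof -
      have kl: "k \<in> I" "l \<in> I" using that RI by auto
      have "0 = (\<Sum>i\<in>A2. comm I (unit_mt k l) v i (\<sigma> i))"
        using rad[OF unit_mt_supp[OF that]] sbr_V[OF unit_mt_supp[OF that] v] by simp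
      also have "\<dots> = (\<Sum>i\<in>A2. (if i = k then v l (\<sigma> i) else 0) - (if \<sigma> i = l then v i k else 0))"
        using kl finI by (intro sum.cong) (auto simp: comm_def mmul_unit_left mmul_unit_right)
      finally show ?thesis by simp
    qed
    show ?thesis
    proof (cases "w \<in> W2")
      case w: True
      have "(\<sigma>' w, a) \<in> R" using w True \<sigma>'A A2 AA by blast
      from formula[OF this]
      have "(\<Sum>i\<in>A2. (if i = \<sigma>' w then v a (\<sigma> i) else 0)) = (\<Sum>i\<in>A2. if \<sigma> i = a then v i (\<sigma>' w) else 0)"
        by (simp add: sum_subtractf)
      also have "\<dots> = 0" using \<sigma>W notA True by (intro sum.neutral) auto
      finally have "v a (\<sigma> (\<sigma>' w)) = 0" using finA w \<sigma>'A by simp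
      then show ?thesis using w \<sigma>\<sigma>' by simp
    next
      case w: False
      then have d: "A2 = A" "(W - W2) \<times> W2 \<subseteq> R" using dich True by auto
      have "(w, \<sigma> a) \<in> R" using d True w \<sigma>W by blast
      from formula[OF this]
      have "(\<Sum>i\<in>A2. (if i = w then v (\<sigma> a) (\<sigma> i) else 0)) = (\<Sum>i\<in>A2. if \<sigma> i = \<sigma> a then v i w else 0)"
        by (simp add: sum_subtractf)
      moreover have "(\<Sum>i\<in>A2. (if i = w then v (\<sigma> a) (\<sigma> i) else 0)) = 0"
        using True notA A2 by (intro sum.neutral) auto
      moreover have "(\<Sum>i\<in>A2. if \<sigma> i = \<sigma> a then v i w else 0) = (\<Sum>i\<in>A2. if i = a then v i w else 0)"
        using d True \<sigma>'\<sigma> by (intro sum.cong) (auto, metis)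
      ultimately show ?thesis using finA d True by simp
    qed
  qed
qed

lemma onto:
  assumes x: "x \<in> supp R"
    and perp: "\<And>a w. a \<in> A \<Longrightarrow> w \<in> W \<Longrightarrow> \<gamma> (sbr I \<rho> (x, s) (unit_mt a w, 0)) = 0"
  shows "x - \<pi> (\<kappa> x) \<in> supp (A \<times> W)"
proof (rule suppI, rule ccontr)
  have eq: "(if w \<in> W2 then x (\<sigma>' w) a else 0) = (if a \<in> A2 then x w (\<sigma> a) else 0)"
    if "a \<in> A" "w \<in> W" for a w
    using perp[OF that] sbr_unit[OF x that] by simp
  fix i j assume nz: "(x - \<pi> (\<kappa> x)) i j \<noteq> 0" and nV: "(i, j) \<notin> A \<times> W"
  consider "i \<in> A" "j \<in> A" | "i \<notin> A" "j \<notin> A" | "i \<in> A" "j \<notin> A" | "i \<notin> A" "j \<in> A" by blast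
  then have "x i j = \<pi> (\<kappa> x) i j"
  proof cases
    case 1
    then have pi: "\<pi> (\<kappa> x) i j = \<kappa> x (\<tau> i) (\<tau> j)" by (simp add: \<pi>_def)
    consider "i \<in> A2" "j \<in> A2" | "i \<in> A2" "j \<notin> A2" | "i \<notin> A2" "j \<in> A2" | "i \<notin> A2" "j \<notin> A2" by blast
    then show ?thesis
    proof cases
      case a: 1
      have "\<kappa> x (\<sigma> i) (\<sigma> j) = x (\<sigma> i) (\<sigma> j)"
        using a \<sigma>W notA supp_zero[OF x] by (auto simp: \<kappa>_def R'_def)
      moreover have "x i j = x (\<sigma> i) (\<sigma> j)"
        using eq[of j "\<sigma> i"] a 1 \<sigma>W W2 \<sigma>'\<sigma> by auto
      ultimately show ?thesis using a pi by (simp add: \<tau>_def)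
    next
      case a: 2
      have "(\<sigma> i, j) \<notin> R'" using colA[OF R'R, of "\<sigma> i" j] 1 a \<sigma>W notA by blast
      then have "\<kappa> x (\<sigma> i) j = 0" using a \<sigma>W notA by (auto simp: \<kappa>_def)
      moreover have "x i j = 0" using eq[of j "\<sigma> i"] a 1 \<sigma>W W2 \<sigma>'\<sigma> by auto
      ultimately show ?thesis using a pi by (simp add: \<tau>_def)
    next
      case a: 3
      then show ?thesis using 1 pi \<sigma>W \<sigma>'\<sigma> by (simp add: \<tau>_def \<kappa>_def)
    next
      case a: 4
      have "j \<notin> W2" using 1 notA by blast
      then have "(i, j) \<in> R'" using 1 a AA by (auto simp: R'_def)
      with a \<open>j \<notin> W2\<close> pi show ?thesis by (simp add: \<tau>_def \<kappa>_def)
    qed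
  next
    case 2
    then have pi: "\<pi> (\<kappa> x) i j = \<kappa> x i j" by (simp add: \<pi>_def \<tau>_id)
    have n: "i \<notin> A2" "j \<notin> A2" using 2 A2 by auto
    show ?thesis
    proof (cases "i \<in> W - W2 \<and> j \<in> W2")
      case True
      then have "x i j = 0"
        using eq[of "\<sigma>' j" i] \<sigma>'A A2 \<sigma>\<sigma>' by auto
      with True 2 pi show ?thesis by (auto simp: \<kappa>_def R'_def)
    next
      case False
      then have "\<kappa> x i j = x i j" using 2 n supp_zero[OF x] by (auto simp: \<kappa>_def R'_def)
      with pi show ?thesis by simp
    qed
  next
    case 3
    then have "x i j = 0" using nV rowA suppD[OF x] by blast
    with 3 show ?thesis by (simp add: \<pi>_def)
  next
    case 4
    then have "x i j = 0" using colA suppD[OF x] by blast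
    with 4 show ?thesis by (simp add: \<pi>_def)
  qed
  with nz show False by simp
qed

lemma \<kappa>_supp: assumes x: "x \<in> supp R" shows "\<kappa> x \<in> supp R'"
proof (rule suppI)
  fix i j assume nz: "\<kappa> x i j \<noteq> 0"
  show "(i, j) \<in> R'"
  proof (cases "i \<in> A - A2 \<and> j \<in> W2")
    case True
    then have "(i, j) \<in> R" using AW W2 by blast
    then show ?thesis using True notA by (auto simp: R'_def)
  next
    case False
    with nz show ?thesis by (auto simp: \<kappa>_def split: if_splits)
  qed
qed

lemma nondeg_iff:
  "nondeg (\<lambda>p q. \<gamma> (sbr I \<rho> p q)) (supp R \<times> S) \<longleftrightarrow>
   nondeg (\<lambda>p q. \<gamma> (map_prod \<pi> id (sbr I' \<rho> p q))) (supp R' \<times> S)"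
proof -
  define B where "B = (\<lambda>p q. \<gamma> (sbr I \<rho> p q))"
  let ?V = "supp (A \<times> W) \<times> {0}"
  let ?F = "(\<lambda>x. (x, 0)) ` units (A \<times> W)"
  have B: "bilin pscale B" unfolding B_def by (rule bilin_sbr[OF lin])
  have skew: "B q p = - B p q" for p q
    unfolding B_def by (subst sbr_skew) (rule P.functional_minus[OF lin])
  have VR: "supp (A \<times> W) \<subseteq> supp R" using AW by (rule supp_mono)
  have S0: "0 \<in> S" using S_subspace by (rule M.subspace_0)
  have "nondeg B (supp R \<times> S) \<longleftrightarrow>
    (\<forall>v\<in>?V. (\<forall>x\<in>supp R \<times> S. B v x = 0) \<longrightarrow> v = 0) \<and>
    nondeg (\<lambda>p q. \<gamma> (map_prod \<pi> id (sbr I' \<rho> p q))) (supp R' \<times> S)"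
  proof (rule nondeg_reduction_iso[where F = ?F and \<pi> = "map_prod \<pi> id", OF vector_space_pscale vector_space_pscale B skew subspace_prod])
    show "finite ?F" using finA by (simp add: units_def)
    show "?F \<subseteq> ?V" by (auto simp: units_def intro!: unit_mt_supp)
    show "P.subspace ?V"
      by (intro subspace_Times subspace_supp M.subspace_single_0)
    show "?V \<subseteq> supp R \<times> S" using VR S0 by auto
    show "?V \<subseteq> P.span ?F"
      using span_left[OF _ order_refl] supp_span[of "A \<times> W"] finA by blast
    show "B v w = 0" if vw: "v \<in> ?V" "w \<in> ?V" for v w
    proof -
      obtain x y where xy: "v = (x, 0)" "w = (y, 0)" "x \<in> supp (A \<times> W)" "y \<in> supp (A \<times> W)"
        using vw by auto
      have "x i k * y k j = 0" "y i k * x k j = 0" for i j k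
        using xy disj suppD[of x "A \<times> W"] suppD[of y "A \<times> W"] by (metis SigmaD1 SigmaD2 disjoint_iff mult_eq_0_iff)+
      then have "comm I x y = 0" by (intro mt_eqI) (simp add: comm_def mmul_apply)
      then show ?thesis using xy P.functional_zero[OF lin]
        by (simp add: B_def sbr_def act_zero_right flip: zero_prod_def)
    qed
    show "map_prod \<pi> id z \<in> supp R \<times> S" if "z \<in> supp R' \<times> S" for z
      using that \<pi>_supp by auto
    show "B (map_prod \<pi> id z) v = 0" if z: "z \<in> supp R' \<times> S" and v: "v \<in> ?V" for z v
    proof -
      obtain y s x where [simp]: "z = (y, s)" "v = (x, 0)" and y: "y \<in> supp R'" and x: "x \<in> supp (A \<times> W)"
        using z v by auto
      have "B (\<pi> y, s) (x, 0) = 0" using x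
      proof -
        have "x \<in> M.span (units (A \<times> W))" using supp_span[of "A \<times> W"] finA x by auto
        then show ?thesis
        proof (induction rule: M.span_induct_alt)
          case base
          then show ?case using P.functional_zero[OF P.bilin_right[OF B]] by (metis zero_prod_def)
        next
          case (step c u t)
          then obtain a w where u: "u = unit_mt a w" "a \<in> A" "w \<in> W" by (auto simp: units_def)
          have "B (\<pi> y, s) (u, 0) = (if w \<in> W2 then \<pi> y (\<sigma>' w) a else 0) - (if a \<in> A2 then \<pi> y w (\<sigma> a) else 0)"
            unfolding B_def u(1) using u by (intro sbr_unit \<pi>_supp y)
          also have "\<dots> = 0"
          proof -
            have zz: "y w a' = 0" if "a' \<in> A" for a'
            proof (rule supp_zero[OF y], rule notI)
              assume "(w, a') \<in> R'" then show False using colA[OF R'R that] u notA by blast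
            qed
            consider "w \<in> W2" "a \<in> A2" | "w \<in> W2" "a \<notin> A2" | "w \<notin> W2" "a \<in> A2" | "w \<notin> W2" "a \<notin> A2" by blast
            then show ?thesis
            proof cases
              case 1
              then have "\<sigma>' w \<in> A" "\<sigma> a \<notin> A" "w \<notin> A" using \<sigma>'A A2 \<sigma>W notA by auto
              then show ?thesis using 1 u \<sigma>'A \<sigma>\<sigma>' \<sigma>W notA by (simp add: \<pi>_def \<tau>_def)
            next
              case 2
              then have "\<sigma>' w \<in> A" using \<sigma>'A A2 by auto
              then show ?thesis using 2 u \<sigma>'A \<sigma>\<sigma>' zz by (simp add: \<pi>_def \<tau>_def)
            next
              case 3
              have "\<sigma> a \<notin> A" "w \<notin> A" "w \<notin> A2" "\<sigma> a \<notin> A2" using 3 u \<sigma>W notA A2 by auto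
              moreover have "y w (\<sigma> a) = 0"
                using 3 u \<sigma>W by (intro supp_zero[OF y]) (auto simp: R'_def)
              ultimately show ?thesis using 3 by (simp add: \<pi>_def \<tau>_def)
            qed simp
          qed
          finally have "B (\<pi> y, s) (u, 0) = 0" .
          moreover have "(mscale c u + t, 0) = pscale c (u, 0) + (t, 0)" by simp
          ultimately show ?case using step.IH
            by (simp only: P.functional_add[OF P.bilin_right[OF B]] P.functional_scale[OF P.bilin_right[OF B]]) simp
        qed
      qed
      then show ?thesis by simp
    qed
    show "\<exists>z\<in>supp R' \<times> S. x - map_prod \<pi> id z \<in> ?V"
      if x: "x \<in> supp R \<times> S" and perp: "\<forall>v\<in>?V. B x v = 0" for x
    proof -
      obtain y s where [simp]: "x = (y, s)" and y: "y \<in> supp R" "s \<in> S" using x by auto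
      have "y - \<pi> (\<kappa> y) \<in> supp (A \<times> W)"
        using perp by (intro onto[OF y(1), of s]) (auto simp: B_def intro!: unit_mt_supp)
      then show ?thesis using y \<kappa>_supp by (intro bexI[of _ "(\<kappa> y, s)"]) auto
    qed
    show "z = 0" if "z \<in> supp R' \<times> S" "map_prod \<pi> id z \<in> ?V" for z
      using that \<pi>_inj by (auto simp: zero_prod_def)
    show "map_prod \<pi> id 0 \<in> ?V" by (auto simp: zero_prod_def \<pi>_def supp_def)
    show "B (map_prod \<pi> id z) (map_prod \<pi> id z') = \<gamma> (map_prod \<pi> id (sbr I' \<rho> z z'))"
      if "z \<in> supp R' \<times> S" "z' \<in> supp R' \<times> S" for z z'
      using that \<pi>_sbr by (auto simp: B_def)
  qed
  moreover have "v = 0" if v: "v \<in> ?V" and rad: "\<forall>x\<in>supp R \<times> S. B v x = 0" for v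
  proof -
    obtain y where [simp]: "v = (y, 0)" and y: "y \<in> supp (A \<times> W)" using v by auto
    have "\<gamma> (sbr I \<rho> (x, 0) (y, 0)) = 0" if "x \<in> supp R" for x
      using rad that S0 skew[of "(y, 0)" "(x, 0)"] by (auto simp: B_def)
    from V_inj[OF y this] show "v = 0" by (simp add: zero_prod_def)
  qed
  ultimately show ?thesis unfolding B_def by blast
qed

end

text \<open>
  A functional on the reduced algebra is pulled back along \<open>\<kappa>\<close>, and the trace of the pairing \<open>\<sigma>\<close> is
  added to it. Since \<open>\<kappa>\<close> kills the ideal and the trace of the pairing kills the image of \<open>\<pi>\<close>, the
  two parts do not interfere.
\<close>

lemma frob_lift:
  assumes "frob I' R' \<rho> S" shows "frob I R \<rho> S"
proof -
  obtain \<gamma>' where lin': "linear_form pscale \<gamma>'" and nd: "nondeg (\<lambda>p q. \<gamma>' (sbr I' \<rho> p q)) (supp R' \<times> S)"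
    using assms by (auto simp: frob_def)
  define \<gamma> where "\<gamma> p = \<gamma>' (map_prod \<kappa> id p) + (\<Sum>i\<in>A2. fst p i (\<sigma> i))" for p :: "'a mt \<times> 'a mt"
  have "map_prod \<kappa> id (p + q) = map_prod \<kappa> id p + map_prod \<kappa> id q" for p q
    by (cases p; cases q) (simp add: \<kappa>_add)
  moreover have "map_prod \<kappa> id (pscale c p) = pscale c (map_prod \<kappa> id p)" for c p
    by (cases p) (simp add: \<kappa>_scale)
  ultimately have lin: "linear_form pscale \<gamma>"
    using lin' by (auto simp: linear_form_def \<gamma>_def pscale_def sum.distrib sum_distrib_left algebra_simps)
  have "\<gamma> (v, 0) = (\<Sum>i\<in>A2. v i (\<sigma> i))" if "v \<in> supp (A \<times> W)" for v
    using \<kappa>_V[OF that] P.functional_zero[OF lin'] by (simp add: \<gamma>_def flip: zero_prod_def)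
  note iff = nondeg_iff[OF lin this]
  have "\<gamma> (map_prod \<pi> id (sbr I' \<rho> p q)) = \<gamma>' (sbr I' \<rho> p q)"
    if "p \<in> supp R' \<times> S" "q \<in> supp R' \<times> S" for p q
  proof -
    have tr: "trans R'"
    proof (rule transI)
      fix i j k assume ij: "(i, j) \<in> R'" and jk: "(j, k) \<in> R'"
      then have "(i, k) \<in> R" using transR R'R by (meson transD)
      moreover have "\<not> (i \<in> W - W2 \<and> k \<in> W2)"
        using ij jk rowW[OF R'R[OF ij]] by (auto simp: R'_def)
      ultimately show "(i, k) \<in> R'" using ij jk by (auto simp: R'_def)
    qed
    have "comm I' (fst p) (fst q) \<in> supp R'"
      unfolding comm_def using that
      by (intro M.subspace_diff subspace_supp mmul_supp tr) auto
    then show ?thesis by (simp add: \<gamma>_def sbr_def \<kappa>_\<pi> \<pi>_trace)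
  qed
  then have "nondeg (\<lambda>p q. \<gamma> (map_prod \<pi> id (sbr I' \<rho> p q))) (supp R' \<times> S)"
    using nd by (auto simp: nondeg_def)
  with iff lin show ?thesis by (auto simp: frob_def)
qed

end

section \<open>Inverse matrices\<close>

definition idm :: "nat set \<Rightarrow> 'a::field mt" where
  "idm I = (\<lambda>i j. if i = j \<and> i \<in> I then 1 else 0)"

lemma mmul_idm_left: "finite I \<Longrightarrow> x \<in> supp (I \<times> J) \<Longrightarrow> mmul I (idm I) x = x"
proof (rule mt_eqI)
  fix i j assume "finite I" and x: "x \<in> supp (I \<times> J)"
  have "mmul I (idm I) x i j = (\<Sum>k\<in>I. if k = i then x i j else 0)"
    unfolding mmul_apply idm_def by (intro sum.cong) auto
  then show "mmul I (idm I) x i j = x i j" using \<open>finite I\<close> supp_zero[OF x, of i j] by auto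
qed

lemma mmul_idm_right: "finite I \<Longrightarrow> x \<in> supp (J \<times> I) \<Longrightarrow> mmul I x (idm I) = x"
proof (rule mt_eqI)
  fix i j assume "finite I" and x: "x \<in> supp (J \<times> I)"
  have "mmul I x (idm I) i j = (\<Sum>k\<in>I. if k = j then x i j else 0)"
    unfolding mmul_apply idm_def by (intro sum.cong) auto
  then show "mmul I x (idm I) i j = x i j" using \<open>finite I\<close> supp_zero[OF x, of i j] by auto
qed

lemma linear_form_mt_sum:
  "linear_form mscale (\<lambda>u. \<Sum>i\<in>A. c i * u (0::nat) (i::nat))"
  by (auto simp: linear_form_def sum.distrib sum_distrib_left algebra_simps)

text \<open>
  The columns of \<open>N\<close> are functionals with trivial common kernel, so every coordinate functional is a
  combination of them. Vectors are encoded as the zeroth rows of matrices.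
\<close>

lemma right_inverse_exists:
  assumes A: "finite A"
    and ker: "\<And>u. (\<And>j. j \<in> A \<Longrightarrow> (\<Sum>i\<in>A. N i j * u i) = 0) \<Longrightarrow> \<forall>i\<in>A. u i = (0::'a::field)"
  shows "\<exists>C\<in>supp (A \<times> A). \<forall>i\<in>A. \<forall>k\<in>A. (\<Sum>j\<in>A. N i j * C j k) = (if i = k then 1 else 0)"
proof -
  have "\<exists>c. \<forall>u\<in>UNIV. (\<Sum>i\<in>A. (if i = k then 1 else 0) * u (0::nat) (i::nat)) = (\<Sum>j\<in>A. c j * (\<Sum>i\<in>A. N i j * u 0 i))"
    if k: "k \<in> A" for k
  proof (rule M.functional_vanishing_on_common_kernel[OF A])
    fix u :: "nat \<Rightarrow> nat \<Rightarrow> 'a" assume "\<forall>j\<in>A. (\<Sum>i\<in>A. N i j * u 0 i) = 0"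
    then have "\<forall>i\<in>A. u 0 i = 0" by (intro ker) auto
    then show "(\<Sum>i\<in>A. (if i = k then 1 else 0) * u 0 i) = 0" by (simp add: sum.neutral)
  qed (auto intro!: linear_form_mt_sum)
  then have "\<forall>k\<in>A. \<exists>c. \<forall>u. (\<Sum>i\<in>A. (if i = k then 1 else 0) * u (0::nat) (i::nat)) = (\<Sum>j\<in>A. c j * (\<Sum>i\<in>A. N i j * u 0 i))"
    by simp
  from bchoice[OF this] obtain c where c: "\<And>k u. k \<in> A \<Longrightarrow> (\<Sum>i\<in>A. (if i = k then 1 else 0) * u (0::nat) (i::nat)) = (\<Sum>j\<in>A. c k j * (\<Sum>i\<in>A. N i j * u 0 i))"
    by blast
  define C where "C j k = (if j \<in> A \<and> k \<in> A then c k j else 0)" for j k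
  have "(\<Sum>j\<in>A. N i j * C j k) = (if i = k then 1 else 0)" if ik: "i \<in> A" "k \<in> A" for i k
  proof -
    have "(\<Sum>l\<in>A. (if l = k then 1 else 0) * unit_mt 0 i 0 l) = (\<Sum>j\<in>A. c k j * (\<Sum>l\<in>A. N l j * unit_mt 0 i 0 l))"
      by (rule c[OF ik(2)])
    also have "(\<Sum>l\<in>A. (if l = k then 1 else 0) * unit_mt 0 i 0 l) = (if i = k then 1 else (0::'a))"
      using A ik by (simp add: unit_mt_def if_distrib[of "\<lambda>t. _ * t"] cong: if_cong)
    also have "(\<Sum>j\<in>A. c k j * (\<Sum>l\<in>A. N l j * unit_mt 0 i 0 l)) = (\<Sum>j\<in>A. c k j * N i j)"
      using A ik by (simp add: unit_mt_def if_distrib[of "\<lambda>t. _ * t"] cong: if_cong)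
    finally show ?thesis using ik by (simp add: C_def mult.commute)
  qed
  moreover have "C \<in> supp (A \<times> A)" by (auto simp: supp_def C_def)
  ultimately show ?thesis by blast
qed

lemma inverse_exists:
  fixes N :: "'a::field mt"
  assumes A: "finite A"
    and ker: "\<And>u. (\<And>j. j \<in> A \<Longrightarrow> (\<Sum>i\<in>A. N i j * u i) = 0) \<Longrightarrow> \<forall>i\<in>A. u i = (0::'a::field)"
    and ker': "\<And>u. (\<And>j. j \<in> A \<Longrightarrow> (\<Sum>i\<in>A. N j i * u i) = 0) \<Longrightarrow> \<forall>i\<in>A. u i = (0::'a::field)"
  shows "\<exists>C. (\<forall>i\<in>A. \<forall>k\<in>A. (\<Sum>j\<in>A. N i j * C j k) = (if i = k then 1 else 0)) \<and>
    (\<forall>i\<in>A. \<forall>k\<in>A. (\<Sum>j\<in>A. C i j * N j k) = (if i = k then 1 else 0))"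
proof -
  obtain C where C: "\<And>i k. i \<in> A \<Longrightarrow> k \<in> A \<Longrightarrow> (\<Sum>j\<in>A. N i j * C j k) = (if i = k then 1 else 0)"
    and Cs: "C \<in> supp (A \<times> A)"
    using right_inverse_exists[OF A ker] by blast
  obtain D where D: "\<And>i k. i \<in> A \<Longrightarrow> k \<in> A \<Longrightarrow> (\<Sum>j\<in>A. N j i * D j k) = (if i = k then 1 else 0)"
    using right_inverse_exists[OF A, of "\<lambda>i j. N j i", OF ker'] by blast
  have "C i k = D k i" if ik: "i \<in> A" "k \<in> A" for i k
  proof -
    have "D k i = (\<Sum>j\<in>A. D j i * (if j = k then 1 else 0))"
      using A ik by (simp add: if_distrib[of "\<lambda>t. _ * t"] cong: if_cong)
    also have "\<dots> = (\<Sum>j\<in>A. D j i * (\<Sum>l\<in>A. N j l * C l k))" using C ik by (intro sum.cong) auto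
    also have "\<dots> = (\<Sum>j\<in>A. \<Sum>l\<in>A. N j l * D j i * C l k)"
      by (simp add: sum_distrib_left algebra_simps)
    also have "\<dots> = (\<Sum>l\<in>A. \<Sum>j\<in>A. N j l * D j i * C l k)" by (rule sum.swap)
    also have "\<dots> = (\<Sum>l\<in>A. (if l = i then 1 else 0) * C l k)"
      using D ik by (intro sum.cong) (auto simp: sum_distrib_right[symmetric])
    also have "\<dots> = C i k" using A ik by (simp add: if_distrib[of "\<lambda>t. t * _"] cong: if_cong)
    finally show ?thesis by simp
  qed
  then have "(\<Sum>j\<in>A. C i j * N j k) = (if i = k then 1 else 0)" if "i \<in> A" "k \<in> A" for i k
  proof -
    have "(\<Sum>j\<in>A. C i j * N j k) = (\<Sum>j\<in>A. N j k * D j i)"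
      using \<open>\<And>k i. i \<in> A \<Longrightarrow> k \<in> A \<Longrightarrow> C i k = D k i\<close> that by (intro sum.cong) (auto simp: mult.commute)
    then show ?thesis using D[of k i] that by auto
  qed
  with C show ?thesis by blast
qed

text \<open>
  The values of \<open>- t\<close> are eigenvalues of \<open>N\<close>. Dividing by \<open>t\<close> turns \<open>N + t\<close> into the perturbation \<open>1
  + N / t\<close> of the identity form, to which \<open>nondeg_perturbation\<close> applies.
\<close>

lemma generic_kernel:
  fixes N :: "nat \<Rightarrow> nat \<Rightarrow> 'a::field"
  assumes A: "finite A"
  shows "finite {t. \<exists>u. (\<forall>j\<in>A. (\<Sum>i\<in>A. N i j * u i) + t * u j = 0) \<and> (\<exists>i\<in>A. u i \<noteq> 0)}"
    (is "finite ?T")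
proof -
  let ?Q = "supp ({0} \<times> A) :: 'a mt set"
  define B :: "'a mt \<Rightarrow> 'a mt \<Rightarrow> 'a" where "B u v = (\<Sum>i\<in>A. u 0 i * v 0 i)" for u v
  define B' where "B' u v = (\<Sum>j\<in>A. (\<Sum>i\<in>A. N i j * u 0 i) * v 0 j)" for u v :: "'a mt"
  have bil: "bilin mscale B" "bilin mscale B'"
    unfolding bilin_def linear_form_def B_def B'_def
    by (simp_all add: sum.distrib sum_distrib_left sum_distrib_right algebra_simps)
  have unit: "unit_mt 0 i \<in> ?Q" if "i \<in> A" for i using that by (auto intro: unit_mt_supp)
  have nd: "nondeg B ?Q"
    unfolding nondeg_def
  proof (intro ballI impI)
    fix u assume u: "u \<in> ?Q" "\<forall>v\<in>?Q. B u v = 0"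
    have "u 0 i = 0" if "i \<in> A" for i
    proof -
      have "B u (unit_mt 0 i) = 0" using u unit[OF that] by blast
      then show ?thesis using A that
        by (simp add: B_def unit_mt_def if_distrib[of "\<lambda>t. _ * t"] cong: if_cong)
    qed
    then show "u = 0" using suppD[OF u(1)] by (intro mt_eqI) fastforce
  qed
  have "finite ({0} \<times> A)" using A by simp
  from M.nondeg_perturbation[OF bil subspace_supp _ supp_span[OF this] nd]
  have fin: "finite {t. \<not> nondeg (\<lambda>x y. B x y + t * B' x y) ?Q}" using A by (simp add: units_def)
  have "?T \<subseteq> insert 0 (inverse ` {t. \<not> nondeg (\<lambda>x y. B x y + t * B' x y) ?Q})"
  proof
    fix t assume "t \<in> ?T"
    then obtain u where u: "\<And>j. j \<in> A \<Longrightarrow> (\<Sum>i\<in>A. N i j * u i) + t * u j = 0" "\<exists>i\<in>A. u i \<noteq> 0" by blast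
    show "t \<in> insert 0 (inverse ` {t. \<not> nondeg (\<lambda>x y. B x y + t * B' x y) ?Q})"
    proof (cases "t = 0")
      case False
      define w :: "'a mt" where "w = (\<lambda>i j. if i = 0 \<and> j \<in> A then u j else 0)"
      have w: "w \<in> ?Q" "w \<noteq> 0" using u(2) by (auto simp: supp_def w_def fun_eq_iff)
      have "B w v + inverse t * B' w v = 0" for v
      proof -
        have "t * B w v + B' w v = (\<Sum>j\<in>A. ((\<Sum>i\<in>A. N i j * u i) + t * u j) * v 0 j)"
          by (simp add: B_def B'_def w_def sum.distrib sum_distrib_left algebra_simps)
        also have "\<dots> = 0" using u(1) by (intro sum.neutral) auto
        finally have "inverse t * (t * B w v + B' w v) = 0" by simp
        moreover have "t * (inverse t * B w v) = B w v" using False by simp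
        ultimately show ?thesis by (simp add: algebra_simps)
      qed
      with w have "\<not> nondeg (\<lambda>x y. B x y + inverse t * B' x y) ?Q"
        unfolding nondeg_def by blast
      then show ?thesis by (intro insertI2 image_eqI[of _ _ "inverse t"]) simp_all
    qed simp
  qed
  then show ?thesis using fin by (meson finite.insertI finite_imageI finite_subset)
qed

section \<open>Conjugation\<close>

text \<open>
  The inverse \<open>g'\<close> of \<open>g\<close> is passed along, so that invertibility within the algebra stays explicit.
\<close>

definition conj_mt :: "nat set \<Rightarrow> 'a::field mt \<Rightarrow> 'a mt \<Rightarrow> 'a mt \<Rightarrow> 'a mt" where
  "conj_mt I g g' x = mmul I (mmul I g x) g'"

definition intertwines ::
  "nat set \<Rightarrow> (nat \<times> nat) set \<Rightarrow> ('a::field mt \<Rightarrow> 'a mt \<Rightarrow> 'a mt) \<Rightarrow> 'a mt set \<Rightarrow> 'a mt \<Rightarrow> 'a mt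
    \<Rightarrow> ('a mt \<Rightarrow> 'a mt) \<Rightarrow> ('a mt \<Rightarrow> 'a mt) \<Rightarrow> bool" where
  "intertwines I R \<rho> S g g' T T' \<longleftrightarrow>
     (\<forall>s t. T (s + t) = T s + T t) \<and> (\<forall>c s. T (mscale c s) = mscale c (T s)) \<and>
     (\<forall>s\<in>S. T s \<in> S \<and> T' s \<in> S \<and> T (T' s) = s \<and> T' (T s) = s) \<and>
     (\<forall>y\<in>supp R. \<forall>s\<in>S. T (\<rho> y s) = \<rho> (conj_mt I g g' y) (T s))"

text \<open>
  Conjugation by units of the algebra extends to automorphisms of the semidirect product, so that a
  functional may be moved by such a conjugation without leaving the set of nondegenerate ones.
\<close>

definition equivariant :: "nat set \<Rightarrow> (nat \<times> nat) set \<Rightarrow> ('a::field mt \<Rightarrow> 'a mt \<Rightarrow> 'a mt) \<Rightarrow> 'a mt set \<Rightarrow> bool" where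
  "equivariant I R \<rho> S \<longleftrightarrow>
     (\<forall>g\<in>supp R. \<forall>g'\<in>supp R. mmul I g g' = idm I \<longrightarrow> mmul I g' g = idm I \<longrightarrow>
       (\<exists>T T'. intertwines I R \<rho> S g g' T T'))"

context local_action
begin

lemma conj_nondeg:
  assumes I: "finite I" "R \<subseteq> I \<times> I" "trans R" and eq: "equivariant I R \<rho> S"
    and g: "g \<in> supp R" "g' \<in> supp R" "mmul I g g' = idm I" "mmul I g' g = idm I"
    and lin: "linear_form pscale \<gamma>" and nd: "nondeg (\<lambda>p q. \<gamma> (sbr I \<rho> p q)) (supp R \<times> S)"
  shows "\<exists>\<gamma>'. linear_form pscale \<gamma>' \<and> nondeg (\<lambda>p q. \<gamma>' (sbr I \<rho> p q)) (supp R \<times> S) \<and>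
    (\<forall>x. \<gamma>' (x, 0) = \<gamma> (conj_mt I g g' x, 0))"
proof -
  obtain T T' where tw: "intertwines I R \<rho> S g g' T T'"
    using eq g unfolding equivariant_def by blast
  have T: "T (s + t) = T s + T t" "T (mscale c s) = mscale c (T s)" for s t c
    using tw by (simp_all add: intertwines_def)
  have TS: "T s \<in> S" "T' s \<in> S" and TT: "T (T' s) = s" "T' (T s) = s" if "s \<in> S" for s
    using tw that by (simp_all add: intertwines_def)
  have T\<rho>: "T (\<rho> y s) = \<rho> (conj_mt I g g' y) (T s)" if "y \<in> supp R" "s \<in> S" for y s
    using tw that by (simp add: intertwines_def)
  have T0: "T 0 = 0" using T(2)[of 0 0] by simp
  have Td: "T (s - t) = T s - T t" for s t
    using T(1)[of "s - t" t] by (simp add: algebra_simps)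
  define \<psi> where "\<psi> p = (conj_mt I g g' (fst p), T (snd p))" for p
  have IR: "x \<in> supp (I \<times> I)" if "x \<in> supp R" for x using that supp_mono[OF I(2)] by blast
  have inv: "conj_mt I g g' (conj_mt I g' g x) = x" "conj_mt I g' g (conj_mt I g g' x) = x"
    if "x \<in> supp R" for x
  proof -
    have a: "mmul I (mmul I h (mmul I (mmul I h' x) h)) h' = x"
      if "mmul I h h' = idm I" for h h'
    proof -
      have "mmul I (mmul I h (mmul I (mmul I h' x) h)) h' = mmul I (mmul I h h') (mmul I x (mmul I h h'))"
        by (simp only: mmul_assoc)
      also have "\<dots> = x"
        unfolding that mmul_idm_right[OF I(1) IR[OF \<open>x \<in> supp R\<close>]]
        by (rule mmul_idm_left[OF I(1) IR[OF \<open>x \<in> supp R\<close>]])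
      finally show ?thesis .
    qed
    show "conj_mt I g g' (conj_mt I g' g x) = x" "conj_mt I g' g (conj_mt I g g' x) = x"
      unfolding conj_mt_def by (rule a[OF g(3)], rule a[OF g(4)])
  qed
  have cs: "conj_mt I g g' x \<in> supp R" "conj_mt I g' g x \<in> supp R" if "x \<in> supp R" for x
    unfolding conj_mt_def by (intro mmul_supp[OF I(3)] that g)+
  have cm: "mmul I (conj_mt I g g' x) (conj_mt I g g' y) = conj_mt I g g' (mmul I x y)"
    if "y \<in> supp R" for x y
  proof -
    have "mmul I (conj_mt I g g' x) (conj_mt I g g' y)
      = mmul I (mmul I g x) (mmul I (mmul I (mmul I g' g) y) g')"
      by (simp only: conj_mt_def mmul_assoc)
    also have "\<dots> = conj_mt I g g' (mmul I x y)"
      unfolding g(4) mmul_idm_left[OF I(1) IR[OF that]] by (simp only: conj_mt_def mmul_assoc)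
    finally show ?thesis .
  qed
  have \<psi>sbr: "sbr I \<rho> (\<psi> p) (\<psi> q) = \<psi> (sbr I \<rho> p q)" if "p \<in> supp R \<times> S" "q \<in> supp R \<times> S" for p q
    using that cm T\<rho> Td
    by (auto simp: \<psi>_def sbr_def comm_def conj_mt_def mmul_diff_left mmul_diff_right)
  have \<psi>add: "\<psi> (p + q) = \<psi> p + \<psi> q" and \<psi>sc: "\<psi> (pscale c p) = pscale c (\<psi> p)" for p q c
    by (simp_all add: \<psi>_def conj_mt_def mmul_add_left mmul_add_right mmul_scale_left mmul_scale_right T pscale_def)
  have lin': "linear_form pscale (\<lambda>p. \<gamma> (\<psi> p))"
    unfolding linear_form_def \<psi>add \<psi>sc using lin by (simp add: linear_form_def del: split_paired_All)
  have "nondeg (\<lambda>p q. \<gamma> (\<psi> (sbr I \<rho> p q))) (supp R \<times> S)"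
    unfolding nondeg_def
  proof (intro ballI impI)
    fix p assume p: "p \<in> supp R \<times> S" "\<forall>q\<in>supp R \<times> S. \<gamma> (\<psi> (sbr I \<rho> p q)) = 0"
    have rad: "\<gamma> (sbr I \<rho> (\<psi> p) q) = 0" if q: "q \<in> supp R \<times> S" for q
    proof -
      let ?q = "(conj_mt I g' g (fst q), T' (snd q))"
      have q12: "fst q \<in> supp R" "snd q \<in> S" using q by (simp_all only: mem_Times_iff)
      have q': "?q \<in> supp R \<times> S" "\<psi> ?q = q"
        unfolding \<psi>_def fst_conv snd_conv inv(1)[OF q12(1)] TT(1)[OF q12(2)]
        by (simp_all only: mem_Times_iff fst_conv snd_conv cs(2)[OF q12(1)] TS(2)[OF q12(2)] prod.collapse)
      have "\<gamma> (\<psi> (sbr I \<rho> p ?q)) = 0" using p(2) q'(1) by (rule bspec)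
      then show ?thesis unfolding \<psi>sbr[OF p(1) q'(1), symmetric] q'(2) .
    qed
    have p12: "fst p \<in> supp R" "snd p \<in> S" using p(1) by (simp_all only: mem_Times_iff)
    have "\<psi> p \<in> supp R \<times> S"
      unfolding \<psi>_def mem_Times_iff fst_conv snd_conv using cs(1)[OF p12(1)] TS(1)[OF p12(2)] by blast
    with nd[unfolded nondeg_def] have "(\<forall>q\<in>supp R \<times> S. \<gamma> (sbr I \<rho> (\<psi> p) q) = 0) \<longrightarrow> \<psi> p = 0"
      by (rule bspec)
    then have "\<psi> p = 0" using rad by simp
    then have z: "conj_mt I g g' (fst p) = 0" "T (snd p) = 0"
      unfolding \<psi>_def prod_eq_iff fst_conv snd_conv fst_zero snd_zero by blast+
    have "fst p = conj_mt I g' g 0"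
      using inv(2)[OF p12(1)] unfolding z(1) by (rule sym)
    moreover have "conj_mt I g' g 0 = 0" by (intro mt_eqI) (simp add: conj_mt_def mmul_apply)
    moreover have "snd p = 0"
    proof -
      have "0 \<in> S" by (rule M.subspace_0[OF S_subspace])
      from TT(2)[OF p12(2)] TT(2)[OF this] show ?thesis unfolding z T0 by (rule trans[OF sym])
    qed
    ultimately show "p = 0" by (simp add: prod_eq_iff)
  qed
  with lin' show ?thesis
    by (intro exI[of _ "\<lambda>p. \<gamma> (\<psi> p)"] conjI allI) (simp_all only: \<psi>_def T0 fst_conv snd_conv)
qed

end

section \<open>Normalising a functional\<close>

context block_reduction
begin

lemma conj_unit:
  assumes "a \<in> I" "w \<in> I"
  shows "conj_mt I g g' (unit_mt a w) = (\<lambda>i j. g i a * g' w j)"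
proof (rule mt_eqI)
  fix i j
  have "conj_mt I g g' (unit_mt a w) i j = (\<Sum>k\<in>I. (if k = w then g i a else 0) * g' k j)"
    unfolding conj_mt_def mmul_apply[of I "mmul I g (unit_mt a w)"]
    using assms finI by (simp add: mmul_unit_right)
  also have "\<dots> = g i a * g' w j"
    using assms finI by (simp add: if_distrib[of "\<lambda>t. t * _"] cong: if_cong)
  finally show "conj_mt I g g' (unit_mt a w) i j = g i a * g' w j" .
qed

lemma form_V_expand:
  assumes lin: "linear_form pscale \<gamma>" and v: "v \<in> supp (A \<times> W)"
  shows "\<gamma> (v, 0) = (\<Sum>a\<in>A. \<Sum>w\<in>W. v a w * \<gamma> (unit_mt a w, 0))"
proof -
  have fin: "finite (A \<times> W)" using finA by simp
  have l: "linear_form mscale (\<lambda>x. \<gamma> (x, 0))"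
  proof -
    have "\<gamma> (x + y, 0) = \<gamma> (x, 0) + \<gamma> (y, 0)" for x y
      using P.functional_add[OF lin, of "(x, 0)" "(y, 0)"] by (metis add_Pair add_0)
    moreover have "\<gamma> (mscale c x, 0) = c * \<gamma> (x, 0)" for c x
      using P.functional_scale[OF lin, of c "(x, 0)"] by (metis pscale_Pair M.scale_zero_right)
    ultimately show ?thesis by (simp add: linear_form_def)
  qed
  have "\<gamma> (v, 0) = \<gamma> ((\<Sum>p\<in>A \<times> W. mscale (v (fst p) (snd p)) (unit_mt (fst p) (snd p))), 0)"
    using supp_expand[OF fin v] by (metis (mono_tags, lifting) case_prod_unfold sum.cong)
  also have "\<dots> = (\<Sum>p\<in>A \<times> W. v (fst p) (snd p) * \<gamma> (unit_mt (fst p) (snd p), 0))"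
    by (rule M.functional_comb[OF l])
  also have "\<dots> = (\<Sum>a\<in>A. \<Sum>w\<in>W. v a w * \<gamma> (unit_mt a w, 0))"
    by (simp add: sum.cartesian_product case_prod_unfold)
  finally show ?thesis .
qed

lemma conj_form:
  assumes lin: "linear_form pscale \<gamma>" and g: "g \<in> supp R" "g' \<in> supp R"
    and a: "a \<in> A" and w: "w \<in> W"
  shows "\<gamma> (conj_mt I g g' (unit_mt a w), 0)
    = (\<Sum>i\<in>A. \<Sum>j\<in>W. g i a * g' w j * \<gamma> (unit_mt i j, 0))"
proof -
  have "a \<in> I" "w \<in> I" using a w AI WI by auto
  then have c: "conj_mt I g g' (unit_mt a w) = (\<lambda>i j. g i a * g' w j)" by (rule conj_unit)
  have "(\<lambda>i j. g i a * g' w j) \<in> supp (A \<times> W)"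
  proof (rule suppI)
    fix i j assume "g i a * g' w j \<noteq> 0"
    then have "(i, a) \<in> R" "(w, j) \<in> R" using suppD[OF g(1), of i a] suppD[OF g(2), of w j] by auto
    then show "(i, j) \<in> A \<times> W" using colA a rowW w by blast
  qed
  from form_V_expand[OF lin this] c show ?thesis by simp
qed

text \<open>
  Add a generic multiple of the trace of the pairing \<open>\<sigma>\<close> to a nondegenerate functional. All but
  finitely many multiples keep it nondegenerate and make the matrix of its values on \<open>A2 \<times> W2\<close>
  invertible; \<open>C\<close> is the inverse of that matrix.
\<close>

lemma generic_form:
  assumes inf: "infinite (UNIV :: 'a set)" and fr: "frob I R \<rho> S"
  shows "\<exists>\<gamma> C. linear_form pscale \<gamma> \<and> nondeg (\<lambda>p q. \<gamma> (sbr I \<rho> p q)) (supp R \<times> S) \<and>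
    (\<forall>i\<in>A2. \<forall>k\<in>A2. (\<Sum>j\<in>A2. \<gamma> (unit_mt i (\<sigma> j), 0) * C j k) = (if i = k then 1 else 0)) \<and>
    (\<forall>i\<in>A2. \<forall>k\<in>A2. (\<Sum>j\<in>A2. C i j * \<gamma> (unit_mt j (\<sigma> k), 0)) = (if i = k then 1 else 0))"
proof -
  obtain \<gamma>0 where lin0: "linear_form pscale \<gamma>0" and nd: "nondeg (\<lambda>p q. \<gamma>0 (sbr I \<rho> p q)) (supp R \<times> S)"
    using fr by (auto simp: frob_def)
  define \<xi> :: "'a mt \<times> 'a mt \<Rightarrow> 'a" where "\<xi> p = (\<Sum>i\<in>A2. fst p i (\<sigma> i))" for p
  have lin\<xi>: "linear_form pscale \<xi>"
    by (auto simp: linear_form_def \<xi>_def sum.distrib sum_distrib_left pscale_def)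
  define N where "N i j = \<gamma>0 (unit_mt i (\<sigma> j), 0)" for i j
  obtain F where F: "finite F" "supp R \<times> S \<subseteq> P.span F" using prod_span[OF finR] by blast
  let ?T1 = "{t. \<not> nondeg (\<lambda>p q. \<gamma>0 (sbr I \<rho> p q) + t * \<xi> (sbr I \<rho> p q)) (supp R \<times> S)}"
  let ?T2 = "{t. \<exists>u. (\<forall>j\<in>A2. (\<Sum>i\<in>A2. N i j * u i) + t * u j = 0) \<and> (\<exists>i\<in>A2. u i \<noteq> 0)}"
  let ?T3 = "{t. \<exists>u. (\<forall>j\<in>A2. (\<Sum>i\<in>A2. N j i * u i) + t * u j = 0) \<and> (\<exists>i\<in>A2. u i \<noteq> 0)}"
  have "finite ?T1"
    by (rule P.nondeg_perturbation[OF bilin_sbr[OF lin0] bilin_sbr[OF lin\<xi>] subspace_prod F nd])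
  then have "finite (?T1 \<union> ?T2 \<union> ?T3)"
    using generic_kernel[OF finA(1), of N] generic_kernel[OF finA(1), of "\<lambda>i j. N j i"] by simp
  from ex_new_if_finite[OF inf this] obtain t where t: "t \<notin> ?T1" "t \<notin> ?T2" "t \<notin> ?T3"
    unfolding Un_iff by blast
  define \<gamma> where "\<gamma> p = \<gamma>0 p + t * \<xi> p" for p
  have lin: "linear_form pscale \<gamma>"
    using lin0 lin\<xi> by (simp add: \<gamma>_def linear_form_def algebra_simps)
  have M: "\<gamma> (unit_mt i (\<sigma> j), 0) = N i j + (if i = j then t else 0)" if "i \<in> A2" "j \<in> A2" for i j
  proof -
    have "\<xi> (unit_mt i (\<sigma> j), 0) = (\<Sum>k\<in>A2. if k = i then (if i = j then 1 else 0) else 0)"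
      unfolding \<xi>_def fst_conv unit_mt_def using \<sigma>'\<sigma>[OF that(1)] \<sigma>'\<sigma>[OF that(2)]
      by (intro sum.cong) auto
    then show ?thesis using finA that by (simp add: \<gamma>_def N_def)
  qed
  have s1: "(\<Sum>i\<in>A2. \<gamma> (unit_mt i (\<sigma> j), 0) * u i) = (\<Sum>i\<in>A2. N i j * u i) + t * u j" if "j \<in> A2" for j u
  proof -
    have "(\<Sum>i\<in>A2. \<gamma> (unit_mt i (\<sigma> j), 0) * u i) = (\<Sum>i\<in>A2. N i j * u i + (if i = j then t * u i else 0))"
      using M that by (intro sum.cong) (auto simp: algebra_simps)
    then show ?thesis using that finA by (simp add: sum.distrib)
  qed
  have s2: "(\<Sum>i\<in>A2. \<gamma> (unit_mt j (\<sigma> i), 0) * u i) = (\<Sum>i\<in>A2. N j i * u i) + t * u j" if "j \<in> A2" for j u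
  proof -
    have "(\<Sum>i\<in>A2. \<gamma> (unit_mt j (\<sigma> i), 0) * u i) = (\<Sum>i\<in>A2. N j i * u i + (if i = j then t * u i else 0))"
      using M that by (intro sum.cong) (auto simp: algebra_simps)
    then show ?thesis using that finA by (simp add: sum.distrib)
  qed
  have "\<exists>C. (\<forall>i\<in>A2. \<forall>k\<in>A2. (\<Sum>j\<in>A2. \<gamma> (unit_mt i (\<sigma> j), 0) * C j k) = (if i = k then 1 else 0)) \<and>
    (\<forall>i\<in>A2. \<forall>k\<in>A2. (\<Sum>j\<in>A2. C i j * \<gamma> (unit_mt j (\<sigma> k), 0)) = (if i = k then 1 else 0))"
  proof (rule inverse_exists[OF finA(1)])
    fix u assume u: "\<And>j. j \<in> A2 \<Longrightarrow> (\<Sum>i\<in>A2. \<gamma> (unit_mt i (\<sigma> j), 0) * u i) = 0"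
    have "\<forall>j\<in>A2. (\<Sum>i\<in>A2. N i j * u i) + t * u j = 0" using u s1 by simp
    with t(2) show "\<forall>i\<in>A2. u i = 0" by blast
  next
    fix u assume u: "\<And>j. j \<in> A2 \<Longrightarrow> (\<Sum>i\<in>A2. \<gamma> (unit_mt j (\<sigma> i), 0) * u i) = 0"
    have "\<forall>j\<in>A2. (\<Sum>i\<in>A2. N j i * u i) + t * u j = 0" using u s2 by simp
    with t(3) show "\<forall>i\<in>A2. u i = 0" by blast
  qed
  moreover have "nondeg (\<lambda>p q. \<gamma> (sbr I \<rho> p q)) (supp R \<times> S)" using t(1) by (simp add: \<gamma>_def)
  ultimately show ?thesis using lin by blast
qed

text \<open>
  Conjugation by the matrix that is \<open>C\<close> transposed on \<open>A2\<close> and the identity elsewhere.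
\<close>

lemma normalise_corner:
  assumes eq: "equivariant I R \<rho> S"
    and inf: "infinite (UNIV :: 'a set)" and fr: "frob I R \<rho> S"
  shows "\<exists>\<gamma>. linear_form pscale \<gamma> \<and> nondeg (\<lambda>p q. \<gamma> (sbr I \<rho> p q)) (supp R \<times> S) \<and>
    (\<forall>i\<in>A2. \<forall>j\<in>A2. \<gamma> (unit_mt i (\<sigma> j), 0) = (if i = j then 1 else 0))"
proof -
  obtain \<gamma> C where lin: "linear_form pscale \<gamma>" and nd: "nondeg (\<lambda>p q. \<gamma> (sbr I \<rho> p q)) (supp R \<times> S)"
    and C: "\<And>i k. i \<in> A2 \<Longrightarrow> k \<in> A2 \<Longrightarrow> (\<Sum>j\<in>A2. \<gamma> (unit_mt i (\<sigma> j), 0) * C j k) = (if i = k then 1 else 0)"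
     "\<And>i k. i \<in> A2 \<Longrightarrow> k \<in> A2 \<Longrightarrow> (\<Sum>j\<in>A2. C i j * \<gamma> (unit_mt j (\<sigma> k), 0)) = (if i = k then 1 else 0)"
    using generic_form[OF inf fr] by blast
  define g where "g i j = (if i \<in> A2 \<and> j \<in> A2 then C j i else if i = j \<and> i \<in> I then 1 else 0)" for i j
  define g' where "g' i j = (if i \<in> A2 \<and> j \<in> A2 then \<gamma> (unit_mt j (\<sigma> i), 0) else if i = j \<and> i \<in> I then 1 else 0)" for i j
  have gs: "g \<in> supp R" "g' \<in> supp R"
    using A2 AA reflR by (auto simp: supp_def g_def g'_def split: if_splits)
  have A2I: "A2 \<subseteq> I" using A2 AI by blast
  have bl: "mmul I x y = idm I"
    if x: "\<And>i j. x i j = (if i \<in> A2 \<and> j \<in> A2 then X i j else if i = j \<and> i \<in> I then 1 else 0)"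
     and y: "\<And>i j. y i j = (if i \<in> A2 \<and> j \<in> A2 then Y i j else if i = j \<and> i \<in> I then 1 else 0)"
     and XY: "\<And>i j. i \<in> A2 \<Longrightarrow> j \<in> A2 \<Longrightarrow> (\<Sum>k\<in>A2. X i k * Y k j) = (if i = j then 1 else 0)"
   for x y :: "'a mt" and X Y
  proof (rule mt_eqI)
    fix i j
    show "mmul I x y i j = idm I i j"
    proof (cases "i \<in> A2")
      case i: True
      have "mmul I x y i j = (\<Sum>k\<in>A2. x i k * y k j)"
        unfolding mmul_apply using finI A2I i by (intro sum.mono_neutral_right) (auto simp: x)
      also have "\<dots> = idm I i j"
      proof (cases "j \<in> A2")
        case True
        then have "(\<Sum>k\<in>A2. x i k * y k j) = (\<Sum>k\<in>A2. X i k * Y k j)"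
          using i by (intro sum.cong) (auto simp: x y)
        with XY[OF i True] i A2I show ?thesis by (auto simp: idm_def)
      next
        case False
        then have "(\<Sum>k\<in>A2. x i k * y k j) = 0" by (intro sum.neutral) (auto simp: y)
        with i False show ?thesis by (auto simp: idm_def)
      qed
      finally show ?thesis .
    next
      case False
      have "mmul I x y i j = (\<Sum>k\<in>I. if k = i then y i j else 0)"
        unfolding mmul_apply using False by (intro sum.cong) (auto simp: x)
      also have "\<dots> = idm I i j" using finI False by (auto simp: idm_def y)
      finally show ?thesis .
    qed
  qed
  have inv: "mmul I g g' = idm I" "mmul I g' g = idm I"
    using C by (auto intro!: bl[OF g_def g'_def] bl[OF g'_def g_def] simp: mult.commute)
  obtain \<gamma>' where \<gamma>': "linear_form pscale \<gamma>'" "nondeg (\<lambda>p q. \<gamma>' (sbr I \<rho> p q)) (supp R \<times> S)"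
    and eq': "\<And>x. \<gamma>' (x, 0) = \<gamma> (conj_mt I g g' x, 0)"
    using conj_nondeg[OF finI RI transR eq gs inv lin nd] by blast
  have "\<gamma>' (unit_mt a (\<sigma> b), 0) = (if a = b then 1 else 0)" if ab: "a \<in> A2" "b \<in> A2" for a b
  proof -
    have w: "\<sigma> b \<in> W" "\<sigma> b \<notin> A2" using ab \<sigma>W W2 notA by auto
    have "\<gamma>' (unit_mt a (\<sigma> b), 0) = (\<Sum>i\<in>A. \<Sum>j\<in>W. g i a * g' (\<sigma> b) j * \<gamma> (unit_mt i j, 0))"
      unfolding eq' using ab A2 w by (intro conj_form lin gs) auto
    also have "\<dots> = (\<Sum>i\<in>A. \<Sum>j\<in>W. if j = \<sigma> b then g i a * \<gamma> (unit_mt i (\<sigma> b), 0) else 0)"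
      using w WI by (intro sum.cong) (auto simp: g'_def)
    also have "\<dots> = (\<Sum>i\<in>A. g i a * \<gamma> (unit_mt i (\<sigma> b), 0))" using finA w by simp
    also have "\<dots> = (\<Sum>i\<in>A2. g i a * \<gamma> (unit_mt i (\<sigma> b), 0))"
      using finA A2 ab by (intro sum.mono_neutral_right) (auto simp: g_def)
    also have "\<dots> = (\<Sum>i\<in>A2. C a i * \<gamma> (unit_mt i (\<sigma> b), 0))"
      using ab by (intro sum.cong) (auto simp: g_def)
    also have "\<dots> = (if a = b then 1 else 0)" by (rule C(2)[OF ab])
    finally show ?thesis .
  qed
  with \<gamma>' show ?thesis by blast
qed

text \<open>
  Once the pairing is the identity on \<open>A2 \<times> W2\<close>, its values on the rest of \<open>A \<times> W\<close> are cleared by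
  one elementary conjugation \<open>1 + e\<close>. By the dichotomy the rest is \<open>(A - A2) \<times> W\<close> or \<open>A \<times> (W - W2)\<close>,
  and in each case the needed entries of \<open>e\<close> belong to \<open>R\<close>.
\<close>

lemma normalise:
  assumes eq: "equivariant I R \<rho> S"
    and inf: "infinite (UNIV :: 'a set)" and fr: "frob I R \<rho> S"
  shows "\<exists>\<gamma>. linear_form pscale \<gamma> \<and> nondeg (\<lambda>p q. \<gamma> (sbr I \<rho> p q)) (supp R \<times> S) \<and>
    (\<forall>v\<in>supp (A \<times> W). \<gamma> (v, 0) = (\<Sum>i\<in>A2. v i (\<sigma> i)))"
proof -
  obtain \<gamma> where lin: "linear_form pscale \<gamma>" and nd: "nondeg (\<lambda>p q. \<gamma> (sbr I \<rho> p q)) (supp R \<times> S)"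
    and corner: "\<And>i j. i \<in> A2 \<Longrightarrow> j \<in> A2 \<Longrightarrow> \<gamma> (unit_mt i (\<sigma> j), 0) = (if i = j then 1 else 0)"
    using normalise_corner[OF eq inf fr] by blast
  define f where "f a w = \<gamma> (unit_mt a w, 0)" for a w
  \<comment> \<open>By the dichotomy \<open>A - A2\<close> or \<open>W - W2\<close> is empty, so only one of the two branches occurs. In both cases \<open>e\<close> squares to zero.\<close>
  define e :: "'a mt" where "e i k = (if i \<in> A2 \<and> k \<in> A - A2 then - f k (\<sigma> i)
     else if i \<in> W - W2 \<and> k \<in> W2 then f (\<sigma>' k) i else 0)" for i k
  have es: "e \<in> supp R"
    using A2 AA dich by (auto simp: supp_def e_def split: if_splits)
  have ids: "idm I \<in> supp R" using reflR by (auto simp: supp_def idm_def split: if_splits)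
  have e0: "e i k * e k j = 0" for i k j
    using notA W2 A2 disj by (auto simp: e_def)
  have ee: "mmul I e e = 0" by (intro mt_eqI) (simp add: mmul_apply e0)
  have IR: "x \<in> supp (I \<times> I)" if "x \<in> supp R" for x using that supp_mono[OF RI] by blast
  define g where "g = idm I + e"
  define g' where "g' = idm I - e"
  have gs: "g \<in> supp R" "g' \<in> supp R"
    unfolding g_def g'_def using es ids by (auto intro: M.subspace_add M.subspace_diff subspace_supp)
  have inv: "mmul I g g' = idm I" "mmul I g' g = idm I"
    by (simp_all add: g_def g'_def mmul_add_left mmul_diff_left mmul_add_right mmul_diff_right ee
        mmul_idm_left[OF finI IR[OF es]] mmul_idm_right[OF finI IR[OF es]] mmul_idm_left[OF finI IR[OF ids]])
  obtain \<gamma>' where \<gamma>': "linear_form pscale \<gamma>'" "nondeg (\<lambda>p q. \<gamma>' (sbr I \<rho> p q)) (supp R \<times> S)"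
    and eq': "\<And>x. \<gamma>' (x, 0) = \<gamma> (conj_mt I g g' x, 0)"
    using conj_nondeg[OF finI RI transR eq gs inv lin nd] by blast
  have form: "\<gamma>' (unit_mt a w, 0) = (if a \<in> A2 \<and> w = \<sigma> a then 1 else 0)" if aw: "a \<in> A" "w \<in> W" for a w
  proof -
    have wI: "w \<in> I" "a \<in> I" "w \<notin> A" using aw WI AI notA by auto
    have "\<gamma>' (unit_mt a w, 0) = (\<Sum>i\<in>A. \<Sum>j\<in>W. g i a * g' w j * f i j)"
      unfolding eq' f_def using aw by (intro conj_form lin gs)
    also have "\<dots> = (if a \<in> A2 \<and> w = \<sigma> a then 1 else 0)"
    proof (cases "w \<in> W2")
      case w: True
      have "(\<Sum>i\<in>A. \<Sum>j\<in>W. g i a * g' w j * f i j) = (\<Sum>i\<in>A. \<Sum>j\<in>W. if j = w then g i a * f i w else 0)"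
        using w wI notA by (intro sum.cong) (auto simp: g'_def idm_def e_def)
      also have "\<dots> = (\<Sum>i\<in>A. g i a * f i w)" using finA aw by simp
      also have "\<dots> = (\<Sum>i\<in>A. (if i = a then f a w else 0) + e i a * f i w)"
        using wI by (intro sum.cong) (auto simp: g_def idm_def algebra_simps)
      also have "\<dots> = f a w + (\<Sum>i\<in>A. e i a * f i w)" using finA aw by (simp add: sum.distrib)
      also have "(\<Sum>i\<in>A. e i a * f i w) = (\<Sum>i\<in>A. if i = \<sigma>' w then (if a \<in> A2 then 0 else - f a w) else 0)"
      proof (rule sum.cong[OF refl])
        fix i assume i: "i \<in> A"
        then have iW: "i \<notin> W" using disj by blast
        show "e i a * f i w = (if i = \<sigma>' w then if a \<in> A2 then 0 else - f a w else 0)"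
        proof (cases "i \<in> A2")
          case True
          have "f i w = (if i = \<sigma>' w then 1 else 0)"
            using corner[OF True \<sigma>'A[OF w]] \<sigma>\<sigma>'[OF w] by (simp add: f_def)
          then show ?thesis using True aw w iW \<sigma>\<sigma>' by (auto simp: e_def)
        next
          case False
          then show ?thesis using iW w \<sigma>'A by (auto simp: e_def)
        qed
      qed
      also have "\<dots> = (if a \<in> A2 then 0 else - f a w)" using finA w \<sigma>'A A2 by auto
      finally show ?thesis
        using corner[OF _ \<sigma>'A[OF w], of a] w \<sigma>\<sigma>' \<sigma>'\<sigma> by (auto simp: f_def)
    next
      case w: False
      then have d: "A2 = A" using dich aw by blast
      have "(\<Sum>i\<in>A. \<Sum>j\<in>W. g i a * g' w j * f i j) = (\<Sum>i\<in>A. \<Sum>j\<in>W. if i = a then g' w j * f a j else 0)"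
        using wI aw disj d by (intro sum.cong) (auto simp: g_def idm_def e_def)
      also have "\<dots> = (\<Sum>i\<in>A. if i = a then \<Sum>j\<in>W. g' w j * f a j else 0)"
        by (intro sum.cong) auto
      also have "\<dots> = (\<Sum>j\<in>W. g' w j * f a j)" using finA aw by simp
      also have "\<dots> = (\<Sum>j\<in>W. (if j = w then f a w else 0) - e w j * f a j)"
        using wI by (intro sum.cong) (auto simp: g'_def idm_def algebra_simps)
      also have "\<dots> = f a w - (\<Sum>j\<in>W. e w j * f a j)" using finA aw by (simp add: sum_subtractf)
      also have "(\<Sum>j\<in>W. e w j * f a j) = (\<Sum>j\<in>W. if j = \<sigma> a then f a w else 0)"
      proof (rule sum.cong[OF refl])
        fix j assume j: "j \<in> W"
        show "e w j * f a j = (if j = \<sigma> a then f a w else 0)"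
        proof (cases "j \<in> W2")
          case True
          have "f a j = (if a = \<sigma>' j then 1 else 0)"
            using corner[OF _ \<sigma>'A[OF True], of a] \<sigma>\<sigma>'[OF True] aw d by (simp add: f_def)
          then show ?thesis using True aw w wI d \<sigma>\<sigma>' \<sigma>'\<sigma> by (auto simp: e_def)
        next
          case False
          then show ?thesis using w wI \<sigma>W d aw by (auto simp: e_def)
        qed
      qed
      also have "\<dots> = f a w" using finA d aw \<sigma>W W2 by auto
      finally show ?thesis using w d aw \<sigma>W by auto
    qed
    finally show ?thesis .
  qed
  have "\<gamma>' (v, 0) = (\<Sum>i\<in>A2. v i (\<sigma> i))" if v: "v \<in> supp (A \<times> W)" for v
  proof -
    have "\<gamma>' (v, 0) = (\<Sum>a\<in>A. \<Sum>w\<in>W. v a w * \<gamma>' (unit_mt a w, 0))"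
      by (rule form_V_expand[OF \<gamma>'(1) v])
    also have "\<dots> = (\<Sum>a\<in>A. \<Sum>w\<in>W. if w = \<sigma> a then (if a \<in> A2 then v a w else 0) else 0)"
      using form by (intro sum.cong refl) auto
    also have "\<dots> = (\<Sum>a\<in>A. if a \<in> A2 then v a (\<sigma> a) else 0)"
      using finA \<sigma>W W2 by (intro sum.cong refl) auto
    also have "\<dots> = (\<Sum>i\<in>A2. v i (\<sigma> i))"
      using finA A2 by (simp add: sum.inter_restrict[symmetric] Int_absorb1)
    finally show ?thesis .
  qed
  with \<gamma>' show ?thesis by blast
qed

theorem frob_reduction_iff:
  assumes eq: "equivariant I R \<rho> S"
    and inf: "infinite (UNIV :: 'a set)"
  shows "frob I R \<rho> S \<longleftrightarrow> frob I' R' \<rho> S"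
proof
  assume "frob I R \<rho> S"
  from normalise[OF eq inf this] obtain \<gamma> where lin: "linear_form pscale \<gamma>"
    and nd: "nondeg (\<lambda>p q. \<gamma> (sbr I \<rho> p q)) (supp R \<times> S)"
    and n: "\<And>v. v \<in> supp (A \<times> W) \<Longrightarrow> \<gamma> (v, 0) = (\<Sum>i\<in>A2. v i (\<sigma> i))"
    by blast
  have "linear_form pscale (\<lambda>p. \<gamma> (map_prod \<pi> id p))"
  proof -
    have "map_prod \<pi> id (p + q) = map_prod \<pi> id p + map_prod \<pi> id q"
      "map_prod \<pi> id (pscale c p) = pscale c (map_prod \<pi> id p)" for p q c
      by (cases p; cases q; simp add: \<pi>_add \<pi>_scale)+
    then show ?thesis
      unfolding linear_form_def by (simp only: P.functional_add[OF lin] P.functional_scale[OF lin]) simp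
  qed
  moreover have "nondeg (\<lambda>p q. \<gamma> (map_prod \<pi> id (sbr I' \<rho> p q))) (supp R' \<times> S)"
    using nondeg_iff[OF lin n] nd by blast
  ultimately show "frob I' R' \<rho> S" by (auto simp: frob_def)
qed (rule frob_lift)

end

section \<open>Bilinear forms as a module\<close>

definition tp :: "'a mt \<Rightarrow> 'a mt" where "tp x = (\<lambda>i j. x j i)"

definition restr :: "nat set \<Rightarrow> 'a::field mt \<Rightarrow> 'a mt" where
  "restr L x = (\<lambda>i j. if i \<in> L \<and> j \<in> L then x i j else 0)"

text \<open>
  The action \<open>s \<mapsto> s y + y\<^sup>T s\<close> of matrices on bilinear forms. Cutting \<open>y\<close> down to \<open>L\<close> makes the
  action local; in a seaweed whose last block is \<open>L\<close> it loses nothing (\<open>form_act_full\<close>).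
\<close>

definition form_act :: "nat set \<Rightarrow> 'a::field mt \<Rightarrow> 'a mt \<Rightarrow> 'a mt" where
  "form_act L y s = mmul L s (restr L y) + mmul L (tp (restr L y)) s"

text \<open>Symmetric forms for \<open>\<epsilon> = 1\<close> and alternating forms for \<open>\<epsilon> = - 1\<close>.\<close>

definition forms :: "nat set \<Rightarrow> 'a::field \<Rightarrow> 'a mt set" where
  "forms L \<epsilon> = {s \<in> supp (L \<times> L). tp s = mscale \<epsilon> s}"

lemma tp_tp [simp]: "tp (tp x) = x" by (simp add: tp_def)

lemma tp_apply: "tp x i j = x j i" by (simp add: tp_def)

lemma tp_add: "tp (x + y) = tp x + tp y" and tp_diff: "tp (x - y) = tp x - tp y"
  and tp_minus: "tp (- x) = - tp x" and tp_scale: "tp (mscale c x) = mscale c (tp x)"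
  by (auto intro!: mt_eqI simp: tp_def)

lemma tp_mmul: "tp (mmul I x y) = mmul I (tp y) (tp x)"
  by (intro mt_eqI) (simp add: tp_def mmul_apply mult.commute)

lemma tp_idm: "tp (idm I) = idm I"
  by (intro mt_eqI) (auto simp: tp_def idm_def)

lemma tp_supp: "tp x \<in> supp (R\<inverse>) \<longleftrightarrow> x \<in> supp R"
  by (auto simp: supp_def tp_def)

lemma restr_supp: "restr L x \<in> supp (L \<times> L)"
  by (auto simp: supp_def restr_def)

lemma restr_add: "restr L (x + y) = restr L x + restr L y"
  and restr_scale: "restr L (mscale c x) = mscale c (restr L x)"
  and restr_cong: "(\<And>i j. i \<in> L \<Longrightarrow> j \<in> L \<Longrightarrow> x i j = y i j) \<Longrightarrow> restr L x = restr L y"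
  by (auto intro!: mt_eqI simp: restr_def)

lemma mmul_supp_square: "x \<in> supp (L \<times> L) \<Longrightarrow> y \<in> supp (L \<times> L) \<Longrightarrow> mmul L x y \<in> supp (L \<times> L)"
  by (rule mmul_supp) (auto intro: transI)

lemma tp_square: "x \<in> supp (L \<times> L) \<Longrightarrow> tp x \<in> supp (L \<times> L)"
  by (auto simp: supp_def tp_def)

lemma form_act_forms: "s \<in> forms L \<epsilon> \<Longrightarrow> form_act L y s \<in> forms L \<epsilon>"
proof -
  assume s: "s \<in> forms L \<epsilon>"
  then have s1: "s \<in> supp (L \<times> L)" and s2: "tp s = mscale \<epsilon> s" by (auto simp: forms_def)
  have "form_act L y s \<in> supp (L \<times> L)"
    unfolding form_act_def
    by (intro M.subspace_add subspace_supp mmul_supp_square tp_square restr_supp s1)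
  moreover have "tp (form_act L y s) = mscale \<epsilon> (form_act L y s)"
    by (simp add: form_act_def tp_add tp_mmul s2 mmul_scale_left mmul_scale_right M.scale_right_distrib add.commute)
  ultimately show ?thesis by (simp add: forms_def)
qed

lemma local_action_forms: assumes "finite L" shows "local_action (form_act L) L (forms L \<epsilon>)"
proof
  show "form_act L (x + y) s = form_act L x s + form_act L y s" for x y s :: "'a mt"
    by (simp add: form_act_def restr_add tp_add mmul_add_left mmul_add_right algebra_simps)
  show "form_act L x (s + t) = form_act L x s + form_act L x t" for x s t :: "'a mt"
    by (simp add: form_act_def mmul_add_left mmul_add_right algebra_simps)
  show "form_act L (mscale c x) s = mscale c (form_act L x s)" for x s :: "'a mt" and c
    by (simp add: form_act_def restr_scale tp_scale mmul_scale_left mmul_scale_right M.scale_right_distrib)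
  show "form_act L x (mscale c s) = mscale c (form_act L x s)" for x s :: "'a mt" and c
    by (simp add: form_act_def mmul_scale_left mmul_scale_right M.scale_right_distrib)
  show "form_act L x s = form_act L y s" if "\<And>i j. i \<in> L \<Longrightarrow> j \<in> L \<Longrightarrow> x i j = y i j" for x y s :: "'a mt"
    using restr_cong[of L x y] that by (simp add: form_act_def)
  show "M.subspace (forms L \<epsilon>)"
    using subspace_supp[of "L \<times> L"]
    by (auto simp: M.subspace_def forms_def tp_add tp_scale M.scale_right_distrib M.scale_left_commute
        intro!: mt_eqI simp: tp_apply)
  have "finite (L \<times> L)" using assms by simp
  from supp_span[OF this] show "\<exists>F. finite F \<and> forms L \<epsilon> \<subseteq> M.span F"
    using assms by (intro exI[of _ "units (L \<times> L)"]) (auto simp: units_def forms_def)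
qed

lemma restr_mmul:
  assumes fin: "finite I" and LI: "L \<subseteq> I" and x: "x \<in> supp R" and closed: "\<And>i j. (i, j) \<in> R \<Longrightarrow> i \<in> L \<Longrightarrow> j \<in> L"
  shows "restr L (mmul I x y) = mmul L (restr L x) (restr L y)"
proof (rule mt_eqI)
  fix i j
  show "restr L (mmul I x y) i j = mmul L (restr L x) (restr L y) i j"
  proof (cases "i \<in> L \<and> j \<in> L")
    case True
    have "(\<Sum>k\<in>I. x i k * y k j) = (\<Sum>k\<in>L. x i k * y k j)"
    proof (rule sum.mono_neutral_right[OF fin LI], rule ballI)
      fix k assume "k \<in> I - L"
      then have "(i, k) \<notin> R" using closed True by blast
      then show "x i k * y k j = 0" using supp_zero[OF x] by simp
    qed
    with True show ?thesis by (simp add: restr_def mmul_apply cong: sum.cong)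
  next
    case False
    have "restr L x i k * restr L y k j = 0" if "k \<in> L" for k
      using False by (auto simp: restr_def)
    with False show ?thesis by (auto simp: restr_def[of L "mmul I x y"] mmul_apply)
  qed
qed

text \<open>
  A unit \<open>g\<close> with inverse \<open>g'\<close> acts on a form by \<open>s \<mapsto> g'\<^sup>T s g'\<close>. As rows in \<open>L\<close> have their support
  in \<open>L\<close>, restriction to the corner \<open>L \<times> L\<close> is multiplicative, so only the corners of \<open>g\<close> and \<open>g'\<close>
  enter.
\<close>

lemma equivariant_forms:
  assumes fin: "finite I" and LI: "L \<subseteq> I" and RI: "R \<subseteq> I \<times> I" and tr: "trans R"
    and closed: "\<And>i j. (i, j) \<in> R \<Longrightarrow> i \<in> L \<Longrightarrow> j \<in> L"
  shows "equivariant I R (form_act L) (forms L \<epsilon>)"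
  unfolding equivariant_def
proof (intro ballI impI)
  fix g g' :: "'a mt" assume g: "g \<in> supp R" and g': "g' \<in> supp R"
    and gg': "mmul I g g' = idm I" and g'g: "mmul I g' g = idm I"
  define G where "G = restr L g'"
  define H where "H = restr L g"
  have finL: "finite L" using finite_subset[OF LI fin] .
  have GL: "G \<in> supp (L \<times> L)" and HL: "H \<in> supp (L \<times> L)" by (simp_all add: G_def H_def restr_supp)
  have rid: "restr L (idm I) = idm L" using LI by (intro mt_eqI) (auto simp: restr_def idm_def)
  have GH: "mmul L G H = idm L" and HG: "mmul L H G = idm L"
    unfolding G_def H_def using restr_mmul[OF fin LI g' closed, where y = g] restr_mmul[OF fin LI g closed, where y = g']
    by (simp_all add: gg' g'g rid)
  have HGt: "mmul L (tp G) (tp H) = idm L" and GHt: "mmul L (tp H) (tp G) = idm L"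
    by (simp_all add: tp_mmul[symmetric] GH HG tp_idm)
  define T where "T X s = mmul L (tp X) (mmul L s X)" for X s :: "'a mt"
  have Tforms: "T X s \<in> forms L \<epsilon>" if "X \<in> supp (L \<times> L)" "s \<in> forms L \<epsilon>" for X s
  proof -
    have s: "s \<in> supp (L \<times> L)" "tp s = mscale \<epsilon> s" using that by (auto simp: forms_def)
    have "T X s \<in> supp (L \<times> L)" unfolding T_def by (intro mmul_supp_square tp_square that s)
    moreover have "tp (T X s) = mscale \<epsilon> (T X s)"
      by (simp add: T_def tp_mmul s(2) mmul_assoc mmul_scale_left mmul_scale_right)
    ultimately show ?thesis by (simp add: forms_def)
  qed
  have TT: "T X (T Y s) = s" if "mmul L Y X = idm L" "mmul L (tp X) (tp Y) = idm L" "s \<in> supp (L \<times> L)" for X Y s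
  proof -
    have "T X (T Y s) = mmul L (mmul L (tp X) (tp Y)) (mmul L s (mmul L Y X))"
      by (simp only: T_def mmul_assoc)
    also have "\<dots> = s" unfolding that mmul_idm_right[OF finL that(3)] by (rule mmul_idm_left[OF finL that(3)])
    finally show ?thesis .
  qed
  have conj: "restr L (conj_mt I g g' y) = mmul L H (mmul L (restr L y) G)" if y: "y \<in> supp R" for y
    unfolding conj_mt_def
    by (simp only: restr_mmul[OF fin LI mmul_supp[OF tr g y] closed] restr_mmul[OF fin LI g closed] G_def H_def mmul_assoc[of L])
  have act: "T G (form_act L y s) = form_act L (conj_mt I g g' y) (T G s)"
    if y: "y \<in> supp R" and s: "s \<in> supp (L \<times> L)" for y s
  proof -
    have a: "mmul L G (mmul L H z) = z" if "z \<in> supp (L \<times> L)" for z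
      unfolding mmul_assoc[symmetric] GH by (rule mmul_idm_left[OF finL that])
    have b: "mmul L (tp H) (mmul L (tp G) z) = z" if "z \<in> supp (L \<times> L)" for z
      unfolding mmul_assoc[symmetric] GHt by (rule mmul_idm_left[OF finL that])
    let ?y = "restr L y"
    have c: "mmul L (T G s) (mmul L H (mmul L ?y G)) = mmul L (tp G) (mmul L s (mmul L ?y G))"
      unfolding T_def mmul_assoc
      by (subst a) (simp_all add: mmul_supp_square restr_supp GL)
    have d: "mmul L (tp (mmul L H (mmul L ?y G))) (T G s) = mmul L (tp G) (mmul L (tp ?y) (mmul L s G))"
      unfolding T_def tp_mmul mmul_assoc
      by (subst b) (simp_all add: mmul_supp_square restr_supp GL s)
    show ?thesis
      unfolding form_act_def conj[OF y] c d by (simp add: T_def mmul_add_left mmul_add_right mmul_assoc)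
  qed
  have "intertwines I R (form_act L) (forms L \<epsilon>) g g' (T G) (T H)"
    unfolding intertwines_def
  proof (intro conjI allI ballI)
    show "T G (s + t) = T G s + T G t" "T G (mscale c s) = mscale c (T G s)" for s t c
      by (simp_all add: T_def mmul_add_left mmul_add_right mmul_scale_left mmul_scale_right)
    fix s assume s: "s \<in> forms L \<epsilon>"
    then have sL: "s \<in> supp (L \<times> L)" by (simp add: forms_def)
    show "T G s \<in> forms L \<epsilon>" "T H s \<in> forms L \<epsilon>" using Tforms GL HL s by auto
    show "T G (T H s) = s" by (rule TT[OF HG HGt sL])
    show "T H (T G s) = s" by (rule TT[OF GH GHt sL])
    show "T G (form_act L y s) = form_act L (conj_mt I g g' y) (T G s)" if "y \<in> supp R" for y
      by (rule act[OF that sL])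
  qed
  then show "\<exists>T T'. intertwines I R (form_act L) (forms L \<epsilon>) g g' T T'" by blast
qed

section \<open>Transposition\<close>

text \<open>
  The same module, viewed over the transposed algebra through the isomorphism \<open>x \<mapsto> - x\<^sup>T\<close>. It is
  used to exchange the roles of the two compositions.
\<close>

definition contra :: "('a::field mt \<Rightarrow> 'a mt \<Rightarrow> 'a mt) \<Rightarrow> 'a mt \<Rightarrow> 'a mt \<Rightarrow> 'a mt" where
  "contra \<rho> y s = \<rho> (- tp y) s"

lemma contra_contra [simp]: "contra (contra \<rho>) = \<rho>"
  by (intro ext) (simp add: contra_def tp_minus)

lemma mmul_minus: "mmul I (- x) y = - mmul I x y" "mmul I x (- y) = - mmul I x y"
  by (intro mt_eqI, simp add: mmul_apply sum_negf)+

lemma local_action_contra: "local_action \<rho> L S \<Longrightarrow> local_action (contra \<rho>) L S"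
proof -
  assume "local_action \<rho> L S"
  then interpret local_action \<rho> L S .
  have s: "- tp (mscale c x) = mscale c (- tp x)" for c and x :: "'a mt"
    by (intro mt_eqI) (simp add: tp_def)
  have t: "- tp (x + y) = - tp x + - tp y" for x y :: "'a mt"
    by (intro mt_eqI) (simp add: tp_def)
  show ?thesis
  proof
    show "contra \<rho> x s = contra \<rho> y s" if "\<And>i j. i \<in> L \<Longrightarrow> j \<in> L \<Longrightarrow> x i j = y i j" for x y s
      unfolding contra_def using that by (intro act_local) (simp add: tp_def)
  qed (simp_all only: contra_def s t act_add_left act_add_right act_scale_left act_scale_right S_subspace S_fin)
qed

lemma frob_transpose_imp:
  assumes "frob I R \<rho> S" shows "frob I (R\<inverse>) (contra \<rho>) S"
proof -
  obtain \<gamma> where lin: "linear_form pscale \<gamma>" and nd: "nondeg (\<lambda>p q. \<gamma> (sbr I \<rho> p q)) (supp R \<times> S)"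
    using assms by (auto simp: frob_def)
  define \<theta> where "\<theta> p = (- tp (fst p), snd p)" for p :: "'a mt \<times> 'a mt"
  have \<theta>add: "\<theta> (p + q) = \<theta> p + \<theta> q" and \<theta>sc: "\<theta> (pscale c p) = pscale c (\<theta> p)" for p q c
    by (simp_all add: \<theta>_def tp_add tp_scale pscale_def)
  have \<theta>\<theta>: "\<theta> (\<theta> p) = p" for p by (simp add: \<theta>_def tp_minus)
  have br: "\<theta> (sbr I (contra \<rho>) p q) = sbr I \<rho> (\<theta> p) (\<theta> q)" for p q
    by (simp add: \<theta>_def sbr_def contra_def comm_def tp_diff tp_mmul mmul_minus)
  have mem: "\<theta> p \<in> supp R \<times> S \<longleftrightarrow> p \<in> supp (R\<inverse>) \<times> S" for p
    by (auto simp: \<theta>_def mem_Times_iff supp_def tp_def)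
  have "linear_form pscale (\<lambda>p. \<gamma> (\<theta> p))"
    unfolding linear_form_def \<theta>add \<theta>sc
    by (simp only: P.functional_add[OF lin] P.functional_scale[OF lin]) simp
  moreover have "nondeg (\<lambda>p q. \<gamma> (\<theta> (sbr I (contra \<rho>) p q))) (supp (R\<inverse>) \<times> S)"
    unfolding nondeg_def
  proof (intro ballI impI)
    fix p assume p: "p \<in> supp (R\<inverse>) \<times> S" and r: "\<forall>q\<in>supp (R\<inverse>) \<times> S. \<gamma> (\<theta> (sbr I (contra \<rho>) p q)) = 0"
    have rad: "\<gamma> (sbr I \<rho> (\<theta> p) q) = 0" if "q \<in> supp R \<times> S" for q
    proof -
      have "\<theta> q \<in> supp (R\<inverse>) \<times> S" using that mem[of "\<theta> q"] by (simp only: \<theta>\<theta>)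
      with r have "\<gamma> (\<theta> (sbr I (contra \<rho>) p (\<theta> q))) = 0" by (rule bspec)
      then show ?thesis by (simp only: br \<theta>\<theta>)
    qed
    have "\<theta> p \<in> supp R \<times> S" using p by (simp only: mem)
    with nd[unfolded nondeg_def] have "(\<forall>q\<in>supp R \<times> S. \<gamma> (sbr I \<rho> (\<theta> p) q) = 0) \<longrightarrow> \<theta> p = 0"
      by (rule bspec)
    then have "\<theta> p = 0" using rad by simp
    then have "\<theta> (\<theta> p) = \<theta> 0" by (rule arg_cong)
    moreover have "\<theta> 0 = 0" by (auto simp: \<theta>_def tp_def prod_eq_iff intro!: mt_eqI)
    ultimately show "p = 0" by (simp only: \<theta>\<theta>)
  qed
  ultimately show ?thesis by (auto simp: frob_def)
qed

lemma frob_transpose: "frob I R \<rho> S \<longleftrightarrow> frob I (R\<inverse>) (contra \<rho>) S"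
  using frob_transpose_imp[of I R \<rho> S] frob_transpose_imp[of I "R\<inverse>" "contra \<rho>" S] by auto

lemma equivariant_transpose:
  assumes eq: "equivariant I R \<rho> S" shows "equivariant I (R\<inverse>) (contra \<rho>) S"
  unfolding equivariant_def
proof (intro ballI impI)
  fix g g' :: "'a mt" assume g: "g \<in> supp (R\<inverse>)" "g' \<in> supp (R\<inverse>)"
    and inv: "mmul I g g' = idm I" "mmul I g' g = idm I"
  have "tp g' \<in> supp R" "tp g \<in> supp R" using g tp_supp[of "tp g" R] tp_supp[of "tp g'" R] by simp_all
  moreover have "mmul I (tp g') (tp g) = idm I" "mmul I (tp g) (tp g') = idm I"
    by (simp_all add: tp_mmul[symmetric] inv tp_idm)
  ultimately obtain T T' where T: "intertwines I R \<rho> S (tp g') (tp g) T T'"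
    using eq unfolding equivariant_def by blast
  have "T (contra \<rho> y s) = contra \<rho> (conj_mt I g g' y) (T s)" if y: "y \<in> supp (R\<inverse>)" and s: "s \<in> S" for y s
  proof -
    have "- tp y \<in> supp R" using y by (auto simp: supp_def tp_def)
    then have "T (\<rho> (- tp y) s) = \<rho> (conj_mt I (tp g') (tp g) (- tp y)) (T s)"
      using T s by (simp add: intertwines_def)
    moreover have "conj_mt I (tp g') (tp g) (- tp y) = - tp (conj_mt I g g' y)"
      by (simp add: conj_mt_def tp_mmul mmul_minus mmul_assoc)
    ultimately show ?thesis by (simp add: contra_def)
  qed
  with T show "\<exists>T T'. intertwines I (R\<inverse>) (contra \<rho>) S g g' T T'"
    unfolding intertwines_def by (intro exI[of _ T] exI[of _ T']) simp
qed

text \<open>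
  The identity of a block that is not connected to other indices and not seen by the module is
  central, and a central element is in the radical of every form \<open>\<gamma>([x, y])\<close>.
\<close>

lemma central_not_frob:
  assumes la: "local_action \<rho> L S" and fin: "finite I" and AI: "A \<subseteq> I" and ne: "A \<noteq> {}" and LA: "L \<inter> A = {}"
    and refl: "\<And>i. i \<in> A \<Longrightarrow> (i, i) \<in> R" and RI: "R \<subseteq> I \<times> I"
    and split: "\<And>i j. (i, j) \<in> R \<Longrightarrow> i \<in> A \<longleftrightarrow> j \<in> A"
  shows "\<not> frob I R \<rho> S"
proof
  interpret local_action \<rho> L S by fact
  assume "frob I R \<rho> S"
  then obtain \<gamma> where lin: "linear_form pscale \<gamma>" and nd: "nondeg (\<lambda>p q. \<gamma> (sbr I \<rho> p q)) (supp R \<times> S)"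
    by (auto simp: frob_def)
  have mem: "(idm A, 0) \<in> supp R \<times> S"
    using refl M.subspace_0[OF S_subspace] by (auto simp: supp_def idm_def split: if_splits)
  have "sbr I \<rho> (idm A, 0) q = 0" if q: "q \<in> supp R \<times> S" for q
  proof -
    have y: "fst q \<in> supp R" using q by (simp only: mem_Times_iff)
    have "comm I (idm A) (fst q) = 0"
    proof (rule mt_eqI)
      fix i j
      have "mmul I (idm A) (fst q) i j = (\<Sum>k\<in>I. if k = i then (if i \<in> A then fst q i j else 0) else 0)"
        unfolding mmul_apply idm_def by (intro sum.cong) auto
      then have l: "mmul I (idm A) (fst q) i j = (if i \<in> A then fst q i j else 0)"
        using fin AI by auto
      have "mmul I (fst q) (idm A) i j = (\<Sum>k\<in>I. if k = j then (if j \<in> A then fst q i j else 0) else 0)"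
        unfolding mmul_apply idm_def by (intro sum.cong) auto
      then have r: "mmul I (fst q) (idm A) i j = (if j \<in> A then fst q i j else 0)"
        using fin AI by auto
      show "comm I (idm A) (fst q) i j = 0 i j"
        using l r split[of i j] supp_zero[OF y, of i j] by (auto simp: comm_def)
    qed
    moreover have "\<rho> (idm A) (snd q) = 0"
      using LA by (intro act_vanish) (auto simp: idm_def)
    ultimately show ?thesis by (simp add: sbr_def act_zero_right prod_eq_iff)
  qed
  then have "\<forall>q\<in>supp R \<times> S. \<gamma> (sbr I \<rho> (idm A, 0) q) = 0"
    using P.functional_zero[OF lin] by simp
  with nd mem have "(idm A, 0) = (0 :: 'a mt \<times> 'a mt)" unfolding nondeg_def by blast
  then have z: "idm A = (0 :: 'a mt)" by (simp add: prod_eq_iff)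
  obtain a where "a \<in> A" using ne by blast
  with fun_cong[OF fun_cong[OF z, of a], of a] show False by (simp add: idm_def)
qed

section \<open>Seaweed preorders\<close>

text \<open>
  A seaweed is the incidence algebra of this preorder when \<open>\<alpha>\<close> and \<open>\<beta>\<close> number the blocks of the two
  compositions. Monotone functions in place of compositions let the reduction step act on arbitrary
  index sets and cut a block by changing values.
\<close>

definition sw :: "nat set \<Rightarrow> (nat \<Rightarrow> nat) \<Rightarrow> (nat \<Rightarrow> nat) \<Rightarrow> (nat \<times> nat) set" where
  "sw I \<alpha> \<beta> = {(i, j). i \<in> I \<and> j \<in> I \<and> \<alpha> i \<le> \<alpha> j \<and> \<beta> j \<le> \<beta> i}"

lemma sw_converse: "(sw I \<alpha> \<beta>)\<inverse> = sw I \<beta> \<alpha>"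
  by (auto simp: sw_def)

lemma trans_sw: "trans (sw I \<alpha> \<beta>)"
  by (auto simp: sw_def intro!: transI)

text \<open>
  Used to choose \<open>W2\<close> among the last elements of \<open>W\<close>, so that the refined numbering of blocks is
  monotone.
\<close>

lemma upper_subset_exists:
  assumes "finite (W :: nat set)" "r \<le> card W"
  shows "\<exists>U\<subseteq>W. card U = r \<and> (\<forall>x\<in>W - U. \<forall>y\<in>U. x < y)"
  using assms(2)
proof (induction r)
  case 0
  then show ?case by (intro exI[of _ "{}"]) auto
next
  case (Suc r)
  then obtain U where U: "U \<subseteq> W" "card U = r" "\<forall>x\<in>W - U. \<forall>y\<in>U. x < y" by auto
  have finU: "finite U" using U assms finite_subset by blast
  have ne: "W - U \<noteq> {}"
  proof
    assume "W - U = {}"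
    then have "U = W" using U by blast
    with U Suc.prems show False by simp
  qed
  define m where "m = Max (W - U)"
  have fin: "finite (W - U)" using assms by simp
  have m: "m \<in> W - U" "\<And>x. x \<in> W - U \<Longrightarrow> x \<le> m"
    unfolding m_def using Max_in[OF fin ne] Max_ge[OF fin] by auto
  have "x < y" if "x \<in> W - insert m U" "y \<in> insert m U" for x y
    using that m(2)[of x] U(3) by (cases "y = m") auto
  moreover have "card (insert m U) = Suc r" using m finU U by simp
  moreover have "insert m U \<subseteq> W" using m U by auto
  ultimately show ?case by blast
qed

text \<open>
  The reduced preorder is again a seaweed. The first block \<open>B\<close> of \<open>\<beta>\<close> is cut into two, and doubling
  \<open>\<beta>\<close> makes room for this: the lower part \<open>W - W2\<close> gets the value \<open>2 \<beta>\<close> and everything else \<open>2 \<beta> +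
  1\<close>. The bounds on \<open>\<beta>'\<close> say that it only refines \<open>\<beta>\<close>, and that all blocks other than \<open>B\<close> are kept.
\<close>

lemma sw_reduce:
  assumes fin: "finite I" and ne: "I \<noteq> {}" and mono: "mono_on I \<alpha>" "mono_on I \<beta>"
    and A: "A = {i \<in> I. \<forall>j\<in>I. \<alpha> i \<le> \<alpha> j}" and B: "B = {i \<in> I. \<forall>j\<in>I. \<beta> i \<le> \<beta> j}" and AB: "A \<subset> B"
    and inf: "infinite (UNIV :: 'a::field set)"
  shows "\<exists>J \<beta>'. J \<subset> I \<and> I - A \<subseteq> J \<and> mono_on J \<beta>' \<and>
    (\<forall>i\<in>J. 2 * \<beta> i \<le> \<beta>' i \<and> \<beta>' i \<le> 2 * \<beta> i + 1 \<and> (i \<notin> B \<longrightarrow> \<beta>' i = 2 * \<beta> i + 1)) \<and>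
    (\<forall>(\<rho> :: 'a mt \<Rightarrow> 'a mt \<Rightarrow> 'a mt) L S. local_action \<rho> L S \<longrightarrow> L \<inter> A = {} \<longrightarrow>
       equivariant I (sw I \<alpha> \<beta>) \<rho> S \<longrightarrow>
       frob I (sw I \<alpha> \<beta>) \<rho> S = frob J (sw J \<alpha> \<beta>') \<rho> S)"
proof -
  define W where "W = B - A"
  define r where "r = min (card A) (card W)"
  have sub: "A \<subseteq> I" "B \<subseteq> I" "W \<subseteq> I" using A B by (auto simp: W_def)
  have finA: "finite A" "finite W"
    using finite_subset[OF sub(1) fin] finite_subset[OF sub(3) fin] by auto
  have Ane: "A \<noteq> {}"
  proof -
    obtain i where "i \<in> I" "\<forall>j\<in>I. \<alpha> i \<le> \<alpha> j" using finite_has_minimal[of "\<alpha> ` I"] fin ne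
      by (metis (no_types, lifting) finite_imageI image_iff image_is_empty linorder_le_cases)
    then show ?thesis using A by blast
  qed
  have Wne: "W \<noteq> {}" using AB by (auto simp: W_def)
  have "0 < card A" "0 < card W" using Ane Wne finA by (auto simp: card_gt_0_iff)
  then have r: "r \<le> card A" "r \<le> card W" "0 < r" by (auto simp: r_def)
  obtain A2 where A2: "A2 \<subseteq> A" "card A2 = r" using obtain_subset_with_card_n[OF r(1)] by blast
  obtain W2 where W2: "W2 \<subseteq> W" "card W2 = r" "\<And>x y. x \<in> W - W2 \<Longrightarrow> y \<in> W2 \<Longrightarrow> x < y"
    using upper_subset_exists[OF finA(2) r(2)] by blast
  have fin2: "finite A2" "finite W2" using A2 W2 finA finite_subset by auto
  obtain \<sigma> where \<sigma>: "bij_betw \<sigma> A2 W2" using finite_same_card_bij[OF fin2] A2 W2 by auto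
  have dich0: "A2 = A \<or> W2 = W"
    using card_subset_eq[OF finA(1) A2(1)] card_subset_eq[OF finA(2) W2(1)] A2 W2
    unfolding r_def min_def by metis
  define J where "J = I - A2"
  define \<beta>' where "\<beta>' i = 2 * \<beta> i + (if i \<in> W - W2 then 0 else 1)" for i
  have WB: "\<beta> i = \<beta> j" if "i \<in> B" "j \<in> B" for i j using that B by (auto intro: le_antisym)
  have dich: "(A2 = A \<and> (W - W2) \<times> W2 \<subseteq> sw I \<alpha> \<beta>) \<or> W2 = W"
  proof -
    have "(W - W2) \<times> W2 \<subseteq> sw I \<alpha> \<beta>"
    proof clarify
      fix i j assume ij: "i \<in> W" "i \<notin> W2" "j \<in> W2"
      then have "i < j" "j \<in> W" using W2 by auto
      moreover have "\<alpha> i \<le> \<alpha> j" using mono_onD[OF mono(1), of i j] calculation ij sub by auto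
      ultimately show "(i, j) \<in> sw I \<alpha> \<beta>" using WB[of i j] ij sub by (auto simp: sw_def W_def)
    qed
    with dich0 show ?thesis by blast
  qed
  have "A2 \<noteq> {}" using A2 r by auto
  then have "J \<subset> I" using A2 sub by (auto simp: J_def)
  moreover have "I - A \<subseteq> J" using A2 by (auto simp: J_def)
  moreover have "mono_on J \<beta>'"
  proof (rule mono_onI)
    fix i j assume ij: "i \<in> J" "j \<in> J" "i \<le> j"
    then have le: "\<beta> i \<le> \<beta> j" using mono_onD[OF mono(2), of i j] by (auto simp: J_def)
    show "\<beta>' i \<le> \<beta>' j"
    proof (cases "j \<in> W - W2 \<and> \<beta> i = \<beta> j")
      case True
      then have iB: "i \<in> B" using ij B W_def J_def by auto
      have "A2 = A" using True dich0 by blast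
      then have "i \<in> W" using iB ij by (auto simp: W_def J_def)
      moreover have "i \<notin> W2" using W2(3)[of j i] True ij by auto
      ultimately show ?thesis using True by (simp add: \<beta>'_def)
    next
      case False
      with le show ?thesis by (auto simp: \<beta>'_def)
    qed
  qed
  moreover have "\<forall>i\<in>J. 2 * \<beta> i \<le> \<beta>' i \<and> \<beta>' i \<le> 2 * \<beta> i + 1 \<and> (i \<notin> B \<longrightarrow> \<beta>' i = 2 * \<beta> i + 1)"
    by (auto simp: \<beta>'_def W_def)
  moreover have "frob I (sw I \<alpha> \<beta>) \<rho> S = frob J (sw J \<alpha> \<beta>') \<rho> S"
    if la: "local_action \<rho> L S" and LA: "L \<inter> A = {}"
      and eq: "equivariant I (sw I \<alpha> \<beta>) \<rho> S"
    for \<rho> :: "'a mt \<Rightarrow> 'a mt \<Rightarrow> 'a mt" and L S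
  proof -
    interpret la: local_action \<rho> L S by fact
    interpret br: block_reduction \<rho> L S I "sw I \<alpha> \<beta>" A W A2 W2 \<sigma>
    proof
      show "j \<in> A \<union> W" if "(i, j) \<in> sw I \<alpha> \<beta>" "i \<in> A" for i j
      proof -
        have "i \<in> B" "\<beta> j \<le> \<beta> i" "j \<in> I" using that AB by (auto simp: sw_def)
        then have "j \<in> B" using B by (auto intro: order_trans)
        then show ?thesis by (auto simp: W_def)
      qed
      show "i \<in> A" if "(i, j) \<in> sw I \<alpha> \<beta>" "j \<in> A" for i j
        using that A by (auto simp: sw_def intro: order_trans)
      show "A \<times> A \<subseteq> sw I \<alpha> \<beta>" using AB A B by (auto simp: sw_def)
      show "A \<times> W \<subseteq> sw I \<alpha> \<beta>" using AB A B by (auto simp: sw_def W_def)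
    qed (use fin sub A2 W2 \<sigma> LA Ane dich in \<open>auto simp: sw_def W_def intro: trans_sw[unfolded sw_def]\<close>)
    have "br.I' = J" by (simp add: br.I'_def J_def)
    moreover have "br.R' = sw J \<alpha> \<beta>'"
    proof -
      have cond: "\<beta>' j \<le> \<beta>' i \<longleftrightarrow> \<beta> j \<le> \<beta> i \<and> \<not> (i \<in> W - W2 \<and> j \<in> W2)" if ij: "i \<in> J" "j \<in> J" for i j
      proof (cases "\<beta> i = \<beta> j \<and> i \<in> W - W2")
        case True
        then have "j \<in> B" using ij B by (auto simp: W_def J_def)
        moreover have "A2 = A" using True dich0 by blast
        ultimately have "j \<in> W" using ij by (auto simp: W_def J_def)
        with True show ?thesis by (auto simp: \<beta>'_def)
      next
        case F: False
        show ?thesis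
        proof (cases "i \<in> W - W2 \<and> j \<in> W2")
          case True
          then have "\<beta> i = \<beta> j" using WB[of i j] W2 by (auto simp: W_def)
          with F True show ?thesis by blast
        next
          case False
          with F show ?thesis by (auto simp: \<beta>'_def)
        qed
      qed
      have "(i, j) \<in> br.R' \<longleftrightarrow> (i, j) \<in> sw J \<alpha> \<beta>'" for i j
      proof (cases "i \<in> J \<and> j \<in> J")
        case True
        with cond[of i j] show ?thesis unfolding br.R'_def by (auto simp: sw_def J_def)
      next
        case False
        then show ?thesis unfolding br.R'_def by (auto simp: sw_def J_def)
      qed
      then show ?thesis by (intro equalityI subrelI) simp_all
    qed
    ultimately show ?thesis using br.frob_reduction_iff[OF eq inf] by auto
  qed
  ultimately show ?thesis by blast
qed

section \<open>The base case\<close>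

text \<open>
  The Gram matrix \<open>M\<close> in the basis \<open>e\<close> satisfies \<open>M\<^sup>T = - M\<close>, so its determinant vanishes.
\<close>

lemma odd_degenerate:
  fixes sc :: "'a::field \<Rightarrow> 'v::ab_group_add \<Rightarrow> 'v" and n :: nat
  assumes vs: "vector_space sc" and B: "bilin sc B" and two: "(2::'a) \<noteq> 0"
    and skew: "\<And>i j. i < n \<Longrightarrow> j < n \<Longrightarrow> B (e j) (e i) = - B (e i) (e j)"
    and eQ: "\<And>i. i < n \<Longrightarrow> e i \<in> Q" and QS: "module.subspace sc Q"
    and span: "\<And>x. x \<in> Q \<Longrightarrow> \<exists>c. x = (\<Sum>i<n. sc (c i) (e i))"
    and ind: "\<And>c i. (\<Sum>i<n. sc (c i) (e i)) = 0 \<Longrightarrow> i < n \<Longrightarrow> c i = 0"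
    and n: "odd n"
  shows "\<not> nondeg B Q"
proof
  interpret vector_space sc by fact
  assume nd: "nondeg B Q"
  define M where "M = mat n n (\<lambda>(i, j). B (e i) (e j))"
  have M: "M \<in> carrier_mat n n" by (simp add: M_def)
  have "transpose_mat M = (- 1) \<cdot>\<^sub>m M"
  proof (rule eq_matI)
    fix i j assume "i < dim_row ((- 1) \<cdot>\<^sub>m M)" "j < dim_col ((- 1) \<cdot>\<^sub>m M)"
    then have ij: "i < n" "j < n" by (simp_all add: M_def)
    then show "transpose_mat M $$ (i, j) = ((- 1) \<cdot>\<^sub>m M) $$ (i, j)"
      using skew[OF ij] by (simp add: M_def)
  qed (simp_all add: M_def)
  then have "det M = (- 1) ^ n * det M"
    using det_transpose[OF M] det_smult[of "- 1" M] M by simp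
  with n have "2 * det M = 0" by (simp add: eq_neg_iff_add_eq_0)
  with two have "det M = 0" by simp
  then obtain v where v: "v \<in> carrier_vec n" "v \<noteq> 0\<^sub>v n" "M *\<^sub>v v = 0\<^sub>v n"
    using det_0_iff_vec_prod_zero_field[OF M] by auto
  let ?x = "\<Sum>i<n. sc (v $ i) (e i)"
  have xQ: "?x \<in> Q" using eQ by (intro subspace_sum[OF QS] subspace_scale[OF QS]) auto
  have col: "B ?x (e i) = 0" if i: "i < n" for i
  proof -
    have "0 = (M *\<^sub>v v) $ i" using v i by simp
    also have "\<dots> = (\<Sum>j<n. B (e i) (e j) * v $ j)"
      using i v(1) by (simp add: M_def scalar_prod_def atLeast0LessThan)
    also have "\<dots> = - (\<Sum>j<n. v $ j * B (e j) (e i))"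
      unfolding sum_negf[symmetric]
    proof (rule sum.cong[OF refl])
      fix j assume "j \<in> {..<n}"
      then have "B (e i) (e j) = - B (e j) (e i)" using skew[of j i] i by simp
      then show "B (e i) (e j) * v $ j = - (v $ j * B (e j) (e i))" by simp
    qed
    also have "\<dots> = - B ?x (e i)" by (simp add: functional_comb[OF bilin_left[OF B]])
    finally show ?thesis by simp
  qed
  have "B ?x y = 0" if "y \<in> Q" for y
  proof -
    obtain c where c: "y = (\<Sum>i<n. sc (c i) (e i))" using span[OF \<open>y \<in> Q\<close>] by blast
    show ?thesis unfolding c functional_comb[OF bilin_right[OF B]] using col by simp
  qed
  with nd xQ have "?x = 0" unfolding nondeg_def by blast
  then have "v $ i = 0" if "i < n" for i using ind[of "\<lambda>i. v $ i" i] that by simp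
  with v show False by auto
qed

context
  fixes p q :: nat
  assumes pq: "p < q"
begin

definition pair_basis :: "'a::field \<Rightarrow> nat \<Rightarrow> 'a mt \<times> 'a mt" where
  "pair_basis \<epsilon> i = ([(unit_mt p p, 0), (unit_mt p q, 0), (unit_mt q p, 0), (unit_mt q q, 0),
     (0, unit_mt p q + mscale \<epsilon> (unit_mt q p)), (0, unit_mt p p), (0, unit_mt q q)] ! i)"

text \<open>
  The dimension is \<open>4 + 3\<close> for symmetric and \<open>4 + 1\<close> for alternating forms, odd in both cases.
\<close>

lemma full_block_not_frob:
  assumes char: "(2::'a::field) \<noteq> 0" and \<epsilon>: "\<epsilon> = 1 \<or> \<epsilon> = (- 1 :: 'a)"
  shows "\<not> frob {p, q} ({p, q} \<times> {p, q}) (form_act {p, q}) (forms {p, q} \<epsilon>)"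
proof
  let ?L = "{p, q}"
  let ?S = "forms ?L \<epsilon>"
  let ?Q = "supp (?L \<times> ?L) \<times> ?S"
  let ?e = "pair_basis \<epsilon>"
  define n :: nat where "n = (if \<epsilon> = 1 then 7 else 5)"
  interpret local_action "form_act ?L" ?L ?S by (rule local_action_forms) simp
  assume "frob ?L (?L \<times> ?L) (form_act ?L) ?S"
  then obtain \<gamma> where lin: "linear_form pscale \<gamma>" and nd: "nondeg (\<lambda>x y. \<gamma> (sbr ?L (form_act ?L) x y)) ?Q"
    by (auto simp: frob_def)
  have nq: "p \<noteq> q" "q \<noteq> p" using pq by auto
  have cases_e: "P 0 \<and> P 1 \<and> P 2 \<and> P 3 \<and> P 4 \<and> (\<epsilon> = 1 \<longrightarrow> P 5 \<and> P 6) \<Longrightarrow> i < n \<Longrightarrow> P i" for P and i :: nat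
  proof -
    assume P: "P 0 \<and> P 1 \<and> P 2 \<and> P 3 \<and> P 4 \<and> (\<epsilon> = 1 \<longrightarrow> P 5 \<and> P 6)" and i: "i < n"
    have "i = 0 \<or> i = 1 \<or> i = 2 \<or> i = 3 \<or> i = 4 \<or> (\<epsilon> = 1 \<and> (i = 5 \<or> i = 6))"
      using i by (auto simp: n_def split: if_splits)
    with P show "P i" by blast
  qed
  have sum_n: "(\<Sum>i<n. f i) = f 0 + f 1 + f 2 + f 3 + f 4 + (if \<epsilon> = 1 then f 5 + f 6 else 0)"
    for f :: "nat \<Rightarrow> 'a mt \<times> 'a mt"
    by (simp add: n_def eval_nat_numeral add.assoc)
  have "\<not> nondeg (\<lambda>x y. \<gamma> (sbr ?L (form_act ?L) x y)) ?Q"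
  proof (rule odd_degenerate[OF vector_space_pscale bilin_sbr[OF lin] char, where e = ?e and n = n])
    show "\<gamma> (sbr ?L (form_act ?L) (?e j) (?e i)) = - \<gamma> (sbr ?L (form_act ?L) (?e i) (?e j))" for i j
      by (subst sbr_skew) (rule P.functional_minus[OF lin])
    show "?e i \<in> ?Q" if "i < n" for i
      by (rule cases_e[OF _ that])
        (use \<epsilon> nq in \<open>auto simp: pair_basis_def forms_def supp_def unit_mt_def tp_def fun_eq_iff\<close>)
    show "P.subspace ?Q" by (rule subspace_prod)
    show "odd n" by (simp add: n_def)
    show "\<exists>c. x = (\<Sum>i<n. pscale (c i) (?e i))" if x: "x \<in> ?Q" for x
    proof -
      define y s where "y = fst x" and "s = snd x"
      have y: "y \<in> supp (?L \<times> ?L)" and s: "s \<in> supp (?L \<times> ?L)" "tp s = mscale \<epsilon> s"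
        using x by (auto simp: y_def s_def mem_Times_iff forms_def)
      have sy: "s b a = \<epsilon> * s a b" for a b
        using fun_cong[OF fun_cong[OF s(2), of a], of b] by (simp add: tp_def)
      have diag: "s i i = 0" if "\<epsilon> \<noteq> 1" for i
      proof -
        have "s i i = - s i i" using sy[of i i] \<epsilon> that by simp
        then have "2 * s i i = 0" by (simp add: eq_neg_iff_add_eq_0)
        with char show ?thesis by simp
      qed
      define c where "c i = ([y p p, y p q, y q p, y q q, s p q, s p p, s q q] ! i)" for i :: nat
      have "y = fst (\<Sum>i<n. pscale (c i) (?e i))"
      proof (rule mt_eqI)
        fix i j
        show "y i j = fst (\<Sum>i<n. pscale (c i) (?e i)) i j"
          unfolding sum_n using nq supp_zero[OF y, of i j]
          by (auto simp: c_def pair_basis_def unit_mt_def)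
      qed
      moreover have "s = snd (\<Sum>i<n. pscale (c i) (?e i))"
      proof (rule mt_eqI)
        fix i j
        show "s i j = snd (\<Sum>i<n. pscale (c i) (?e i)) i j"
          unfolding sum_n using nq supp_zero[OF s(1), of i j] trans[OF sy[of q p] mult.commute] diag
          by (auto simp: c_def pair_basis_def unit_mt_def)
      qed
      ultimately show ?thesis by (intro exI[of _ c]) (simp add: y_def s_def prod_eq_iff)
    qed
    show "c i = 0" if c: "(\<Sum>i<n. pscale (c i) (?e i)) = 0" and i: "i < n" for c i
    proof (rule cases_e[OF _ i])
      have y: "fst (\<Sum>i<n. pscale (c i) (?e i)) k l = 0" and s: "snd (\<Sum>i<n. pscale (c i) (?e i)) k l = 0" for k l
        unfolding c by simp_all
      show "c 0 = 0 \<and> c 1 = 0 \<and> c 2 = 0 \<and> c 3 = 0 \<and> c 4 = 0 \<and> (\<epsilon> = 1 \<longrightarrow> c 5 = 0 \<and> c 6 = 0)"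
      proof (cases "\<epsilon> = 1")
        case True
        then show ?thesis
          using y[of p p] y[of p q] y[of q p] y[of q q] s[of p q] s[of p p] s[of q q] nq
          unfolding sum_n by (simp add: pair_basis_def unit_mt_def)
      next
        case False
        then show ?thesis
          using y[of p p] y[of p q] y[of q p] y[of q q] s[of p q] nq
          unfolding sum_n by (simp add: pair_basis_def unit_mt_def)
      qed
    qed
  qed
  with nd show False by blast
qed

text \<open>
  Explicit functionals: the trace of the form for symmetric forms, and the sum of the off-diagonal
  matrix entry and the form's only coordinate for alternating ones.
\<close>

lemma borel_frob:
  assumes char: "(2::'a::field) \<noteq> 0" and \<epsilon>: "\<epsilon> = 1 \<or> \<epsilon> = (- 1 :: 'a)"
  shows "frob {p, q} {(p, p), (q, q), (q, p)} (form_act {p, q}) (forms {p, q} \<epsilon>)"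
proof -
  let ?L = "{p, q}"
  let ?R = "{(p, p), (q, q), (q, p)}"
  let ?S = "forms ?L \<epsilon>"
  have nq: "p \<noteq> q" "q \<noteq> p" using pq by auto
  define \<gamma> :: "'a mt \<times> 'a mt \<Rightarrow> 'a" where
    "\<gamma> x = (if \<epsilon> = 1 then snd x p p + snd x q q else fst x q p + snd x p q)" for x
  have "linear_form pscale \<gamma>"
    by (auto simp: linear_form_def \<gamma>_def pscale_def algebra_simps)
  moreover have "nondeg (\<lambda>x y. \<gamma> (sbr ?L (form_act ?L) x y)) (supp ?R \<times> ?S)"
    unfolding nondeg_def
  proof (intro ballI impI)
    fix x assume x: "x \<in> supp ?R \<times> ?S" and rad: "\<forall>y\<in>supp ?R \<times> ?S. \<gamma> (sbr ?L (form_act ?L) x y) = 0"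
    define y s where "y = fst x" and "s = snd x"
    have y: "y \<in> supp ?R" and s: "s \<in> supp (?L \<times> ?L)" "tp s = mscale \<epsilon> s"
      using x by (auto simp: y_def s_def mem_Times_iff forms_def)
    have ypq: "y p q = 0" using supp_zero[OF y, of p q] nq by auto
    have sy: "s b a = \<epsilon> * s a b" for a b
      using fun_cong[OF fun_cong[OF s(2), of a], of b] by (simp add: tp_def)
    have S0: "0 \<in> ?S" by (auto simp: forms_def supp_def tp_def fun_eq_iff)
    have r1: "\<gamma> (sbr ?L (form_act ?L) (y, s) (unit_mt a b, 0)) = 0" if "(a, b) \<in> ?R" for a b
    proof -
      have "(unit_mt a b, 0) \<in> supp ?R \<times> ?S" using unit_mt_supp[OF that] S0 by simp
      with rad have "\<gamma> (sbr ?L (form_act ?L) x (unit_mt a b, 0)) = 0" by (rule bspec)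
      then show ?thesis by (simp add: y_def s_def)
    qed
    have r2: "\<gamma> (sbr ?L (form_act ?L) (y, s) (0, t)) = 0" if "t \<in> ?S" for t
    proof -
      have "(0, t) \<in> supp ?R \<times> ?S" using that by (auto simp: supp_def)
      with rad have "\<gamma> (sbr ?L (form_act ?L) x (0, t)) = 0" by (rule bspec)
      then show ?thesis by (simp add: y_def s_def)
    qed
    have fa: "form_act ?L z t i j = t i p * z p j + t i q * z q j + (z p i * t p j + z q i * t q j)"
      if "i \<in> ?L" "j \<in> ?L" for z t :: "'a mt" and i j
      using that nq by (simp add: form_act_def mmul_apply restr_def tp_def)
    have cm: "comm ?L y z i j = y i p * z p j + y i q * z q j - (z i p * y p j + z i q * y q j)" for z :: "'a mt" and i j
      using nq by (simp add: comm_def mmul_apply)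
    note defs = \<gamma>_def sbr_def fa cm unit_mt_apply
    have "y p p = 0 \<and> y q q = 0 \<and> y q p = 0 \<and> s p p = 0 \<and> s q q = 0 \<and> s p q = 0"
    proof (cases "\<epsilon> = 1")
      case True
      have e: "\<epsilon> = 1" by fact
      have dbl: "t = 0" if "t + t = 0" for t :: 'a
      proof -
        have "2 * t = 0" using that by (simp only: mult_2)
        with char show ?thesis by simp
      qed
      have u: "unit_mt a a \<in> ?S" if "a \<in> ?L" for a
        using that by (auto simp: e forms_def supp_def unit_mt_def tp_def fun_eq_iff)
      have u': "unit_mt p q + unit_mt q p \<in> ?S"
        using nq by (auto simp: e forms_def supp_def unit_mt_def tp_def fun_eq_iff)
      have "y p p = 0" by (rule dbl) (use r2[OF u[of p]] nq ypq in \<open>simp add: e defs\<close>)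
      moreover have "y q q = 0" by (rule dbl) (use r2[OF u[of q]] nq ypq in \<open>simp add: e defs\<close>)
      moreover have "y q p = 0" by (rule dbl) (use r2[OF u'] nq ypq in \<open>simp add: e defs\<close>)
      moreover have "s p p = 0" by (rule dbl) (use r1[of p p] nq in \<open>simp add: e defs\<close>)
      moreover have "s q q = 0" by (rule dbl) (use r1[of q q] nq in \<open>simp add: e defs\<close>)
      moreover have "s p q = 0" by (rule dbl) (use r1[of q p] nq sy[of q p] in \<open>simp add: e defs\<close>)
      ultimately show ?thesis by blast
    next
      case False
      then have e: "\<epsilon> = - 1" using \<epsilon> by blast
      have ne: "(- 1 :: 'a) \<noteq> 1" using False e by simp
      have dg: "s i i = 0" for i
      proof -
        have "s i i = - s i i" using sy[of i i] e by simp
        then have "2 * s i i = 0" by (simp add: eq_neg_iff_add_eq_0)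
        with char show ?thesis by simp
      qed
      have u: "unit_mt p q - unit_mt q p \<in> ?S"
        using nq by (auto simp: e forms_def supp_def unit_mt_def tp_def fun_eq_iff)
      have a: "- y q q = y p p" using r2[OF u] ne nq ypq by (simp add: e defs)
      have b: "y q q = y p p" using r1[of q p] ne nq ypq dg by (simp add: e defs)
      have c: "s p q = - y q p" using r1[of p p] ne nq ypq dg by (simp add: e defs eq_neg_iff_add_eq_0 add.commute)
      have d: "s p q = y q p" using r1[of q q] ne nq ypq dg by (simp add: e defs)
      have half: "t = 0" if "t = - t" for t :: 'a
      proof -
        have "2 * t = 0" using that by (simp add: eq_neg_iff_add_eq_0)
        with char show ?thesis by simp
      qed
      have "y p p = 0" by (rule half) (use a b in simp)
      moreover have "y q p = 0" by (rule half[OF trans[OF d[symmetric] c]])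
      ultimately have "y p p = 0" "y q q = 0" "y q p = 0" "s p q = 0" using b d by simp_all
      with dg show ?thesis by blast
    qed
    then have z: "y p p = 0" "y q q = 0" "y q p = 0" "s p p = 0" "s q q = 0" "s p q = 0" by blast+
    have z': "s q p = 0" using sy[of q p] z by simp
    have "y = 0" using z suppD[OF y] by (intro mt_eqI) fastforce
    moreover have "s = 0" using z z' suppD[OF s(1)] by (intro mt_eqI) fastforce
    ultimately show "x = 0" by (simp add: y_def s_def prod_eq_iff)
  qed
  ultimately show ?thesis by (auto simp: frob_def)
qed

end

section \<open>Symmetric and alternating forms\<close>

text \<open>
  Induction on the number of indices, applying \<open>sw_reduce\<close> to the first blocks \<open>A\<close> and \<open>B\<close> until the
  last block \<open>L\<close> of \<open>\<alpha>\<close> is all that is left. The reduction does not look at the module, so it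
  applies to both kinds of forms with the same smaller seaweed, and \<open>L\<close> remains the last block.
\<close>

theorem frob_sym_iff_alt:
  fixes \<alpha> \<beta> :: "nat \<Rightarrow> nat"
  assumes char: "infinite (UNIV :: 'a::field set)" "(2::'a) \<noteq> 0"
    and "finite I" "mono_on I \<alpha>" "mono_on I \<beta>" "L = {i \<in> I. \<forall>j\<in>I. \<alpha> j \<le> \<alpha> i}" "card L = 2"
  shows "frob I (sw I \<alpha> \<beta>) (form_act L) (forms L (1::'a)) \<longleftrightarrow>
    frob I (sw I \<alpha> \<beta>) (form_act L) (forms L (- 1 :: 'a))"
  using assms(3-)
proof (induction "card I" arbitrary: I \<alpha> \<beta> rule: less_induct)
  case less
  note fin = less.prems(1) and m\<alpha> = less.prems(2) and m\<beta> = less.prems(3) and L = less.prems(4) and cL = less.prems(5)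
  define A where "A = {i \<in> I. \<forall>j\<in>I. \<alpha> i \<le> \<alpha> j}"
  define B where "B = {i \<in> I. \<forall>j\<in>I. \<beta> i \<le> \<beta> j}"
  have LI: "L \<subseteq> I" using L by blast
  have finL: "finite L" using finite_subset[OF LI fin] .
  have ne: "I \<noteq> {}" using LI cL by auto
  let ?R = "sw I \<alpha> \<beta>"
  have la: "local_action (form_act L) L (forms L \<epsilon>)" for \<epsilon> :: 'a by (rule local_action_forms[OF finL])
  have eq: "equivariant I ?R (form_act L) (forms L \<epsilon>)" for \<epsilon> :: 'a
  proof (rule equivariant_forms[OF fin LI _ trans_sw])
    show "j \<in> L" if "(i, j) \<in> ?R" "i \<in> L" for i j
      using that L by (auto simp: sw_def intro: order_trans)
  qed (auto simp: sw_def)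
  show ?case
  proof (cases "A \<inter> L = {}")
    case False
    then obtain i0 where i0: "i0 \<in> A" "i0 \<in> L" by blast
    \<comment> \<open>An index in both the first and the last block of \<open>\<alpha>\<close>: there is only one block, and it is \<open>L\<close>.\<close>
    then have const: "\<alpha> i = \<alpha> i0" if "i \<in> I" for i using that L A_def by (auto intro: le_antisym)
    then have IL: "I = L" using L by force
    obtain p q where pq: "L = {p, q}" "p < q"
      using cL unfolding card_2_iff by (metis insert_commute linorder_neqE_nat)
    have \<beta>pq: "\<beta> p \<le> \<beta> q" using mono_onD[OF m\<beta>, of p q] pq IL by auto
    have co: "\<alpha> p = \<alpha> q" using const[of p] const[of q] IL pq by auto
    show ?thesis
    proof (cases "\<beta> p = \<beta> q")
      case True
      then have "?R = {p, q} \<times> {p, q}" using IL pq co by (auto simp: sw_def)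
      then show ?thesis
        using full_block_not_frob[OF pq(2) char(2)] IL pq(1) by auto
    next
      case False
      then have "?R = {(p, p), (q, q), (q, p)}" using IL pq co \<beta>pq by (auto simp: sw_def)
      then show ?thesis using borel_frob[OF pq(2) char(2)] IL pq(1) by auto
    qed
  next
    case disj: True
    have comparable: "A \<subseteq> B \<or> B \<subseteq> A"
    proof (rule ccontr)
      assume "\<not> ?thesis"
      then obtain a b where ab: "a \<in> A" "a \<notin> B" "b \<in> B" "b \<notin> A" by blast
      then have I: "a \<in> I" "b \<in> I" by (auto simp: A_def B_def)
      show False
      proof (cases "a \<le> b")
        case True
        then have "\<beta> a \<le> \<beta> b" using mono_onD[OF m\<beta> I] by blast
        then have "a \<in> B" using ab I by (auto simp: B_def intro: order_trans)
        with ab show False by blast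
      next
        case False
        then have "\<alpha> b \<le> \<alpha> a" using mono_onD[OF m\<alpha> I(2,1)] by simp
        then have "b \<in> A" using ab I by (auto simp: A_def intro: order_trans)
        with ab show False by blast
      qed
    qed
    consider "A = B" | "A \<subset> B" | "B \<subset> A" using comparable by blast
    then show ?thesis
    proof cases
      case 1
      have "A \<noteq> {}"
      proof -
        have "Min (\<alpha> ` I) \<in> \<alpha> ` I" using fin ne by simp
        then obtain i where "i \<in> I" "\<alpha> i = Min (\<alpha> ` I)" by auto
        then have "i \<in> A" using fin by (auto simp: A_def)
        then show ?thesis by blast
      qed
      moreover have "i \<in> A \<longleftrightarrow> j \<in> A" if "(i, j) \<in> ?R" for i j
      proof
        assume "i \<in> A"
        then have "i \<in> B" using 1 by simp
        then have "j \<in> B" using that by (auto simp: sw_def B_def intro: order_trans)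
        then show "j \<in> A" using 1 by simp
      next
        assume "j \<in> A"
        then show "i \<in> A" using that by (auto simp: sw_def A_def intro: order_trans)
      qed
      ultimately have "\<not> frob I ?R (form_act L) (forms L \<epsilon>)" for \<epsilon> :: 'a
        using disj by (intro central_not_frob[OF la fin, of A]) (auto simp: A_def sw_def)
      then show ?thesis by simp
    next
      case 2
      obtain J \<beta>' where J: "J \<subset> I" "I - A \<subseteq> J" "mono_on J \<beta>'"
        and red: "\<And>(\<rho> :: 'a mt \<Rightarrow> 'a mt \<Rightarrow> 'a mt) L S. local_action \<rho> L S \<Longrightarrow> L \<inter> A = {} \<Longrightarrow>
         equivariant I ?R \<rho> S \<Longrightarrow> frob I ?R \<rho> S = frob J (sw J \<alpha> \<beta>') \<rho> S"
        using sw_reduce[OF fin ne m\<alpha> m\<beta> A_def B_def 2 char(1)] by metis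
      have LJ: "L \<subseteq> J" using J(2) LI disj by blast
      have "frob J (sw J \<alpha> \<beta>') (form_act L) (forms L (1::'a)) = frob J (sw J \<alpha> \<beta>') (form_act L) (forms L (- 1 :: 'a))"
      proof (rule less.hyps)
        show "card J < card I" using J(1) fin by (rule psubset_card_mono[rotated])
        show "finite J" using J(1) fin finite_subset by blast
        show "mono_on J \<alpha>" using m\<alpha> J(1) by (meson mono_on_subset psubset_imp_subset)
        show "L = {i \<in> J. \<forall>j\<in>J. \<alpha> j \<le> \<alpha> i}"
        proof (intro equalityI subsetI)
          fix i assume "i \<in> L"
          then show "i \<in> {i \<in> J. \<forall>j\<in>J. \<alpha> j \<le> \<alpha> i}" using LJ J(1) L by auto
        next
          fix i assume i: "i \<in> {i \<in> J. \<forall>j\<in>J. \<alpha> j \<le> \<alpha> i}"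
          obtain l where l: "l \<in> L" using cL by fastforce
          then have "\<alpha> l \<le> \<alpha> i" using i LJ by auto
          then show "i \<in> L" using l i J(1) L by (auto intro: order_trans)
        qed
      qed (use J cL in auto)
      then show ?thesis using red[OF la _ eq] disj by blast
    next
      case 3
      \<comment> \<open>The reduction with the two numberings exchanged, applied to the transposed algebra. It refines \<open>\<alpha>\<close>, but only in
        the first block, so the last block is still \<open>L\<close>.\<close>
      obtain J \<alpha>' where J: "J \<subset> I" "I - B \<subseteq> J" "mono_on J \<alpha>'"
        and \<alpha>': "\<forall>i\<in>J. 2 * \<alpha> i \<le> \<alpha>' i \<and> \<alpha>' i \<le> 2 * \<alpha> i + 1 \<and> (i \<notin> A \<longrightarrow> \<alpha>' i = 2 * \<alpha> i + 1)"
        and red: "\<And>(\<rho> :: 'a mt \<Rightarrow> 'a mt \<Rightarrow> 'a mt) L S. local_action \<rho> L S \<Longrightarrow> L \<inter> B = {} \<Longrightarrow>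
         equivariant I (sw I \<beta> \<alpha>) \<rho> S \<Longrightarrow>
           frob I (sw I \<beta> \<alpha>) \<rho> S = frob J (sw J \<beta> \<alpha>') \<rho> S"
        using sw_reduce[OF fin ne m\<beta> m\<alpha> B_def A_def 3 char(1)] by metis
      have LJ: "L \<subseteq> J" using J(2) LI disj 3 by blast
      have IH: "frob J (sw J \<alpha>' \<beta>) (form_act L) (forms L (1::'a)) = frob J (sw J \<alpha>' \<beta>) (form_act L) (forms L (- 1 :: 'a))"
      proof (rule less.hyps)
        show "card J < card I" using J(1) fin by (rule psubset_card_mono[rotated])
        show "finite J" using J(1) fin finite_subset by blast
        show "mono_on J \<beta>" using m\<beta> J(1) by (meson mono_on_subset psubset_imp_subset)
        show "L = {i \<in> J. \<forall>j\<in>J. \<alpha>' j \<le> \<alpha>' i}"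
        proof (intro equalityI subsetI)
          fix i assume i: "i \<in> L"
          then have "\<alpha>' i = 2 * \<alpha> i + 1" using \<alpha>' LJ disj by blast
          moreover have "\<alpha>' j \<le> 2 * \<alpha> i + 1" if "j \<in> J" for j
          proof -
            have "\<alpha> j \<le> \<alpha> i" using i that J(1) L by auto
            moreover have "\<alpha>' j \<le> 2 * \<alpha> j + 1" using \<alpha>' that by blast
            ultimately show ?thesis by linarith
          qed
          ultimately show "i \<in> {i \<in> J. \<forall>j\<in>J. \<alpha>' j \<le> \<alpha>' i}" using i LJ by auto
        next
          fix i assume i: "i \<in> {i \<in> J. \<forall>j\<in>J. \<alpha>' j \<le> \<alpha>' i}"
          obtain l where l: "l \<in> L" using cL by fastforce
          then have "\<alpha>' l \<le> \<alpha>' i" using i LJ by auto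
          moreover have "\<alpha>' l = 2 * \<alpha> l + 1" using \<alpha>' LJ disj l by blast
          moreover have "\<alpha>' i \<le> 2 * \<alpha> i + 1" using \<alpha>' i by blast
          ultimately have "\<alpha> l \<le> \<alpha> i" by linarith
          then show "i \<in> L" using l i J(1) L by (auto intro: order_trans)
        qed
      qed (use J cL in auto)
      have "frob I ?R (form_act L) (forms L \<epsilon>) = frob J (sw J \<alpha>' \<beta>) (form_act L) (forms L \<epsilon>)" for \<epsilon> :: 'a
      proof -
        have "equivariant I (sw I \<beta> \<alpha>) (contra (form_act L)) (forms L \<epsilon>)"
          using equivariant_transpose[OF eq, of \<epsilon>] by (simp add: sw_converse)
        moreover have "L \<inter> B = {}" using disj 3 by blast
        ultimately have "frob I (sw I \<beta> \<alpha>) (contra (form_act L)) (forms L \<epsilon>)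
          = frob J (sw J \<beta> \<alpha>') (contra (form_act L)) (forms L \<epsilon>)"
          by (intro red[OF local_action_contra[OF la]])
        moreover have "frob I ?R (form_act L) (forms L \<epsilon>) = frob I (sw I \<beta> \<alpha>) (contra (form_act L)) (forms L \<epsilon>)"
          using frob_transpose[of I ?R] by (simp add: sw_converse)
        moreover have "frob J (sw J \<alpha>' \<beta>) (form_act L) (forms L \<epsilon>) = frob J (sw J \<beta> \<alpha>') (contra (form_act L)) (forms L \<epsilon>)"
          using frob_transpose[of J "sw J \<alpha>' \<beta>"] by (simp add: sw_converse)
        ultimately show ?thesis by blast
      qed
      with IH show ?thesis by blast
    qed
  qed
qed

section \<open>One-dimensional modules and traceless matrices\<close>

definition trace_mt :: "nat set \<Rightarrow> 'a::field mt \<Rightarrow> 'a" where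
  "trace_mt I x = (\<Sum>i\<in>I. x i i)"

definition sl_supp :: "nat set \<Rightarrow> (nat \<times> nat) set \<Rightarrow> 'a::field mt set" where
  "sl_supp I R = {x \<in> supp R. trace_mt I x = 0}"

definition frob_sl :: "nat set \<Rightarrow> (nat \<times> nat) set \<Rightarrow> 'a::field itself \<Rightarrow> bool" where
  "frob_sl I R ty \<longleftrightarrow>
     (\<exists>\<gamma>. linear_form mscale \<gamma> \<and> nondeg (\<lambda>x y. \<gamma> (comm I x y)) (sl_supp I R :: 'a mt set))"

lemma trace_linear: "linear_form mscale (trace_mt I)"
  by (simp add: linear_form_def trace_mt_def sum.distrib sum_distrib_left)

lemma trace_idm: "finite I \<Longrightarrow> trace_mt I (idm I) = of_nat (card I)"
  by (simp add: trace_mt_def idm_def)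

lemma comm_linear:
  "comm I (x + y) z = comm I x z + comm I y z" "comm I x (y + z) = comm I x y + comm I x z"
  "comm I (mscale c x) z = mscale c (comm I x z)" "comm I x (mscale c z) = mscale c (comm I x z)"
  "comm I (x - y) z = comm I x z - comm I y z" "comm I x (y - z) = comm I x y - comm I x z"
  by (simp_all add: comm_def mmul_add_left mmul_add_right mmul_diff_left mmul_diff_right
      mmul_scale_left mmul_scale_right M.scale_right_diff_distrib)

lemma comm_idm:
  assumes "finite I" "x \<in> supp (I \<times> I)"
  shows "comm I (idm I) x = 0" "comm I x (idm I) = 0"
  by (simp_all add: comm_def mmul_idm_left[OF assms] mmul_idm_right[OF assms])

text \<open>
  Let \<open>lam\<close> be the character by which the seaweed acts on the line \<open>S\<close>. A nondegenerate functional
  is nonzero on \<open>S\<close>, and the orthogonal space of \<open>S\<close> is the product of the kernel of \<open>lam\<close> with \<open>S\<close>.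
  Both the kernel of \<open>lam\<close> and the traceless matrices are complements of the scalar matrices, which
  are central; so the projection \<open>\<pi>\<close> along the scalar matrices identifies their brackets.
\<close>

lemma frob_one_dimensional:
  fixes \<rho> :: "'a::field mt \<Rightarrow> 'a mt \<Rightarrow> 'a mt"
  assumes la: "local_action \<rho> L S" and fin: "finite I" and RI: "R \<subseteq> I \<times> I" and refl: "\<And>i. i \<in> I \<Longrightarrow> (i, i) \<in> R"
    and card: "of_nat (card I) \<noteq> (0::'a)"
    and sg: "sg \<noteq> 0" and S: "S = range (\<lambda>c. mscale c sg)"
    and lam: "linear_form mscale lam" "\<And>y. y \<in> supp R \<Longrightarrow> \<rho> y sg = mscale (lam y) sg" "lam (idm I) \<noteq> 0"
  shows "frob I R \<rho> S \<longleftrightarrow> frob_sl I R TYPE('a)"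
proof -
  interpret local_action \<rho> L S by fact
  let ?n = "of_nat (card I) :: 'a"
  let ?l = "lam (idm I)"
  let ?Q = "(supp R :: 'a mt set) \<times> S"
  let ?V = "{0 :: 'a mt} \<times> S"
  let ?Q' = "sl_supp I R :: 'a mt set"
  define \<pi> where "\<pi> z = (z - mscale (lam z / ?l) (idm I), 0 :: 'a mt)" for z
  have id: "idm I \<in> supp R" using refl by (auto simp: supp_def idm_def split: if_splits)
  have sq: "x \<in> supp (I \<times> I)" if "x \<in> supp R" for x using that supp_mono[OF RI] by blast
  have s0S: "sg \<in> S" unfolding S by (rule range_eqI[of _ _ 1]) simp
  have S0: "0 \<in> S" by (rule M.subspace_0[OF S_subspace])
  have z0: "0 \<in> (supp R :: 'a mt set)" by (rule M.subspace_0[OF subspace_supp])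
  have act: "\<rho> y (mscale c sg) = mscale (c * lam y) sg" if "y \<in> supp R" for y c
    using lam(2)[OF that] by (simp add: act_scale_right mult.commute)
  have act0: "\<rho> 0 s = 0" for s by (rule act_vanish) simp
  have core: "nondeg (\<lambda>p q. \<gamma> (sbr I \<rho> p q)) ?Q \<longleftrightarrow> nondeg (\<lambda>x y. \<gamma> (comm I x y, 0)) ?Q'"
    if lin: "linear_form pscale \<gamma>" and nz: "\<gamma> (0, sg) \<noteq> 0" for \<gamma>
  proof -
    define B where "B = (\<lambda>p q. \<gamma> (sbr I \<rho> p q))"
    have B: "bilin pscale B" unfolding B_def by (rule bilin_sbr[OF lin])
    have skew: "B q p = - B p q" for p q
      unfolding B_def by (subst sbr_skew) (rule P.functional_minus[OF lin])
    have g0: "\<gamma> (0, mscale c sg) = c * \<gamma> (0, sg)" for c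
      using P.functional_scale[OF lin, of c "(0, sg)"] by (simp add: M.scale_zero_right)
    have BV: "B (y, s) (0, mscale c sg) = - (c * lam y * \<gamma> (0, sg))" if "y \<in> supp R" for y s c
    proof -
      have "comm I y 0 = 0" using comm_linear(4)[of I y 0 0] by simp
      then have "sbr I \<rho> (y, s) (0, mscale c sg) = (0, mscale (- (c * lam y)) sg)"
        using act[OF that] act0 by (simp add: sbr_def)
      then show ?thesis by (simp only: B_def g0) simp
    qed
    have \<pi>l: "lam (fst (\<pi> z)) = 0" for z
      using lam(3) by (simp add: \<pi>_def M.functional_diff[OF lam(1)] M.functional_scale[OF lam(1)])
    have \<pi>R: "fst (\<pi> z) \<in> supp R" if "z \<in> supp R" for z
      unfolding \<pi>_def fst_conv by (intro M.subspace_diff M.subspace_scale subspace_supp that id)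
    have "nondeg B ?Q \<longleftrightarrow> (\<forall>v\<in>?V. (\<forall>x\<in>?Q. B v x = 0) \<longrightarrow> v = 0) \<and> nondeg (\<lambda>x y. \<gamma> (comm I x y, 0)) ?Q'"
    proof (rule nondeg_reduction_iso[where F = "{(0, sg)}" and \<pi> = \<pi>, OF vector_space_pscale vector_space_mscale B skew subspace_prod])
      show "{(0, sg)} \<subseteq> ?V" using s0S by simp
      show "P.subspace ?V" by (intro subspace_Times M.subspace_single_0 S_subspace)
      show "?V \<subseteq> ?Q" using z0 by auto
      show "?V \<subseteq> P.span {(0, sg)}"
      proof
        fix v assume "v \<in> ?V"
        then obtain c where "v = pscale c (0, sg)" by (auto simp: S M.scale_zero_right)
        then show "v \<in> P.span {(0, sg)}" by (simp only: P.span_scale P.span_base singletonI)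
      qed
      show "B v w = 0" if v: "v \<in> ?V" and w: "w \<in> ?V" for v w
      proof -
        obtain s c where vw: "v = (0, s)" "w = (0, mscale c sg)" using v w S by auto
        show ?thesis unfolding vw BV[OF z0] M.functional_zero[OF lam(1)] by simp
      qed
      show "\<pi> z \<in> ?Q" if "z \<in> ?Q'" for z
        using that \<pi>R S0 by (auto simp: sl_supp_def mem_Times_iff \<pi>_def)
      show "B (\<pi> z) v = 0" if z: "z \<in> ?Q'" and v: "v \<in> ?V" for z v
      proof -
        obtain c where v': "v = (0, mscale c sg)" using v S by auto
        have "z \<in> supp R" using z by (simp add: sl_supp_def)
        from BV[OF \<pi>R[OF this], of "snd (\<pi> z)" c] show ?thesis unfolding v' by (simp add: \<pi>l)
      qed
      show "\<exists>z\<in>?Q'. x - \<pi> z \<in> ?V" if x: "x \<in> ?Q" and perp: "\<forall>v\<in>?V. B x v = 0" for x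
      proof -
        obtain y s where x': "x = (y, s)" and y: "y \<in> supp R" and s: "s \<in> S" using x by auto
        have "B x (0, mscale 1 sg) = 0" using perp s0S by simp
        then have l0: "lam y = 0" unfolding x' BV[OF y] using nz by simp
        \<comment> \<open>The traceless part of \<open>y\<close>; subtracting the right scalar from it leads back to \<open>y\<close>, since \<open>lam y = 0\<close>.\<close>
        define z where "z = y - mscale (trace_mt I y / ?n) (idm I)"
        have zQ: "z \<in> ?Q'"
          using y id card unfolding sl_supp_def z_def
          by (auto intro!: M.subspace_diff M.subspace_scale subspace_supp
              simp: M.functional_diff[OF trace_linear] M.functional_scale[OF trace_linear] trace_idm[OF fin])
        have "lam z = - (trace_mt I y / ?n) * ?l"
          by (simp add: z_def M.functional_diff[OF lam(1)] M.functional_scale[OF lam(1)] l0)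
        then have "lam z / ?l = - (trace_mt I y / ?n)" using lam(3) by simp
        then have "\<pi> z = (y, 0)" by (simp add: \<pi>_def z_def)
        then have "x - \<pi> z \<in> ?V" using s by (simp add: x' mem_Times_iff)
        then show ?thesis by (rule bexI[OF _ zQ])
      qed
      show "z = 0" if z: "z \<in> ?Q'" and V: "\<pi> z \<in> ?V" for z
      proof -
        have e: "z = mscale (lam z / ?l) (idm I)" using V by (simp add: \<pi>_def)
        then have "trace_mt I z = lam z / ?l * ?n"
          using M.functional_scale[OF trace_linear, of I "lam z / ?l" "idm I"] trace_idm[OF fin, where 'a = 'a] by simp
        then have "lam z / ?l = 0" using z card by (simp add: sl_supp_def)
        with e show ?thesis by simp
      qed
      have "\<pi> 0 = (0, 0)" by (simp add: \<pi>_def M.functional_zero[OF lam(1)])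
      then show "\<pi> 0 \<in> ?V" using S0 by simp
      show "B (\<pi> z) (\<pi> z') = \<gamma> (comm I z z', 0)" if z: "z \<in> ?Q'" "z' \<in> ?Q'" for z z'
      proof -
        have "z \<in> supp (I \<times> I)" "z' \<in> supp (I \<times> I)" "idm I \<in> (supp (I \<times> I) :: 'a mt set)"
          using z sq id by (auto simp: sl_supp_def)
        then have "comm I (fst (\<pi> z)) (fst (\<pi> z')) = comm I z z'"
          by (simp add: \<pi>_def comm_linear comm_idm[OF fin])
        then show ?thesis by (simp add: B_def sbr_def \<pi>_def act_zero_right)
      qed
    qed simp
    moreover have "v = 0" if v: "v \<in> ?V" and r: "\<forall>x\<in>?Q. B v x = 0" for v
    proof -
      obtain c where v': "v = (0, mscale c sg)" using v S by auto
      have "(idm I, 0) \<in> ?Q" using id S0 by simp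
      with r have "B v (idm I, 0) = 0" by (rule bspec)
      then have "B (idm I, 0) v = 0" using skew[of v "(idm I, 0)"] by simp
      then have "c * lam (idm I) * \<gamma> (0, sg) = 0" unfolding v' BV[OF id] by simp
      then have "c = 0" using lam(3) nz by simp
      then show ?thesis by (simp add: v' zero_prod_def)
    qed
    ultimately show ?thesis unfolding B_def by blast
  qed
  show ?thesis
  proof
    assume "frob I R \<rho> S"
    then obtain \<gamma> where lin: "linear_form pscale \<gamma>" and nd: "nondeg (\<lambda>p q. \<gamma> (sbr I \<rho> p q)) ?Q"
      by (auto simp: frob_def)
    have nz: "\<gamma> (0, sg) \<noteq> 0"
    proof
      assume z: "\<gamma> (0, sg) = 0"
      have "\<gamma> (sbr I \<rho> (0, sg) q) = 0" if "q \<in> ?Q" for q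
      proof -
        have y: "fst q \<in> supp R" using that by (simp only: mem_Times_iff)
        have "comm I 0 (fst q) = 0" using comm_linear(3)[of I 0 0 "fst q"] by simp
        then have "sbr I \<rho> (0, sg) q = pscale (lam (fst q)) (0, sg)"
          using act0 lam(2)[OF y] by (simp add: sbr_def M.scale_zero_right)
        then show ?thesis by (simp only: P.functional_scale[OF lin] z) simp
      qed
      moreover have "(0, sg) \<in> ?Q" using z0 s0S by simp
      ultimately have "(0, sg) = (0 :: 'a mt \<times> 'a mt)" using nd unfolding nondeg_def by blast
      with sg show False by (simp add: prod_eq_iff)
    qed
    have "linear_form mscale (\<lambda>x. \<gamma> (x, 0))"
    proof -
      have "\<gamma> (x + y, 0) = \<gamma> (x, 0) + \<gamma> (y, 0)" for x y
        using P.functional_add[OF lin, of "(x, 0)" "(y, 0)"] by (simp only: add_Pair) simp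
      moreover have "\<gamma> (mscale c x, 0) = c * \<gamma> (x, 0)" for c x
        using P.functional_scale[OF lin, of c "(x, 0)"] by (simp only: pscale_Pair M.scale_zero_right)
      ultimately show ?thesis by (simp add: linear_form_def)
    qed
    with core[OF lin nz] nd show "frob_sl I R TYPE('a)" by (auto simp: frob_sl_def)
  next
    assume "frob_sl I R TYPE('a)"
    then obtain \<gamma>' where lin': "linear_form mscale \<gamma>'" and nd: "nondeg (\<lambda>x y. \<gamma>' (comm I x y)) ?Q'"
      by (auto simp: frob_sl_def)
    obtain a b where ab: "sg a b \<noteq> 0" using sg by (metis mt_eqI zero_fun_apply)
    define \<gamma> where "\<gamma> p = \<gamma>' (fst p) + snd p a b" for p
    have lin: "linear_form pscale \<gamma>"
      unfolding linear_form_def \<gamma>_def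
      by (simp add: M.functional_add[OF lin'] M.functional_scale[OF lin'] pscale_def algebra_simps)
    have "\<gamma> (0, sg) \<noteq> 0" using ab by (simp add: \<gamma>_def M.functional_zero[OF lin'])
    from core[OF lin this] nd have "nondeg (\<lambda>p q. \<gamma> (sbr I \<rho> p q)) ?Q" by (simp add: \<gamma>_def)
    with lin show "frob I R \<rho> S" by (auto simp: frob_def)
  qed
qed

lemma form_act_apply:
  "finite L \<Longrightarrow> form_act L y s i j = (\<Sum>k\<in>L. s i k * restr L y k j) + (\<Sum>k\<in>L. restr L y k i * s k j)"
  by (simp add: form_act_def mmul_apply tp_def)

lemma frob_sym_line_iff:
  assumes fin: "finite I" and RI: "R \<subseteq> I \<times> I" and refl: "\<And>i. i \<in> I \<Longrightarrow> (i, i) \<in> R"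
    and card: "of_nat (card I) \<noteq> (0::'a::field)" and two: "(2::'a) \<noteq> 0" and m: "m \<in> I"
  shows "frob I R (form_act {m}) (forms {m} (1::'a)) \<longleftrightarrow> frob_sl I R TYPE('a)"
proof (rule frob_one_dimensional[where lam = "\<lambda>y. 2 * y m m" and sg = "unit_mt m m", OF local_action_forms fin RI refl card])
  show "unit_mt m m \<noteq> (0 :: 'a mt)"
  proof
    assume "unit_mt m m = (0 :: 'a mt)"
    then have "unit_mt m m m m = (0 :: 'a mt) m m" by (simp only:)
    then show False by (simp add: unit_mt_apply)
  qed
  show "forms {m} 1 = range (\<lambda>c :: 'a. mscale c (unit_mt m m))"
  proof (intro equalityI subsetI)
    fix s :: "'a mt" assume "s \<in> forms {m} 1"
    then have s: "s \<in> supp ({m} \<times> {m})" by (simp add: forms_def)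
    have "s = mscale (s m m) (unit_mt m m)"
      using supp_zero[OF s] by (intro mt_eqI) (auto simp: unit_mt_apply)
    then show "s \<in> range (\<lambda>c. mscale c (unit_mt m m))" by blast
  qed (auto simp: forms_def supp_def tp_def unit_mt_def fun_eq_iff split: if_splits)
  show "form_act {m} y (unit_mt m m) = mscale (2 * y m m) (unit_mt m m)" for y :: "'a mt"
    by (intro mt_eqI) (auto simp: form_act_apply restr_def unit_mt_apply)
  show "linear_form mscale (\<lambda>y :: 'a mt. 2 * y m m)"
    by (simp add: linear_form_def algebra_simps)
  show "2 * idm I m m \<noteq> (0::'a)" using m two by (simp add: idm_def)
qed simp_all

lemma frob_alt_plane_iff:
  assumes fin: "finite I" and RI: "R \<subseteq> I \<times> I" and refl: "\<And>i. i \<in> I \<Longrightarrow> (i, i) \<in> R"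
    and card: "of_nat (card I) \<noteq> (0::'a::field)" and two: "(2::'a) \<noteq> 0" and pq: "p \<in> I" "q \<in> I" "p \<noteq> q"
  shows "frob I R (form_act {p, q}) (forms {p, q} (- 1 :: 'a)) \<longleftrightarrow> frob_sl I R TYPE('a)"
proof (rule frob_one_dimensional[where lam = "\<lambda>y. y p p + y q q" and sg = "unit_mt p q - unit_mt q p", OF local_action_forms fin RI refl card])
  have nq: "q \<noteq> p" using pq by simp
  show "unit_mt p q - unit_mt q p \<noteq> (0 :: 'a mt)"
  proof
    assume "unit_mt p q - unit_mt q p = (0 :: 'a mt)"
    then have "(unit_mt p q - unit_mt q p) p q = (0 :: 'a mt) p q" by (simp only:)
    then show False using pq nq by (simp add: unit_mt_apply)
  qed
  show "forms {p, q} (- 1) = range (\<lambda>c :: 'a. mscale c (unit_mt p q - unit_mt q p))"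
  proof (intro equalityI subsetI)
    fix s :: "'a mt" assume "s \<in> forms {p, q} (- 1)"
    then have s: "s \<in> supp ({p, q} \<times> {p, q})" and t: "tp s = mscale (- 1) s" by (simp_all add: forms_def)
    have alt: "s b a = - s a b" for a b
      using fun_cong[OF fun_cong[OF t, of a], of b] by (simp add: tp_def)
    have "s a a = 0" for a
    proof -
      have "2 * s a a = 0" using alt[of a a] by (simp add: eq_neg_iff_add_eq_0)
      with two show ?thesis by simp
    qed
    then have z: "s p p = 0" "s q q = 0" "s q p = - s p q" using alt[of q p] by simp_all
    have "s = mscale (s p q) (unit_mt p q - unit_mt q p)"
    proof (rule mt_eqI)
      fix i j
      show "s i j = mscale (s p q) (unit_mt p q - unit_mt q p) i j"
      proof (cases "i \<in> {p, q} \<and> j \<in> {p, q}")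
        case True
        then consider "i = p" "j = p" | "i = p" "j = q" | "i = q" "j = p" | "i = q" "j = q" by blast
        then show ?thesis by cases (simp_all add: z(1,2) unit_mt_apply nq pq(3), rule z(3))
      next
        case False
        then have "s i j = 0" by (intro supp_zero[OF s]) auto
        moreover have "unit_mt p q i j = (0::'a)" "unit_mt q p i j = (0::'a)"
          using False by (auto simp: unit_mt_apply)
        ultimately show ?thesis by simp
      qed
    qed
    then show "s \<in> range (\<lambda>c. mscale c (unit_mt p q - unit_mt q p))" by blast
  next
    fix s :: "'a mt" assume "s \<in> range (\<lambda>c. mscale c (unit_mt p q - unit_mt q p))"
    then obtain c where c: "s = mscale c (unit_mt p q - unit_mt q p)" by blast
    have "s \<in> supp ({p, q} \<times> {p, q})"
      unfolding c by (auto simp: supp_def unit_mt_apply split: if_splits)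
    moreover have "tp s = mscale (- 1) s"
      unfolding c using nq by (intro mt_eqI) (simp add: tp_def unit_mt_apply)
    ultimately show "s \<in> forms {p, q} (- 1)" by (simp add: forms_def)
  qed
  show "form_act {p, q} y (unit_mt p q - unit_mt q p) = mscale (y p p + y q q) (unit_mt p q - unit_mt q p)" for y :: "'a mt"
    using pq nq by (intro mt_eqI) (auto simp: form_act_apply restr_def unit_mt_apply)
  show "linear_form mscale (\<lambda>y :: 'a mt. y p p + y q q)"
    by (simp add: linear_form_def algebra_simps)
  show "idm I p p + idm I q q \<noteq> (0::'a)" using pq two by (simp add: idm_def)
qed simp_all

section \<open>Frobenius subalgebras of matrix algebras\<close>

text \<open>
  The dimension is the least size of a finite generating set and tells nothing unless there is one,
  so the main point is to find a finite set that generates \<open>W\<close>.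
\<close>

lemma subspace_dim_eq_0_iff:
  fixes W :: "'a::field mat set"
  assumes W: "W \<subseteq> carrier_mat m m" and z: "0\<^sub>m m m \<in> W"
    and add: "\<And>x y. x \<in> W \<Longrightarrow> y \<in> W \<Longrightarrow> x + y \<in> W" and sc: "\<And>c x. x \<in> W \<Longrightarrow> c \<cdot>\<^sub>m x \<in> W"
  shows "subspace_dim m W = 0 \<longleftrightarrow> W = {0\<^sub>m m m}"
proof -
  let ?MM = "module_mat TYPE('a) m m"
  let ?N = "?MM\<lparr>carrier := W\<rparr>"
  interpret V: vectorspace class_ring ?MM by (rule matrix_vs)
  have sub: "VectorSpace.subspace class_ring W ?MM"
    using W z add sc
    by (intro subspace.intro submodule.intro) (auto simp: matrix_vs_simps intro: V.vectorspace_axioms V.module_axioms)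
  interpret N: vectorspace class_ring ?N by (rule V.subspace_is_vs[OF sub])
  define \<phi> :: "'a mt \<Rightarrow> 'a mat" where "\<phi> x = mat m m (\<lambda>(i, j). x i j)" for x
  define W' where "W' = {x. \<phi> x \<in> W \<and> x \<in> supp ({..<m} \<times> {..<m})}"
  have \<phi>add: "\<phi> (x + y) = \<phi> x + \<phi> y" and \<phi>sc: "\<phi> (mscale c x) = c \<cdot>\<^sub>m \<phi> x" and \<phi>0: "\<phi> 0 = 0\<^sub>m m m" for x y c
    by (auto simp: \<phi>_def intro!: eq_matI)
  have sW': "M.subspace W'"
    using subspace_supp[of "{..<m} \<times> {..<m}"] add sc z
    by (auto simp: W'_def M.subspace_def \<phi>add \<phi>sc \<phi>0)
  obtain B where B: "B \<subseteq> W'" "M.independent B" "W' \<subseteq> M.span B"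
    by (rule M.basis_exists[of W'])
  have fin: "finite ({..<m} \<times> {..<m} :: (nat \<times> nat) set)" by simp
  have "B \<subseteq> M.span (units ({..<m} \<times> {..<m}))"
    using B(1) supp_span[OF fin] by (auto simp: W'_def)
  then have finB: "finite B"
    using M.independent_span_bound[OF _ B(2), of "units ({..<m} \<times> {..<m})"] by (simp add: units_def)
  have BW: "\<phi> ` B \<subseteq> carrier ?N" using B(1) by (auto simp: W'_def)
  have zN: "\<zero>\<^bsub>?N\<^esub> = 0\<^sub>m m m" by (simp add: matrix_vs_simps)
  have gen: "N.gen_set (\<phi> ` B)"
  proof
    show "N.span (\<phi> ` B) \<subseteq> carrier ?N" by (rule N.span_is_subset2[OF BW])
    interpret sp: submodule class_ring "N.span (\<phi> ` B)" ?N by (rule N.span_is_submodule[OF BW])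
    have own: "\<phi> ` B \<subseteq> N.span (\<phi> ` B)" by (rule N.in_own_span[OF BW])
    have "\<phi> x \<in> N.span (\<phi> ` B)" if "x \<in> M.span B" for x
      using that
    proof (induction rule: M.span_induct_alt)
      case base
      show ?case unfolding \<phi>0 zN[symmetric] by (rule sp.zero_closed)
    next
      case (step c x y)
      have "c \<odot>\<^bsub>?N\<^esub> \<phi> x \<in> N.span (\<phi> ` B)"
        using step.hyps own by (intro sp.smult_closed) (auto simp: class_ring_simps)
      then have "c \<odot>\<^bsub>?N\<^esub> \<phi> x \<oplus>\<^bsub>?N\<^esub> \<phi> y \<in> N.span (\<phi> ` B)"
        using step.IH by (rule sp.m_closed)
      then show ?case unfolding \<phi>add \<phi>sc by (simp add: matrix_vs_simps)
    qed
    moreover have "w \<in> \<phi> ` W'" if "w \<in> W" for w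
    proof -
      have wc: "w \<in> carrier_mat m m" using that W by auto
      define x where "x i j = (if i < m \<and> j < m then w $$ (i, j) else 0)" for i j
      have "\<phi> x = w" using wc by (intro eq_matI) (auto simp: \<phi>_def x_def)
      moreover have "x \<in> W'" using calculation that by (auto simp: W'_def supp_def x_def)
      ultimately show ?thesis by blast
    qed
    ultimately show "carrier ?N \<subseteq> N.span (\<phi> ` B)" using B(3) by auto
  qed
  have sp0: "N.span {} = {0\<^sub>m m m}"
    by (auto simp: N.span_def N.lincomb_def zN)
  have ex: "\<exists>n A. finite A \<and> card A = n \<and> A \<subseteq> carrier ?N \<and> N.gen_set A"
    using finB BW gen by blast
  have "N.dim = 0 \<longleftrightarrow> W = {0\<^sub>m m m}"
  proof
    assume d: "N.dim = 0"
    have "\<exists>A. finite A \<and> card A = N.dim \<and> A \<subseteq> carrier ?N \<and> N.gen_set A"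
      unfolding N.dim_def by (rule LeastI_ex[OF ex])
    then have "N.gen_set {}" using d by auto
    then show "W = {0\<^sub>m m m}" using sp0 by simp
  next
    assume "W = {0\<^sub>m m m}"
    then have "N.gen_set {}" using sp0 by simp
    then have "\<exists>A. finite A \<and> card A = 0 \<and> A \<subseteq> carrier ?N \<and> N.gen_set A" by (intro exI[of _ "{}"]) simp
    then show "N.dim = 0" unfolding N.dim_def by (intro Least_eq_0)
  qed
  then show ?thesis by (simp add: subspace_dim_def)
qed

definition mat_subalgebra :: "nat \<Rightarrow> 'a::field mat set \<Rightarrow> bool" where
  "mat_subalgebra m q \<longleftrightarrow> q \<subseteq> carrier_mat m m \<and> 0\<^sub>m m m \<in> q \<and> (\<forall>x\<in>q. \<forall>y\<in>q. x + y \<in> q) \<and>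
     (\<forall>c. \<forall>x\<in>q. c \<cdot>\<^sub>m x \<in> q) \<and> (\<forall>x\<in>q. \<forall>y\<in>q. lie_bracket x y \<in> q)"

lemma lie_bracket_linear:
  assumes "x \<in> carrier_mat m m" "x' \<in> carrier_mat m m" "y \<in> carrier_mat m m"
  shows "lie_bracket (x + x') y = lie_bracket x y + lie_bracket x' y"
    and "lie_bracket (c \<cdot>\<^sub>m x) y = c \<cdot>\<^sub>m lie_bracket x y"
proof -
  have "x * y + x' * y - (y * x + y * x') = x * y - y * x + (x' * y - y * x')"
    using assms by (intro eq_matI) auto
  then show "lie_bracket (x + x') y = lie_bracket x y + lie_bracket x' y"
    using assms by (simp add: lie_bracket_def add_mult_distrib_mat[of x m m x' y m] mult_add_distrib_mat[of y m m x m x'])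
  have "c \<cdot>\<^sub>m (x * y) - c \<cdot>\<^sub>m (y * x) = c \<cdot>\<^sub>m (x * y - y * x)"
    using assms by (intro eq_matI) (auto simp: right_diff_distrib)
  then show "lie_bracket (c \<cdot>\<^sub>m x) y = c \<cdot>\<^sub>m lie_bracket x y"
    using assms by (simp add: lie_bracket_def mult_smult_distrib[of y m m x m] mult_smult_assoc_mat[of x m m y m])
qed

lemma frobenius_iff:
  assumes q: "mat_subalgebra m q"
  shows "frobenius m q \<longleftrightarrow>
    (\<exists>\<gamma>\<in>linear_functionals q. \<forall>x\<in>q. (\<forall>y\<in>q. \<gamma> (lie_bracket x y) = 0) \<longrightarrow> x = 0\<^sub>m m m)"
proof -
  have qs: "q \<subseteq> carrier_mat m m" "0\<^sub>m m m \<in> q" "\<And>x y. x \<in> q \<Longrightarrow> y \<in> q \<Longrightarrow> x + y \<in> q"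
    "\<And>c x. x \<in> q \<Longrightarrow> c \<cdot>\<^sub>m x \<in> q" "\<And>x y. x \<in> q \<Longrightarrow> y \<in> q \<Longrightarrow> lie_bracket x y \<in> q"
    using q by (auto simp: mat_subalgebra_def)
  have key: "subspace_dim m (lie_stabilizer q \<gamma>) = 0 \<longleftrightarrow>
      (\<forall>x\<in>q. (\<forall>y\<in>q. \<gamma> (lie_bracket x y) = 0) \<longrightarrow> x = 0\<^sub>m m m)"
    if g: "\<gamma> \<in> linear_functionals q" for \<gamma>
  proof -
    have ga: "\<gamma> (x + y) = \<gamma> x + \<gamma> y" "\<gamma> (c \<cdot>\<^sub>m x) = c * \<gamma> x" if "x \<in> q" "y \<in> q" for x y c
      using g that by (auto simp: linear_functionals_def)
    have g0: "\<gamma> (0\<^sub>m m m) = 0" using ga(2)[OF qs(2,2), of 0] by simp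
    have z: "0\<^sub>m m m \<in> lie_stabilizer q \<gamma>"
    proof -
      have "lie_bracket (0\<^sub>m m m) y = 0\<^sub>m m m" if "y \<in> q" for y
        using that qs(1) by (auto simp: lie_bracket_def)
      with g0 qs(2) show ?thesis by (simp add: lie_stabilizer_def)
    qed
    have "subspace_dim m (lie_stabilizer q \<gamma>) = 0 \<longleftrightarrow> lie_stabilizer q \<gamma> = {0\<^sub>m m m}"
    proof (rule subspace_dim_eq_0_iff[OF _ z])
      show "lie_stabilizer q \<gamma> \<subseteq> carrier_mat m m" using qs(1) by (auto simp: lie_stabilizer_def)
      show "x + x' \<in> lie_stabilizer q \<gamma>" if "x \<in> lie_stabilizer q \<gamma>" "x' \<in> lie_stabilizer q \<gamma>" for x x'
        using that qs lie_bracket_linear(1)[where x = x and x' = x' and m = m] ga(1)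
        by (auto simp: lie_stabilizer_def subset_iff)
      show "c \<cdot>\<^sub>m x \<in> lie_stabilizer q \<gamma>" if "x \<in> lie_stabilizer q \<gamma>" for c x
        using that qs lie_bracket_linear(2)[where x = x and x' = x and m = m and c = c] ga(2)
        by (auto simp: lie_stabilizer_def subset_iff)
    qed
    also have "\<dots> \<longleftrightarrow> (\<forall>x\<in>q. (\<forall>y\<in>q. \<gamma> (lie_bracket x y) = 0) \<longrightarrow> x = 0\<^sub>m m m)"
      using z by (auto simp: lie_stabilizer_def)
    finally show ?thesis .
  qed
  have "(\<lambda>_. 0) \<in> linear_functionals q" by (simp add: linear_functionals_def)
  then have ex: "\<exists>d. \<exists>\<gamma>\<in>linear_functionals q. d = subspace_dim m (lie_stabilizer q \<gamma>)" by blast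
  have "lie_index m q = 0 \<longleftrightarrow> (\<exists>\<gamma>\<in>linear_functionals q. 0 = subspace_dim m (lie_stabilizer q \<gamma>))"
  proof
    assume "lie_index m q = 0"
    then show "\<exists>\<gamma>\<in>linear_functionals q. 0 = subspace_dim m (lie_stabilizer q \<gamma>)"
      using LeastI_ex[OF ex] by (simp only: lie_index_def)
  qed (unfold lie_index_def, rule Least_eq_0)
  then show ?thesis using key by (auto simp: frobenius_def)
qed

text \<open>
  Passage to a coordinate space \<open>Q\<close>. Functionals on \<open>q\<close> are linear on \<open>q\<close> only, whereas linear forms
  are linear on the whole ambient space of \<open>Q\<close>; the projection \<open>Pr\<close> extends them.
\<close>

lemma frobenius_transport:
  fixes scl :: "'a::field \<Rightarrow> 'v::ab_group_add \<Rightarrow> 'v" and \<Phi> :: "'v \<Rightarrow> 'a mat"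
  assumes vs: "vector_space scl" and Q: "module.subspace scl Q"
    and q: "q \<subseteq> carrier_mat m m" and bij: "bij_betw \<Phi> Q q"
    and P: "\<And>v. Pr v \<in> Q" "\<And>v. v \<in> Q \<Longrightarrow> Pr v = v" "\<And>u v. Pr (u + v) = Pr u + Pr v" "\<And>c v. Pr (scl c v) = scl c (Pr v)"
    and \<Phi>: "\<And>u v. \<Phi> (u + v) = \<Phi> u + \<Phi> v" "\<And>c v. \<Phi> (scl c v) = c \<cdot>\<^sub>m \<Phi> v" "\<Phi> 0 = 0\<^sub>m m m"
    and br: "\<And>u v. u \<in> Q \<Longrightarrow> v \<in> Q \<Longrightarrow> br u v \<in> Q"
      "\<And>u v. u \<in> Q \<Longrightarrow> v \<in> Q \<Longrightarrow> \<Phi> (br u v) = lie_bracket (\<Phi> u) (\<Phi> v)"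
  shows "frobenius m q \<longleftrightarrow> (\<exists>\<gamma>. linear_form scl \<gamma> \<and> nondeg (\<lambda>u v. \<gamma> (br u v)) Q)"
proof -
  interpret vector_space scl by fact
  have qQ: "\<exists>u\<in>Q. x = \<Phi> u" if "x \<in> q" for x using bij that by (auto simp: bij_betw_def)
  have \<Phi>q: "\<Phi> u \<in> q" if "u \<in> Q" for u using bij that by (auto simp: bij_betw_def)
  have inj: "u = v" if "\<Phi> u = \<Phi> v" "u \<in> Q" "v \<in> Q" for u v using bij that by (auto simp: bij_betw_def inj_on_def)
  have Q0: "0 \<in> Q" by (rule subspace_0[OF Q])
  have sub: "mat_subalgebra m q"
    unfolding mat_subalgebra_def
  proof (intro conjI ballI allI)
    show "0\<^sub>m m m \<in> q" using \<Phi>q[OF Q0] \<Phi>(3) by simp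
    fix x assume "x \<in> q"
    then obtain u where u: "u \<in> Q" "x = \<Phi> u" using qQ by blast
    show "c \<cdot>\<^sub>m x \<in> q" for c using \<Phi>q[OF subspace_scale[OF Q u(1), of c]] u(2) \<Phi>(2) by simp
    fix y assume "y \<in> q"
    then obtain v where v: "v \<in> Q" "y = \<Phi> v" using qQ by blast
    show "x + y \<in> q" using \<Phi>q[OF subspace_add[OF Q u(1) v(1)]] u(2) v(2) \<Phi>(1) by simp
    show "lie_bracket x y \<in> q" using \<Phi>q[OF br(1)[OF u(1) v(1)]] u v br(2) by simp
  qed (rule q)
  show "frobenius m q \<longleftrightarrow> (\<exists>\<gamma>. linear_form scl \<gamma> \<and> nondeg (\<lambda>u v. \<gamma> (br u v)) Q)"
    unfolding frobenius_iff[OF sub]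
  proof
    assume "\<exists>\<gamma>\<in>linear_functionals q. \<forall>x\<in>q. (\<forall>y\<in>q. \<gamma> (lie_bracket x y) = 0) \<longrightarrow> x = 0\<^sub>m m m"
    then obtain \<gamma> where g: "\<gamma> \<in> linear_functionals q"
      and nd: "\<And>x. x \<in> q \<Longrightarrow> (\<forall>y\<in>q. \<gamma> (lie_bracket x y) = 0) \<Longrightarrow> x = 0\<^sub>m m m" by blast
    have ga: "\<gamma> (x + y) = \<gamma> x + \<gamma> y" "\<gamma> (c \<cdot>\<^sub>m x) = c * \<gamma> x" if "x \<in> q" "y \<in> q" for x y c
      using g that by (auto simp: linear_functionals_def)
    have "linear_form scl (\<lambda>v. \<gamma> (\<Phi> (Pr v)))"
      unfolding linear_form_def P(3,4) \<Phi>(1,2) using ga \<Phi>q P(1) by blast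
    moreover have "nondeg (\<lambda>u v. \<gamma> (\<Phi> (Pr (br u v)))) Q"
      unfolding nondeg_def
    proof (intro ballI impI)
      fix u assume u: "u \<in> Q" and r: "\<forall>v\<in>Q. \<gamma> (\<Phi> (Pr (br u v))) = 0"
      have "\<gamma> (lie_bracket (\<Phi> u) y) = 0" if "y \<in> q" for y
      proof -
        obtain v where v: "v \<in> Q" "y = \<Phi> v" using qQ[OF \<open>y \<in> q\<close>] by blast
        then have "\<gamma> (\<Phi> (Pr (br u v))) = 0" using r by blast
        then show ?thesis using P(2)[OF br(1)[OF u v(1)]] br(2)[OF u v(1)] v(2) by simp
      qed
      then have "\<Phi> u = \<Phi> 0" using nd[OF \<Phi>q[OF u]] \<Phi>(3) by simp
      then show "u = 0" using inj u Q0 by blast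
    qed
    ultimately show "\<exists>\<gamma>. linear_form scl \<gamma> \<and> nondeg (\<lambda>u v. \<gamma> (br u v)) Q"
      by (intro exI[of _ "\<lambda>v. \<gamma> (\<Phi> (Pr v))"]) blast
  next
    assume "\<exists>\<gamma>. linear_form scl \<gamma> \<and> nondeg (\<lambda>u v. \<gamma> (br u v)) Q"
    then obtain \<gamma> where lin: "linear_form scl \<gamma>" and nd: "nondeg (\<lambda>u v. \<gamma> (br u v)) Q" by blast
    define \<gamma>m where "\<gamma>m x = \<gamma> (inv_into Q \<Phi> x)" for x
    have gm: "\<gamma>m (\<Phi> u) = \<gamma> u" if "u \<in> Q" for u
      using bij that by (simp add: \<gamma>m_def bij_betw_def inv_into_f_f)
    have "\<gamma>m \<in> linear_functionals q"
      unfolding linear_functionals_def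
    proof (intro CollectI conjI ballI allI)
      fix x assume "x \<in> q"
      then obtain u where u: "u \<in> Q" "x = \<Phi> u" using qQ by blast
      show "\<gamma>m (c \<cdot>\<^sub>m x) = c * \<gamma>m x" for c
        unfolding u(2) \<Phi>(2)[symmetric] gm[OF subspace_scale[OF Q u(1)]] gm[OF u(1)] by (rule functional_scale[OF lin])
      fix y assume "y \<in> q"
      then obtain v where v: "v \<in> Q" "y = \<Phi> v" using qQ by blast
      show "\<gamma>m (x + y) = \<gamma>m x + \<gamma>m y"
        unfolding u(2) v(2) \<Phi>(1)[symmetric] gm[OF subspace_add[OF Q u(1) v(1)]] gm[OF u(1)] gm[OF v(1)]
        by (rule functional_add[OF lin])
    qed
    moreover have "x = 0\<^sub>m m m" if x: "x \<in> q" and r: "\<forall>y\<in>q. \<gamma>m (lie_bracket x y) = 0" for x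
    proof -
      obtain u where u: "u \<in> Q" "x = \<Phi> u" using qQ[OF x] by blast
      have "\<gamma> (br u v) = 0" if v: "v \<in> Q" for v
        using r \<Phi>q[OF v] gm[OF br(1)[OF u(1) v]] br(2)[OF u(1) v] u(2) by metis
      then have "u = 0" using nd u(1) unfolding nondeg_def by blast
      then show ?thesis using u(2) \<Phi>(3) by simp
    qed
    ultimately show "\<exists>\<gamma>\<in>linear_functionals q. \<forall>x\<in>q. (\<forall>y\<in>q. \<gamma> (lie_bracket x y) = 0) \<longrightarrow> x = 0\<^sub>m m m"
      by blast
  qed
qed

section \<open>Seaweeds as incidence algebras\<close>

text \<open>
  The block boundaries of a composition, including both ends. They are easier to handle than the
  list: an entry \<open>(i, j)\<close> below the diagonal blocks is one with a boundary between \<open>j\<close> and \<open>i\<close>, and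
  appending, reversing and symmetrising compositions become operations on sets.
\<close>

definition bd :: "nat list \<Rightarrow> nat set" where
  "bd a = part_start a ` {..length a}"

definition blk :: "nat list \<Rightarrow> nat \<Rightarrow> nat" where
  "blk a i = card {c \<in> bd a. c \<le> i}"

lemma part_start_mono: "k \<le> l \<Longrightarrow> part_start a k \<le> part_start a l"
proof -
  assume "k \<le> l"
  then have "take l a = take k a @ take (l - k) (drop k a)"
    using take_add[of k "l - k" a] by simp
  then show ?thesis by (simp add: part_start_def)
qed

lemma part_start_Cons [simp]: "part_start (x # a) (Suc k) = x + part_start a k"
  and part_start_0 [simp]: "part_start a 0 = 0"
  and part_start_length [simp]: "part_start a (length a) = sum_list a"
  by (simp_all add: part_start_def)

lemma bd_Nil [simp]: "bd [] = {0}"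
  by (simp add: bd_def)

lemma bd_Cons: "bd (x # a) = insert 0 ((+) x ` bd a)"
proof -
  have "{..length (x # a)} = insert 0 (Suc ` {..length a})"
    by (simp add: atMost_Suc_eq_insert_0)
  then show ?thesis by (simp add: bd_def image_image)
qed

lemma bd_append: "bd (a @ b) = bd a \<union> (+) (sum_list a) ` bd b"
proof (induction a)
  case Nil
  have "0 \<in> bd b" by (auto simp: bd_def intro: image_eqI[of _ _ 0])
  then show ?case by auto
next
  case (Cons x a)
  then show ?case by (auto simp: bd_Cons image_Un image_image add.assoc)
qed

lemma finite_bd [simp]: "finite (bd a)" by (simp add: bd_def)

lemma zero_bd [simp]: "0 \<in> bd a" by (auto simp: bd_def intro: image_eqI[of _ _ 0])

lemma sum_bd [simp]: "sum_list a \<in> bd a" by (auto simp: bd_def intro: image_eqI[of _ _ "length a"])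

lemma bd_le: "c \<in> bd a \<Longrightarrow> c \<le> sum_list a"
  using part_start_mono[of _ "length a" a] by (auto simp: bd_def)

lemma bd_rev: "bd (rev a) = (\<lambda>c. sum_list a - c) ` bd a"
proof (induction a)
  case (Cons x a)
  have "(\<lambda>c. sum_list (x # a) - c) ` bd (x # a) = insert (x + sum_list a) ((\<lambda>c. sum_list a - c) ` bd a)"
    by (simp add: bd_Cons image_image)
  moreover have "bd (rev (x # a)) = (\<lambda>c. sum_list a - c) ` bd a \<union> {sum_list a, x + sum_list a}"
    by (simp add: bd_append bd_Cons Cons sum_list_rev) auto
  moreover have "sum_list a \<in> (\<lambda>c. sum_list a - c) ` bd a" by (rule image_eqI[of _ _ 0]) simp_all
  ultimately show ?case by auto
qed simp

lemma bd_symmetrized: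
  assumes "sum_list a \<le> n"
  shows "bd (symmetrized n a) = bd a \<union> (\<lambda>c. 2 * n - c) ` bd a"
proof (cases "n - sum_list a = 0")
  case True
  then have n: "sum_list a = n" using assms by simp
  have "(+) n ` (\<lambda>c. n - c) ` bd a = (\<lambda>c. 2 * n - c) ` bd a"
    using bd_le[of _ a] n by (auto simp: image_image intro!: image_cong)
  then show ?thesis using True n by (simp add: symmetrized_def bd_append bd_rev)
next
  case False
  define d where "d = n - sum_list a"
  have n: "n = sum_list a + d" using assms by (simp add: d_def)
  have e: "(+) (sum_list a) ` (+) (2 * d) ` (\<lambda>c. sum_list a - c) ` bd a = (\<lambda>c. 2 * n - c) ` bd a"
    unfolding image_image
  proof (rule image_cong[OF refl])
    fix c assume "c \<in> bd a"
    then show "sum_list a + (2 * d + (sum_list a - c)) = 2 * n - c" using bd_le[of c a] n by simp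
  qed
  have "bd (symmetrized n a) = bd a \<union> insert (sum_list a) ((+) (sum_list a) ` (+) (2 * d) ` (\<lambda>c. sum_list a - c) ` bd a)"
    using False by (simp add: symmetrized_def d_def[symmetric] bd_append bd_Cons bd_rev)
  then show ?thesis using e sum_bd[of a] by auto
qed

lemma sum_symmetrized:
  assumes "sum_list a \<le> n" shows "sum_list (symmetrized n a) = 2 * n"
proof -
  obtain d where "n = sum_list a + d" using assms le_Suc_ex by blast
  then show ?thesis by (auto simp: symmetrized_def Let_def sum_list_rev)
qed

lemma interval_exists: "i < sum_list a \<Longrightarrow> \<exists>k<length a. i \<in> part_interval a k"
proof (induction a arbitrary: i)
  case (Cons x a)
  show ?case
  proof (cases "i < x")
    case True
    then show ?thesis by (intro exI[of _ 0]) (simp add: part_interval_def)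
  next
    case False
    then have "i - x < sum_list a" using Cons.prems by auto
    then obtain k where "k < length a" "i - x \<in> part_interval a k" using Cons.IH by blast
    then show ?thesis using False by (intro exI[of _ "Suc k"]) (auto simp: part_interval_def)
  qed
qed simp

lemma blk_less: "blk a j < blk a i \<longleftrightarrow> (\<exists>c\<in>bd a. j < c \<and> c \<le> i)"
proof
  assume "\<exists>c\<in>bd a. j < c \<and> c \<le> i"
  then obtain c where c: "c \<in> bd a" "j < c" "c \<le> i" by blast
  have "c \<in> {c \<in> bd a. c \<le> i}" "c \<notin> {c \<in> bd a. c \<le> j}" using c by auto
  moreover have "{c \<in> bd a. c \<le> j} \<subseteq> {c \<in> bd a. c \<le> i}" using c by auto
  ultimately have "{c \<in> bd a. c \<le> j} \<subset> {c \<in> bd a. c \<le> i}" by blast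
  then show "blk a j < blk a i" unfolding blk_def by (intro psubset_card_mono) simp_all
next
  assume l: "blk a j < blk a i"
  show "\<exists>c\<in>bd a. j < c \<and> c \<le> i"
  proof (rule ccontr)
    assume "\<not> ?thesis"
    then have "{c \<in> bd a. c \<le> i} \<subseteq> {c \<in> bd a. c \<le> j}" by force
    then have "blk a i \<le> blk a j" unfolding blk_def by (intro card_mono) simp_all
    with l show False by simp
  qed
qed

lemma mono_blk: "mono_on I (blk a)"
  unfolding blk_def by (intro mono_onI card_mono) auto

lemma block_interval_iff:
  assumes "sum_list a = n" "i < n" "j < n"
  shows "(\<exists>k l. l < k \<and> k < length a \<and> i \<in> part_interval a k \<and> j \<in> part_interval a l) \<longleftrightarrow>
    (\<exists>c\<in>bd a. j < c \<and> c \<le> i)"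
proof
  assume "\<exists>k l. l < k \<and> k < length a \<and> i \<in> part_interval a k \<and> j \<in> part_interval a l"
  then obtain k l where kl: "l < k" "k < length a" "part_start a k \<le> i" "j < part_start a (Suc l)"
    by (auto simp: part_interval_def)
  have "part_start a (Suc l) \<le> part_start a k" using kl by (intro part_start_mono) simp
  then show "\<exists>c\<in>bd a. j < c \<and> c \<le> i" using kl by (intro bexI[of _ "part_start a k"]) (auto simp: bd_def)
next
  assume "\<exists>c\<in>bd a. j < c \<and> c \<le> i"
  then obtain m where m: "m \<le> length a" "j < part_start a m" "part_start a m \<le> i" by (auto simp: bd_def)
  obtain k l where k: "k < length a" "i \<in> part_interval a k" and l: "l < length a" "j \<in> part_interval a l"
    using interval_exists assms by metis
  have "l < m"
  proof (rule ccontr)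
    assume "\<not> l < m"
    then have "part_start a m \<le> part_start a l" by (intro part_start_mono) simp
    with m l show False by (simp add: part_interval_def)
  qed
  moreover have "m < Suc k"
  proof (rule ccontr)
    assume "\<not> m < Suc k"
    then have "part_start a (Suc k) \<le> part_start a m" by (intro part_start_mono) simp
    with m k show False by (simp add: part_interval_def)
  qed
  ultimately show "\<exists>k l. l < k \<and> k < length a \<and> i \<in> part_interval a k \<and> j \<in> part_interval a l"
    using k l by (intro exI[of _ k] exI[of _ l]) simp
qed

lemma part_interval_less: "i \<in> part_interval a k \<Longrightarrow> k < length a \<Longrightarrow> i < sum_list a"
  using part_start_mono[of "Suc k" "length a" a] by (auto simp: part_interval_def)

lemma seaweed_A_bd:
  assumes "sum_list a = n" "sum_list b = n"
  shows "M \<in> seaweed_A n a b \<longleftrightarrow> M \<in> carrier_mat n n \<and>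
    (\<forall>i<n. \<forall>j<n. M $$ (i, j) \<noteq> 0 \<longrightarrow> \<not> (\<exists>c\<in>bd a. j < c \<and> c \<le> i) \<and> \<not> (\<exists>c\<in>bd b. i < c \<and> c \<le> j))"
proof -
  have up: "(\<forall>k l i j. l < k \<and> k < length a \<and> i \<in> part_interval a k \<and> j \<in> part_interval a l \<longrightarrow> M $$ (i, j) = 0)
    \<longleftrightarrow> (\<forall>i<n. \<forall>j<n. (\<exists>c\<in>bd a. j < c \<and> c \<le> i) \<longrightarrow> M $$ (i, j) = 0)" (is "?A \<longleftrightarrow> ?B")
  proof
    assume A: ?A
    show ?B
    proof (intro allI impI)
      fix i j assume "i < n" "j < n" "\<exists>c\<in>bd a. j < c \<and> c \<le> i"
      with block_interval_iff[OF assms(1)] A show "M $$ (i, j) = 0" by blast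
    qed
  next
    assume B: ?B
    show ?A
    proof (intro allI impI)
      fix k l i j assume kl: "l < k \<and> k < length a \<and> i \<in> part_interval a k \<and> j \<in> part_interval a l"
      then have "i < n" "j < n" using part_interval_less assms(1) by (metis order.strict_trans)+
      with block_interval_iff[OF assms(1)] B kl show "M $$ (i, j) = 0" by blast
    qed
  qed
  have lo: "(\<forall>k l i j. k < l \<and> l < length b \<and> i \<in> part_interval b k \<and> j \<in> part_interval b l \<longrightarrow> M $$ (i, j) = 0)
    \<longleftrightarrow> (\<forall>i<n. \<forall>j<n. (\<exists>c\<in>bd b. i < c \<and> c \<le> j) \<longrightarrow> M $$ (i, j) = 0)" (is "?A \<longleftrightarrow> ?B")
  proof
    assume A: ?A
    show ?B
    proof (intro allI impI)
      fix i j assume "i < n" "j < n" "\<exists>c\<in>bd b. i < c \<and> c \<le> j"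
      with block_interval_iff[OF assms(2), of j i] A show "M $$ (i, j) = 0" by blast
    qed
  next
    assume B: ?B
    show ?A
    proof (intro allI impI)
      fix k l i j assume kl: "k < l \<and> l < length b \<and> i \<in> part_interval b k \<and> j \<in> part_interval b l"
      then have "i < n" "j < n" using part_interval_less assms(2) by (metis order.strict_trans)+
      with block_interval_iff[OF assms(2), of j i] B kl show "M $$ (i, j) = 0" by blast
    qed
  qed
  show ?thesis
    unfolding seaweed_A_def block_upper_triangular_def block_lower_triangular_def Int_iff mem_Collect_eq up lo
    by blast
qed

lemma seaweed_A_sw:
  assumes "sum_list a = n" "sum_list b = n"
  shows "M \<in> seaweed_A n a b \<longleftrightarrow> M \<in> carrier_mat n n \<and>
    (\<forall>i<n. \<forall>j<n. M $$ (i, j) \<noteq> 0 \<longrightarrow> (i, j) \<in> sw {..<n} (blk a) (blk b))"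
  unfolding seaweed_A_bd[OF assms] blk_less[symmetric] by (simp add: sw_def not_less)

definition to_mat :: "nat \<Rightarrow> 'a mt \<Rightarrow> 'a mat" where
  "to_mat n x = mat n n (\<lambda>(i, j). x i j)"

definition cut :: "(nat \<times> nat) set \<Rightarrow> 'a::field mt \<Rightarrow> 'a mt" where
  "cut R x = (\<lambda>i j. if (i, j) \<in> R then x i j else 0)"

lemma cut_supp: "cut R x \<in> supp R" by (auto simp: cut_def supp_def)

lemma cut_id: "x \<in> supp R \<Longrightarrow> cut R x = x"
  by (intro mt_eqI) (auto simp: cut_def supp_zero)

lemma cut_add: "cut R (x + y) = cut R x + cut R y" and cut_scale: "cut R (mscale c x) = mscale c (cut R x)"
  by (auto intro!: mt_eqI simp: cut_def)

lemma trace_comm: "trace_mt I (comm I x y) = 0"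
proof -
  have "(\<Sum>i\<in>I. \<Sum>k\<in>I. x i k * y k i) = (\<Sum>i\<in>I. \<Sum>k\<in>I. y i k * x k i)"
    by (subst sum.swap) (simp add: mult.commute)
  then show ?thesis by (simp add: trace_mt_def comm_def mmul_apply sum_subtractf)
qed

lemma comm_supp: "trans R \<Longrightarrow> x \<in> supp R \<Longrightarrow> y \<in> supp R \<Longrightarrow> comm I x y \<in> supp R"
  unfolding comm_def by (intro M.subspace_diff subspace_supp mmul_supp)

lemma to_mat_comm: "to_mat n (comm {..<n} x y) = lie_bracket (to_mat n x) (to_mat n y)"
  by (intro eq_matI) (auto simp: to_mat_def lie_bracket_def comm_def mmul_apply scalar_prod_def atLeast0LessThan)

text \<open>
  The projection to the traceless matrices subtracts a multiple of the identity, for which \<open>n\<close> has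
  to be invertible in the field.
\<close>

lemma frobenius_sl_seaweed_iff:
  assumes ab: "sum_list a = n" "sum_list b = n" and n: "0 < n" and char: "(of_nat n :: 'a::field) \<noteq> 0"
  shows "frobenius n (seaweed_A n a b \<inter> sl n :: 'a mat set) \<longleftrightarrow>
    frob_sl {..<n} (sw {..<n} (blk a) (blk b)) TYPE('a)"
proof -
  let ?I = "{..<n}"
  let ?R = "sw ?I (blk a) (blk b)"
  let ?Q = "sl_supp ?I ?R :: 'a mt set"
  let ?q = "seaweed_A n a b \<inter> sl n :: 'a mat set"
  define Pr where "Pr x = cut ?R x - mscale (trace_mt ?I (cut ?R x) / of_nat n) (idm ?I)" for x :: "'a mt"
  have id: "idm ?I \<in> supp ?R" by (auto simp: supp_def idm_def sw_def split: if_splits)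
  have RI: "?R \<subseteq> ?I \<times> ?I" by (auto simp: sw_def)
  have ti: "trace_mt ?I (idm ?I :: 'a mt) = of_nat n" by (simp add: trace_idm)
  show ?thesis
    unfolding frob_sl_def
  proof (rule frobenius_transport[OF vector_space_mscale, where \<Phi> = "to_mat n" and Pr = Pr])
    show "M.subspace ?Q"
      unfolding M.subspace_def sl_supp_def
      using subspace_supp[of ?R, where 'a = 'a]
      by (auto simp: M.subspace_def M.functional_add[OF trace_linear] M.functional_scale[OF trace_linear]
          M.functional_zero[OF trace_linear] simp del: plus_fun_apply)
    show "?q \<subseteq> carrier_mat n n" by (auto simp: sl_def)
    have to_q: "to_mat n x \<in> ?q" if "x \<in> ?Q" for x
      using that unfolding Int_iff seaweed_A_sw[OF ab]
      by (auto simp: to_mat_def sl_def sl_supp_def trace_mt_def dest: suppD)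
    have "inj_on (to_mat n) ?Q"
    proof (rule inj_onI, rule mt_eqI)
      fix x y i j assume x: "x \<in> ?Q" and y: "y \<in> ?Q" and e: "to_mat n x = to_mat n y"
      show "x i j = y i j"
      proof (cases "i < n \<and> j < n")
        case True
        then show ?thesis using arg_cong[OF e, of "\<lambda>M. M $$ (i, j)"] by (simp add: to_mat_def)
      next
        case False
        then have "(i, j) \<notin> ?R" using RI by auto
        then show ?thesis using x y supp_zero[of x ?R] supp_zero[of y ?R] by (simp add: sl_supp_def)
      qed
    qed
    moreover have "\<exists>x\<in>?Q. M = to_mat n x" if M: "M \<in> ?q" for M
    proof -
      have Mc: "M \<in> carrier_mat n n" and Mz: "\<And>i j. i < n \<Longrightarrow> j < n \<Longrightarrow> M $$ (i, j) \<noteq> 0 \<Longrightarrow> (i, j) \<in> ?R"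
        and tr: "(\<Sum>i<n. M $$ (i, i)) = 0"
        using M unfolding Int_iff seaweed_A_sw[OF ab] by (auto simp: sl_def)
      define x where "x i j = (if i < n \<and> j < n then M $$ (i, j) else 0)" for i j
      have "x \<in> ?Q" using Mz tr by (auto simp: sl_supp_def supp_def x_def trace_mt_def)
      moreover have "M = to_mat n x" using Mc by (intro eq_matI) (auto simp: to_mat_def x_def)
      ultimately show ?thesis by blast
    qed
    ultimately show "bij_betw (to_mat n) ?Q ?q" using to_q by (auto simp: bij_betw_def)
    show "Pr x \<in> ?Q" for x
      unfolding sl_supp_def
    proof (intro CollectI conjI)
      show "Pr x \<in> supp ?R" unfolding Pr_def by (intro M.subspace_diff M.subspace_scale subspace_supp cut_supp id)
      show "trace_mt ?I (Pr x) = 0"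
        using char by (simp add: Pr_def M.functional_diff[OF trace_linear] M.functional_scale[OF trace_linear] ti)
    qed
    show "Pr x = x" if "x \<in> ?Q" for x
      using that by (simp add: Pr_def sl_supp_def cut_id)
    show "Pr (x + y) = Pr x + Pr y" for x y
      by (simp add: Pr_def cut_add M.functional_add[OF trace_linear] add_divide_distrib M.scale_left_distrib)
    show "Pr (mscale c x) = mscale c (Pr x)" for c x
      by (simp add: Pr_def cut_scale M.functional_scale[OF trace_linear] M.scale_right_diff_distrib)
    show "to_mat n (x + y) = to_mat n x + to_mat n y" "to_mat n (mscale c x) = c \<cdot>\<^sub>m to_mat n x" "to_mat n 0 = 0\<^sub>m n n" for x y :: "'a mt" and c
      by (auto simp: to_mat_def intro!: eq_matI)
    show "comm ?I x y \<in> ?Q" if "x \<in> ?Q" "y \<in> ?Q" for x y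
      using that by (simp add: sl_supp_def trace_comm comm_supp[OF trans_sw])
    show "to_mat n (comm ?I x y) = lie_bracket (to_mat n x) (to_mat n y)" for x y :: "'a mt"
      by (rule to_mat_comm)
  qed
qed

section \<open>Symplectic seaweeds as semidirect products\<close>

lemma sp_iff:
  "M \<in> sp n \<longleftrightarrow> M \<in> carrier_mat (2 * n) (2 * n) \<and>
    (\<forall>i<2 * n. \<forall>j<2 * n. M $$ (i, j) =
      (if (i < n) = (j < n) then - (M $$ (2 * n - 1 - j, 2 * n - 1 - i)) else M $$ (2 * n - 1 - j, 2 * n - 1 - i)))"
    (is "_ \<longleftrightarrow> ?R")
proof
  assume "M \<in> sp n"
  then obtain A B C where M: "M = four_block_mat A B C (- antitranspose n A)"
    and A: "A \<in> carrier_mat n n" and B: "B \<in> carrier_mat n n" "B = antitranspose n B"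
    and C: "C \<in> carrier_mat n n" "C = antitranspose n C"
    by (auto simp: sp_def)
  have aA: "antitranspose n A \<in> carrier_mat n n" by (simp add: antitranspose_def)
  have c: "M \<in> carrier_mat (2 * n) (2 * n)" using A aA by (simp add: M mult_2)
  have Bs: "B $$ (i, j) = B $$ (n - 1 - j, n - 1 - i)" if "i < n" "j < n" for i j
    using that B(2) by (metis (no_types, lifting) antitranspose_def index_mat(1) case_prod_conv)
  have Cs: "C $$ (i, j) = C $$ (n - 1 - j, n - 1 - i)" if "i < n" "j < n" for i j
    using that C(2) by (metis (no_types, lifting) antitranspose_def index_mat(1) case_prod_conv)
  have "M $$ (i, j) = (if (i < n) = (j < n) then - (M $$ (2 * n - 1 - j, 2 * n - 1 - i)) else M $$ (2 * n - 1 - j, 2 * n - 1 - i))"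
    if ij: "i < 2 * n" "j < 2 * n" for i j
  proof -
    define i' j' where "i' = 2 * n - 1 - i" and "j' = 2 * n - 1 - j"
    have r: "i' < 2 * n" "j' < 2 * n" "i' < n \<longleftrightarrow> \<not> i < n" "j' < n \<longleftrightarrow> \<not> j < n"
      using ij by (auto simp: i'_def j'_def)
    have r1: "i' - n = n - 1 - i" "n - 1 - (i' - n) = i" if "i < n" using that ij by (auto simp: i'_def)
    have r2: "j' - n = n - 1 - j" "n - 1 - (j' - n) = j" if "j < n" using that ij by (auto simp: j'_def)
    have r3: "n - 1 - (i - n) = i'" "i - n < n" if "\<not> i < n" using that ij by (auto simp: i'_def)
    have r4: "n - 1 - (j - n) = j'" "j - n < n" if "\<not> j < n" using that ij by (auto simp: j'_def)
    have entry: "M $$ (k, l) = (if k < n then if l < n then A $$ (k, l) else B $$ (k, l - n)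
      else if l < n then C $$ (k - n, l) else - (A $$ (n - 1 - (l - n), n - 1 - (k - n))))"
      if "k < 2 * n" "l < 2 * n" for k l
      using that A by (auto simp: M antitranspose_def)
    show ?thesis
      unfolding i'_def[symmetric] j'_def[symmetric] entry[OF ij] entry[OF r(2,1)] r(3,4)
      using r1 r2 r3 r4 Bs[of i "j - n"] Cs[of "i - n" j] ij by (cases "i < n"; cases "j < n") simp_all
  qed
  with c show ?R by blast
next
  assume R: ?R
  then have Mc: "M \<in> carrier_mat (2 * n) (2 * n)" by blast
  have same: "M $$ (i, j) = - (M $$ (2 * n - 1 - j, 2 * n - 1 - i))" if "i < 2 * n" "j < 2 * n" "(i < n) = (j < n)" for i j
    using R that by (metis (no_types, lifting))
  have diff: "M $$ (i, j) = M $$ (2 * n - 1 - j, 2 * n - 1 - i)" if "i < 2 * n" "j < 2 * n" "(i < n) \<noteq> (j < n)" for i j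
    using R that by (metis (no_types, lifting))
  define A where "A = mat n n (\<lambda>(i, j). M $$ (i, j))"
  define B where "B = mat n n (\<lambda>(i, j). M $$ (i, j + n))"
  define C where "C = mat n n (\<lambda>(i, j). M $$ (i + n, j))"
  have "B = antitranspose n B"
  proof (rule eq_matI)
    fix i j assume "i < dim_row (antitranspose n B)" "j < dim_col (antitranspose n B)"
    then have ij: "i < n" "j < n" by (simp_all add: antitranspose_def)
    then have "2 * n - 1 - (j + n) = n - 1 - j" "2 * n - 1 - i = n - 1 - i + n" by auto
    with diff[of i "j + n"] ij show "B $$ (i, j) = antitranspose n B $$ (i, j)"
      by (simp add: antitranspose_def B_def)
  qed (simp_all add: antitranspose_def B_def)
  moreover have "C = antitranspose n C"
  proof (rule eq_matI)
    fix i j assume "i < dim_row (antitranspose n C)" "j < dim_col (antitranspose n C)"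
    then have ij: "i < n" "j < n" by (simp_all add: antitranspose_def)
    then have "2 * n - 1 - (i + n) = n - 1 - i" "2 * n - 1 - j = n - 1 - j + n" by auto
    with diff[of "i + n" j] ij show "C $$ (i, j) = antitranspose n C $$ (i, j)"
      by (simp add: antitranspose_def C_def)
  qed (simp_all add: antitranspose_def C_def)
  moreover have "M = four_block_mat A B C (- antitranspose n A)"
  proof (rule eq_matI)
    fix i j assume "i < dim_row (four_block_mat A B C (- antitranspose n A))" "j < dim_col (four_block_mat A B C (- antitranspose n A))"
    then have ij: "i < 2 * n" "j < 2 * n" by (simp_all add: A_def antitranspose_def)
    show "M $$ (i, j) = four_block_mat A B C (- antitranspose n A) $$ (i, j)"
    proof (cases "i < n \<or> j < n")
      case True
      then show ?thesis using ij by (auto simp: A_def B_def C_def antitranspose_def)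
    next
      case False
      then have "n - 1 - (j - n) = 2 * n - 1 - j" "n - 1 - (i - n) = 2 * n - 1 - i" "j - n < n" "i - n < n" 
        "2 * n - 1 - j < n" "2 * n - 1 - i < n" using ij by auto
      with False ij same[OF ij] show ?thesis by (simp add: A_def antitranspose_def)
    qed
  qed (use Mc in \<open>simp_all add: A_def antitranspose_def\<close>)
  moreover have "A \<in> carrier_mat n n" "B \<in> carrier_mat n n" "C \<in> carrier_mat n n"
    by (simp_all add: A_def B_def C_def)
  ultimately show "M \<in> sp n" unfolding sp_def by blast
qed

lemma seaweed_C_bd:
  assumes "sum_list a \<le> n" "sum_list b \<le> n"
  shows "M \<in> seaweed_C n a b \<longleftrightarrow> M \<in> sp n \<and> (\<forall>i<2 * n. \<forall>j<2 * n. M $$ (i, j) \<noteq> 0 \<longrightarrow>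
    \<not> (\<exists>c\<in>bd (symmetrized n a). j < c \<and> c \<le> i) \<and> \<not> (\<exists>c\<in>bd (symmetrized n b). i < c \<and> c \<le> j))"
  unfolding seaweed_C_def Int_iff seaweed_A_bd[OF sum_symmetrized[OF assms(1)] sum_symmetrized[OF assms(2)]]
  using sp_iff[of M n] by blast

text \<open>
  The block \<open>C\<close> of a symplectic matrix is symmetric with respect to the antidiagonal; reading its
  rows from the bottom makes it a symmetric bilinear form in the usual sense.
\<close>

definition sp_mat :: "nat \<Rightarrow> 'a::field mt \<times> 'a mt \<Rightarrow> 'a mat" where
  "sp_mat n p = mat (2 * n) (2 * n) (\<lambda>(i, j).
     if i < n then (if j < n then fst p i j else 0)
     else (if j < n then snd p (2 * n - 1 - i) j else - fst p (2 * n - 1 - j) (2 * n - 1 - i)))"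

lemma sum_reflect: "(\<Sum>k<2 * n. f k) = (\<Sum>k<n. f k) + (\<Sum>k<n. f (2 * n - 1 - k))" for f :: "nat \<Rightarrow> 'a::comm_monoid_add"
proof -
  have "{..<2 * n} = {..<n} \<union> {n..<2 * n}" by auto
  then have "(\<Sum>k<2 * n. f k) = (\<Sum>k<n. f k) + (\<Sum>k=n..<2 * n. f k)"
    by (simp add: sum.union_disjoint ivl_disj_int)
  also have "(\<Sum>k=n..<2 * n. f k) = (\<Sum>k<n. f (2 * n - 1 - k))"
    by (rule sum.reindex_bij_witness[of _ "\<lambda>k. 2 * n - 1 - k" "\<lambda>k. 2 * n - 1 - k"]) auto
  finally show ?thesis .
qed

text \<open>
  Position \<open>n\<close> is a boundary for \<open>b\<close>, which kills the upper right block; the boundaries of \<open>a\<close> and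
  their mirror images confine the lower left block to the rows and columns of the middle interval of
  \<open>a\<close>, that is, to \<open>L\<close>. In the upper left block appending \<open>k\<close> to \<open>a\<close> adds only the boundary \<open>n\<close>,
  which separates no two indices below \<open>n\<close>.
\<close>

lemma seaweed_C_image:
  assumes k: "1 \<le> k" "k \<le> n" and a: "sum_list a = n - k" and b: "sum_list b = n"
  defines "R \<equiv> sw {..<n} (blk (a @ [k])) (blk b)" and "L \<equiv> {n - k..<n}"
  shows "bij_betw (sp_mat n) (supp R \<times> forms L 1) (seaweed_C n a b :: 'a::field mat set)"
proof -
  let ?Q = "supp R \<times> forms L (1::'a)"
  have bda: "bd (symmetrized n a) = bd a \<union> (\<lambda>c. 2 * n - c) ` bd a" using a by (intro bd_symmetrized) simp
  have bdb: "bd (symmetrized n b) = bd b \<union> (\<lambda>c. 2 * n - c) ` bd b" using b by (intro bd_symmetrized) simp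
  have ale: "c \<le> n - k" if "c \<in> bd a" for c using bd_le[OF that] a by simp
  have ble: "c \<le> n" if "c \<in> bd b" for c using bd_le[OF that] b by simp
  have bak: "bd (a @ [k]) = insert n (bd a)"
    using a k sum_bd[of a] by (auto simp: bd_append bd_Cons)
  have R: "(i, j) \<in> R \<longleftrightarrow> i < n \<and> j < n \<and> \<not> (\<exists>c\<in>bd a. j < c \<and> c \<le> i) \<and> \<not> (\<exists>c\<in>bd b. i < c \<and> c \<le> j)" for i j
  proof -
    have "(i, j) \<in> R \<longleftrightarrow> i < n \<and> j < n \<and> \<not> (\<exists>c\<in>bd (a @ [k]). j < c \<and> c \<le> i) \<and> \<not> (\<exists>c\<in>bd b. i < c \<and> c \<le> j)"
      unfolding R_def sw_def blk_less[symmetric] by (simp add: not_less)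
    then show ?thesis unfolding bak by auto
  qed
  have mem: "M \<in> seaweed_C n a b \<longleftrightarrow> M \<in> sp n \<and> (\<forall>i<2 * n. \<forall>j<2 * n. M $$ (i, j) \<noteq> 0 \<longrightarrow>
      \<not> (\<exists>c\<in>bd (symmetrized n a). j < c \<and> c \<le> i) \<and> \<not> (\<exists>c\<in>bd (symmetrized n b). i < c \<and> c \<le> j))"
    for M :: "'a mat"
    using a b by (intro seaweed_C_bd) simp_all
  have inj: "inj_on (sp_mat n) ?Q"
  proof (rule inj_onI)
    fix p p' assume p: "p \<in> ?Q" and p': "p' \<in> ?Q" and e: "sp_mat n p = sp_mat n p'"
    have e': "sp_mat n p $$ (i, j) = sp_mat n p' $$ (i, j)" for i j using e by simp
    have f: "fst p \<in> supp R" "fst p' \<in> supp R" "snd p \<in> supp (L \<times> L)" "snd p' \<in> supp (L \<times> L)"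
      using p p' by (auto simp: forms_def mem_Times_iff)
    have "fst p i j = fst p' i j" for i j
    proof (cases "i < n \<and> j < n")
      case True
      then show ?thesis using e'[of i j] by (simp add: sp_mat_def)
    next
      case False
      then show ?thesis using supp_zero[OF f(1), of i j] supp_zero[OF f(2), of i j] R[of i j] by metis
    qed
    moreover have "snd p i j = snd p' i j" for i j
    proof (cases "i < n \<and> j < n")
      case True
      then have "2 * n - 1 - (2 * n - 1 - i) = i" "2 * n - 1 - i < 2 * n" "\<not> 2 * n - 1 - i < n" by auto
      with True e'[of "2 * n - 1 - i" j] show ?thesis by (simp add: sp_mat_def)
    next
      case False
      then show ?thesis using supp_zero[OF f(3), of i j] supp_zero[OF f(4), of i j] by (auto simp: L_def)
    qed
    ultimately show "p = p'" by (intro prod_eqI mt_eqI)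
  qed
  have into: "sp_mat n p \<in> seaweed_C n a b" if p: "p \<in> ?Q" for p
  proof -
    define y s where "y = fst p" and "s = snd p"
    have y: "y \<in> supp R" and s: "s \<in> supp (L \<times> L)" and "tp s = mscale 1 s"
      using p by (auto simp: y_def s_def mem_Times_iff forms_def)
    then have sym: "s j i = s i j" for i j using fun_cong[OF fun_cong, of "tp s" "mscale 1 s" i j] by (simp add: tp_def)
    define M where "M = sp_mat n p"
    have Mij: "M $$ (i, j) = (if i < n then (if j < n then y i j else 0)
       else (if j < n then s (2 * n - 1 - i) j else - y (2 * n - 1 - j) (2 * n - 1 - i)))"
      if "i < 2 * n" "j < 2 * n" for i j
      using that by (simp add: M_def sp_mat_def y_def s_def)
    have "M \<in> sp n"
      unfolding sp_iff
    proof (intro conjI allI impI)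
      show "M \<in> carrier_mat (2 * n) (2 * n)" by (simp add: M_def sp_mat_def)
      fix i j assume ij: "i < 2 * n" "j < 2 * n"
      have r: "2 * n - 1 - j < 2 * n" "2 * n - 1 - i < 2 * n" "2 * n - 1 - (2 * n - 1 - i) = i" "2 * n - 1 - (2 * n - 1 - j) = j"
        "2 * n - 1 - j < n \<longleftrightarrow> \<not> j < n" "2 * n - 1 - i < n \<longleftrightarrow> \<not> i < n" using ij by auto
      show "M $$ (i, j) = (if (i < n) = (j < n) then - (M $$ (2 * n - 1 - j, 2 * n - 1 - i)) else M $$ (2 * n - 1 - j, 2 * n - 1 - i))"
        unfolding Mij[OF ij] Mij[OF r(1,2)] r(3-6) using sym by simp
    qed
    moreover have "\<not> (\<exists>c\<in>bd (symmetrized n a). j < c \<and> c \<le> i) \<and> \<not> (\<exists>c\<in>bd (symmetrized n b). i < c \<and> c \<le> j)"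
      if ij: "i < 2 * n" "j < 2 * n" and nz: "M $$ (i, j) \<noteq> 0" for i j
    proof -
      consider "i < n" "j < n" "y i j \<noteq> 0" | "\<not> i < n" "j < n" "s (2 * n - 1 - i) j \<noteq> 0"
        | "\<not> i < n" "\<not> j < n" "y (2 * n - 1 - j) (2 * n - 1 - i) \<noteq> 0"
        using nz unfolding Mij[OF ij] by (auto split: if_splits)
      then show ?thesis
      proof cases
        case 1
        then have "(i, j) \<in> R" using suppD[OF y] by blast
        then have r: "\<not> (\<exists>c\<in>bd a. j < c \<and> c \<le> i)" "\<not> (\<exists>c\<in>bd b. i < c \<and> c \<le> j)" using R by auto
        have "\<not> 2 * n - c \<le> i" if "c \<in> bd a" for c using ale[OF that] 1 k by simp
        moreover have "\<not> 2 * n - c \<le> j" if "c \<in> bd b" for c using ble[OF that] 1 k by simp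
        ultimately show ?thesis using r unfolding bda bdb by blast
      next
        case 2
        then have l: "2 * n - 1 - i \<in> L" "j \<in> L" using suppD[OF s] by auto
        have "\<not> (j < c \<and> c \<le> i)" "\<not> (j < 2 * n - c \<and> 2 * n - c \<le> i)" if "c \<in> bd a" for c
          using ale[OF that] l ij k by (auto simp: L_def)
        then show ?thesis using 2 unfolding bda by auto
      next
        case 3
        then have "(2 * n - 1 - j, 2 * n - 1 - i) \<in> R" using suppD[OF y] by blast
        then have r: "\<not> (\<exists>c\<in>bd a. 2 * n - 1 - i < c \<and> c \<le> 2 * n - 1 - j)"
          "\<not> (\<exists>c\<in>bd b. 2 * n - 1 - j < c \<and> c \<le> 2 * n - 1 - i)" using R by auto
        have "\<not> j < c" if "c \<in> bd a" for c using ale[OF that] 3 by simp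
        moreover have "\<not> (j < 2 * n - c \<and> 2 * n - c \<le> i)" if "c \<in> bd a" for c
        proof
          assume h: "j < 2 * n - c \<and> 2 * n - c \<le> i"
          then have "2 * n - 1 - i < c \<and> c \<le> 2 * n - 1 - j" using ij ale[OF that] k by auto
          with r(1) that show False by blast
        qed
        moreover have "\<not> i < c" if "c \<in> bd b" for c using ble[OF that] 3 by simp
        moreover have "\<not> (i < 2 * n - c \<and> 2 * n - c \<le> j)" if "c \<in> bd b" for c
        proof
          assume h: "i < 2 * n - c \<and> 2 * n - c \<le> j"
          then have "2 * n - 1 - j < c \<and> c \<le> 2 * n - 1 - i" using ij ble[OF that] k by auto
          with r(2) that show False by blast
        qed
        ultimately show ?thesis unfolding bda bdb by blast
      qed
    qed
    ultimately show ?thesis unfolding mem M_def by blast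
  qed
  have onto: "\<exists>p\<in>?Q. M = sp_mat n p" if M: "M \<in> seaweed_C n a b" for M
  proof -
    have Msp: "M \<in> sp n" using M mem by blast
    then have Mc: "M \<in> carrier_mat (2 * n) (2 * n)" and
      rel: "\<And>i j. i < 2 * n \<Longrightarrow> j < 2 * n \<Longrightarrow> M $$ (i, j) =
      (if (i < n) = (j < n) then - (M $$ (2 * n - 1 - j, 2 * n - 1 - i)) else M $$ (2 * n - 1 - j, 2 * n - 1 - i))"
      unfolding sp_iff by blast+
    have zero: "\<not> (\<exists>c\<in>bd (symmetrized n a). j < c \<and> c \<le> i)" "\<not> (\<exists>c\<in>bd (symmetrized n b). i < c \<and> c \<le> j)"
      if "i < 2 * n" "j < 2 * n" "M $$ (i, j) \<noteq> 0" for i j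
      using M that unfolding mem by blast+
    define y where "y i j = (if i < n \<and> j < n then M $$ (i, j) else 0)" for i j
    define s where "s i j = (if i < n \<and> j < n then M $$ (2 * n - 1 - i, j) else 0)" for i j
    have "y \<in> supp R"
    proof (rule suppI)
      fix i j assume nz: "y i j \<noteq> 0"
      then have ij: "i < n" "j < n" "M $$ (i, j) \<noteq> 0" by (auto simp: y_def split: if_splits)
      then show "(i, j) \<in> R" using zero[of i j] unfolding R bda bdb by auto
    qed
    moreover have sym: "s j i = s i j" for i j
    proof (cases "i < n \<and> j < n")
      case True
      then have r: "2 * n - 1 - j < 2 * n" "i < 2 * n" "\<not> 2 * n - 1 - j < n" "2 * n - 1 - (2 * n - 1 - j) = j" by auto
      show ?thesis using rel[OF r(1,2)] True r(3,4) by (simp add: s_def)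
    qed (auto simp: s_def)
    have sL: "j \<in> L" if "s i j \<noteq> 0" for i j
    proof -
      have ij: "i < n" "j < n" "M $$ (2 * n - 1 - i, j) \<noteq> 0" using that by (auto simp: s_def split: if_splits)
      have "n - k \<in> bd (symmetrized n a)" using sum_bd[of a] a unfolding bda by simp
      then have "\<not> (j < n - k \<and> n - k \<le> 2 * n - 1 - i)" using zero(1)[of "2 * n - 1 - i" j] ij by auto
      then show ?thesis using ij k by (auto simp: L_def)
    qed
    have "s \<in> forms L 1"
      unfolding forms_def
    proof (intro CollectI conjI suppI)
      show "(i, j) \<in> L \<times> L" if "s i j \<noteq> 0" for i j using sL[of i j] sL[of j i] sym[of i j] that by simp
      show "tp s = mscale 1 s" using sym by (intro mt_eqI) (simp add: tp_def)
    qed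
    moreover have "M = sp_mat n (y, s)"
    proof (rule eq_matI)
      fix i j assume "i < dim_row (sp_mat n (y, s))" "j < dim_col (sp_mat n (y, s))"
      then have ij: "i < 2 * n" "j < 2 * n" by (simp_all add: sp_mat_def)
      consider "i < n" "j < n" | "i < n" "\<not> j < n" | "\<not> i < n" "j < n" | "\<not> i < n" "\<not> j < n" by blast
      then show "M $$ (i, j) = sp_mat n (y, s) $$ (i, j)"
      proof cases
        case 2
        have "n \<in> bd (symmetrized n b)" using sum_bd[of b] b unfolding bdb by simp
        then have "M $$ (i, j) = 0" using zero(2)[OF ij] 2 by (meson not_less)
        with 2 ij show ?thesis by (simp add: sp_mat_def)
      next
        case 3
        then have "2 * n - 1 - (2 * n - 1 - i) = i" "2 * n - 1 - i < n" using ij by auto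
        with 3 ij show ?thesis by (simp add: sp_mat_def s_def)
      next
        case 4
        then have "2 * n - 1 - i < n" "2 * n - 1 - j < n" using ij by auto
        with 4 ij rel[OF ij] show ?thesis by (simp add: sp_mat_def y_def)
      qed (use ij in \<open>simp add: sp_mat_def y_def\<close>)
    qed (use Mc in \<open>simp_all add: sp_mat_def\<close>)
    ultimately show ?thesis by blast
  qed
  have "sp_mat n ` ?Q = (seaweed_C n a b :: 'a mat set)"
  proof (intro equalityI subsetI)
    fix M :: "'a mat" assume "M \<in> seaweed_C n a b"
    then show "M \<in> sp_mat n ` ?Q" using onto by blast
  qed (use into in blast)
  with inj show ?thesis by (simp add: bij_betw_def)
qed

context
  fixes n k :: nat and a b :: "nat list" and R L
  assumes k: "1 \<le> k" "k \<le> n" and a: "sum_list a = n - k" and b: "sum_list b = n"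
  defines "R \<equiv> sw {..<n} (blk (a @ [k])) (blk b)" and "L \<equiv> {n - k..<n}"
begin

lemma last_block_closed:
  assumes "(i, j) \<in> R" "i \<in> L" shows "j \<in> L"
proof (rule ccontr)
  assume "j \<notin> L"
  then have "j < n - k" using assms by (auto simp: R_def L_def sw_def)
  moreover have "n - k \<in> bd (a @ [k])" using sum_bd[of a] a by (simp add: bd_append)
  ultimately have "blk (a @ [k]) j < blk (a @ [k]) i"
    using assms unfolding blk_less by (intro bexI[of _ "n - k"]) (auto simp: L_def)
  with assms show False by (simp add: R_def sw_def)
qed

text \<open>Rows in \<open>L\<close> of a matrix of the seaweed have their support in \<open>L\<close>.\<close>

lemma form_act_full:
  fixes s z :: "'a::field mt"
  assumes s: "s \<in> supp (L \<times> L)" and z: "z \<in> supp R"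
  shows "form_act L z s i j = (\<Sum>l<n. s i l * z l j) + (\<Sum>l<n. z l i * s l j)"
proof -
  have LI: "L \<subseteq> {..<n}" "finite L" by (auto simp: L_def)
  have zz: "restr L z l m = z l m" if "l \<in> L" for l m
    using that last_block_closed[of l m] supp_zero[OF z, of l m] by (auto simp: restr_def)
  have "(\<Sum>l\<in>L. s i l * restr L z l j) = (\<Sum>l<n. s i l * z l j)"
    using LI zz supp_zero[OF s] by (intro sum.mono_neutral_cong_left) auto
  moreover have "(\<Sum>l\<in>L. restr L z l i * s l j) = (\<Sum>l<n. z l i * s l j)"
    using LI zz supp_zero[OF s] by (intro sum.mono_neutral_cong_left) auto
  ultimately show ?thesis by (simp add: form_act_apply[OF LI(2)])
qed

lemma sp_mat_entries:
  assumes "i < n" "j < n"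
  shows "sp_mat n p $$ (i, j) = fst p i j" "sp_mat n p $$ (i, 2 * n - 1 - j) = 0"
    "sp_mat n p $$ (2 * n - 1 - i, j) = snd p i j" "sp_mat n p $$ (2 * n - 1 - i, 2 * n - 1 - j) = - fst p j i"
proof -
  have e: "2 * n - 1 - i < 2 * n" "2 * n - 1 - j < 2 * n" "\<not> 2 * n - 1 - i < n" "\<not> 2 * n - 1 - j < n"
    "2 * n - 1 - (2 * n - 1 - i) = i" "2 * n - 1 - (2 * n - 1 - j) = j" "i < 2 * n" "j < 2 * n"
    using assms by auto
  show "sp_mat n p $$ (i, j) = fst p i j" "sp_mat n p $$ (i, 2 * n - 1 - j) = 0"
    "sp_mat n p $$ (2 * n - 1 - i, j) = snd p i j" "sp_mat n p $$ (2 * n - 1 - i, 2 * n - 1 - j) = - fst p j i"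
    unfolding sp_mat_def using assms e by simp_all
qed

lemma sp_mat_carrier: "sp_mat n p \<in> carrier_mat (2 * n) (2 * n)"
  by (simp add: sp_mat_def)

lemma half_cases:
  assumes "i < 2 * n" obtains i' where "i' < n" "i = i' \<or> i = 2 * n - 1 - i'"
proof (cases "i < n")
  case True
  then show ?thesis using that by blast
next
  case False
  then have "2 * n - 1 - i < n" "i = 2 * n - 1 - (2 * n - 1 - i)" using assms by auto
  then show ?thesis using that by blast
qed

lemma sp_mat_mult:
  fixes p q :: "'a::field mt \<times> 'a mt"
  assumes "i < n" "j < n"
  shows "(sp_mat n p * sp_mat n q) $$ (i, j) = (\<Sum>l<n. fst p i l * fst q l j)"
    and "(sp_mat n p * sp_mat n q) $$ (i, 2 * n - 1 - j) = 0"
    and "(sp_mat n p * sp_mat n q) $$ (2 * n - 1 - i, j) = (\<Sum>l<n. snd p i l * fst q l j) - (\<Sum>l<n. fst p l i * snd q l j)"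
    and "(sp_mat n p * sp_mat n q) $$ (2 * n - 1 - i, 2 * n - 1 - j) = (\<Sum>l<n. fst q j l * fst p l i)"
proof -
  have m: "(sp_mat n p * sp_mat n q) $$ (r, c) =
     (\<Sum>l<n. sp_mat n p $$ (r, l) * sp_mat n q $$ (l, c)) +
     (\<Sum>l<n. sp_mat n p $$ (r, 2 * n - 1 - l) * sp_mat n q $$ (2 * n - 1 - l, c))"
    if "r < 2 * n" "c < 2 * n" for r c
  proof -
    have "(sp_mat n p * sp_mat n q) $$ (r, c) = (\<Sum>l<2 * n. sp_mat n p $$ (r, l) * sp_mat n q $$ (l, c))"
      using that sp_mat_carrier[of p] sp_mat_carrier[of q] by (simp add: scalar_prod_def atLeast0LessThan)
    then show ?thesis by (simp only: sum_reflect)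
  qed
  have r: "i < 2 * n" "j < 2 * n" "2 * n - 1 - i < 2 * n" "2 * n - 1 - j < 2 * n" using assms by auto
  note en = sp_mat_entries
  show "(sp_mat n p * sp_mat n q) $$ (i, j) = (\<Sum>l<n. fst p i l * fst q l j)"
    unfolding m[OF r(1,2)] using assms by (simp add: en del: One_nat_def diff_diff_left)
  show "(sp_mat n p * sp_mat n q) $$ (i, 2 * n - 1 - j) = 0"
    unfolding m[OF r(1,4)] using assms by (simp add: en del: One_nat_def diff_diff_left)
  show "(sp_mat n p * sp_mat n q) $$ (2 * n - 1 - i, j) = (\<Sum>l<n. snd p i l * fst q l j) - (\<Sum>l<n. fst p l i * snd q l j)"
    unfolding m[OF r(3,2)] using assms by (simp add: en sum_negf del: One_nat_def diff_diff_left)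
  show "(sp_mat n p * sp_mat n q) $$ (2 * n - 1 - i, 2 * n - 1 - j) = (\<Sum>l<n. fst q j l * fst p l i)"
    unfolding m[OF r(3,4)] using assms by (simp add: en del: One_nat_def diff_diff_left) (simp add: mult.commute)
qed

lemma sp_mat_bracket:
  fixes p q :: "'a::field mt \<times> 'a mt"
  assumes p: "p \<in> supp R \<times> forms L 1" and q: "q \<in> supp R \<times> forms L 1"
  shows "sp_mat n (sbr {..<n} (form_act L) p q) = lie_bracket (sp_mat n p) (sp_mat n q)"
proof (rule eq_matI)
  have c: "sp_mat n p * sp_mat n q \<in> carrier_mat (2 * n) (2 * n)" "sp_mat n q * sp_mat n p \<in> carrier_mat (2 * n) (2 * n)"
    using sp_mat_carrier[of p] sp_mat_carrier[of q] by auto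
  fix i j assume "i < dim_row (lie_bracket (sp_mat n p) (sp_mat n q))" "j < dim_col (lie_bracket (sp_mat n p) (sp_mat n q))"
  then have ij: "i < 2 * n" "j < 2 * n"
    using sp_mat_carrier[of p] sp_mat_carrier[of q] by (simp_all add: lie_bracket_def)
  have br: "lie_bracket (sp_mat n p) (sp_mat n q) $$ (i, j) = (sp_mat n p * sp_mat n q) $$ (i, j) - (sp_mat n q * sp_mat n p) $$ (i, j)"
    using c ij by (simp add: lie_bracket_def del: index_mult_mat)
  have f: "fst p \<in> supp R" "fst q \<in> supp R" "snd p \<in> supp (L \<times> L)" "snd q \<in> supp (L \<times> L)"
    using p q by (auto simp: forms_def mem_Times_iff)
  obtain i' where i': "i' < n" "i = i' \<or> i = 2 * n - 1 - i'" by (rule half_cases[OF ij(1)])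
  obtain j' where j': "j' < n" "j = j' \<or> j = 2 * n - 1 - j'" by (rule half_cases[OF ij(2)])
  note mm = sp_mat_mult[OF i'(1) j'(1)]
  note ee = sp_mat_entries[OF i'(1) j'(1)]
  have g: "fst (sbr {..<n} (form_act L) p q) u v = (\<Sum>l<n. fst p u l * fst q l v) - (\<Sum>l<n. fst q u l * fst p l v)" for u v
    by (simp add: sbr_def comm_def mmul_apply)
  have h: "snd (sbr {..<n} (form_act L) p q) u v = (\<Sum>l<n. snd p u l * fst q l v) + (\<Sum>l<n. fst q l u * snd p l v)
     - ((\<Sum>l<n. snd q u l * fst p l v) + (\<Sum>l<n. fst p l u * snd q l v))" for u v
    by (simp add: sbr_def form_act_full[OF f(3,2)] form_act_full[OF f(4,1)])
  consider "i = i'" "j = j'" | "i = i'" "j = 2 * n - 1 - j'" | "i = 2 * n - 1 - i'" "j = j'" | "i = 2 * n - 1 - i'" "j = 2 * n - 1 - j'"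
    using i' j' by blast
  then show "sp_mat n (sbr {..<n} (form_act L) p q) $$ (i, j) = lie_bracket (sp_mat n p) (sp_mat n q) $$ (i, j)"
    unfolding br
  proof cases
    case 1
    show "sp_mat n (sbr {..<n} (form_act L) p q) $$ (i, j) = (sp_mat n p * sp_mat n q) $$ (i, j) - (sp_mat n q * sp_mat n p) $$ (i, j)"
      unfolding 1 ee(1) mm(1) g ..
  next
    case 2
    show "sp_mat n (sbr {..<n} (form_act L) p q) $$ (i, j) = (sp_mat n p * sp_mat n q) $$ (i, j) - (sp_mat n q * sp_mat n p) $$ (i, j)"
      unfolding 2 ee(2) mm(2) by simp
  next
    case 3
    show "sp_mat n (sbr {..<n} (form_act L) p q) $$ (i, j) = (sp_mat n p * sp_mat n q) $$ (i, j) - (sp_mat n q * sp_mat n p) $$ (i, j)"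
      unfolding 3 ee(3) mm(3) h by (simp add: algebra_simps)
  next
    case 4
    show "sp_mat n (sbr {..<n} (form_act L) p q) $$ (i, j) = (sp_mat n p * sp_mat n q) $$ (i, j) - (sp_mat n q * sp_mat n p) $$ (i, j)"
      unfolding 4 ee(4) mm(4) g by simp
  qed
qed (use sp_mat_carrier[of p] sp_mat_carrier[of q] sp_mat_carrier[of "sbr {..<n} (form_act L) p q"] in \<open>simp_all add: lie_bracket_def\<close>)

definition sym_part :: "'a::field mt \<Rightarrow> 'a mt" where
  "sym_part s = (\<lambda>i j. if i \<in> L \<and> j \<in> L then (s i j + s j i) / 2 else 0)"

text \<open>
  The isomorphism \<open>\<Psi>\<close> is either the identity or the negative transpose, which treats both orders of
  the compositions at once.
\<close>

lemma transport_C: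
  fixes q :: "'a::field mat set" and \<Psi> :: "'a mat \<Rightarrow> 'a mat"
  assumes two: "(2::'a) \<noteq> 0"
    and \<Psi>: "bij_betw \<Psi> (seaweed_C n a b) q" "q \<subseteq> carrier_mat (2 * n) (2 * n)"
      "\<And>x y. x \<in> carrier_mat (2 * n) (2 * n) \<Longrightarrow> y \<in> carrier_mat (2 * n) (2 * n) \<Longrightarrow> \<Psi> (x + y) = \<Psi> x + \<Psi> y"
      "\<And>c x. x \<in> carrier_mat (2 * n) (2 * n) \<Longrightarrow> \<Psi> (c \<cdot>\<^sub>m x) = c \<cdot>\<^sub>m \<Psi> x"
      "\<And>x y. x \<in> carrier_mat (2 * n) (2 * n) \<Longrightarrow> y \<in> carrier_mat (2 * n) (2 * n) \<Longrightarrow>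
         \<Psi> (lie_bracket x y) = lie_bracket (\<Psi> x) (\<Psi> y)"
      "\<Psi> (0\<^sub>m (2 * n) (2 * n)) = 0\<^sub>m (2 * n) (2 * n)"
  shows "frobenius (2 * n) q \<longleftrightarrow> frob {..<n} R (form_act L) (forms L (1::'a))"
proof -
  let ?Q = "supp R \<times> forms L (1::'a)"
  interpret local_action "form_act L" L "forms L (1::'a)" by (rule local_action_forms) (simp add: L_def)
  have img: "bij_betw (sp_mat n) ?Q (seaweed_C n a b :: 'a mat set)"
    unfolding R_def L_def by (rule seaweed_C_image[OF k a b])
  define Pr where "Pr p = (cut R (fst p), sym_part (snd p))" for p :: "'a mt \<times> 'a mt"
  note C = sp_mat_carrier
  show ?thesis
    unfolding frob_def
  proof (rule frobenius_transport[OF vector_space_pscale subspace_prod \<Psi>(2), where \<Phi> = "\<lambda>p. \<Psi> (sp_mat n p)" and Pr = Pr])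
    show "bij_betw (\<lambda>p. \<Psi> (sp_mat n p)) ?Q q"
      using bij_betw_trans[OF img \<Psi>(1)] by (simp add: comp_def)
    show "Pr p \<in> ?Q" for p
    proof -
      have "sym_part (snd p) \<in> forms L 1"
        by (auto simp: forms_def supp_def tp_def sym_part_def add.commute intro!: mt_eqI split: if_splits)
      then show ?thesis by (simp add: Pr_def cut_supp)
    qed
    show "Pr p = p" if "p \<in> ?Q" for p
    proof -
      have s: "snd p \<in> supp (L \<times> L)" "tp (snd p) = mscale 1 (snd p)" "fst p \<in> supp R"
        using that by (auto simp: forms_def mem_Times_iff)
      have "snd p j i = snd p i j" for i j using fun_cong[OF fun_cong[OF s(2), of i], of j] by (simp add: tp_def)
      moreover have "snd p i j = 0" if "\<not> (i \<in> L \<and> j \<in> L)" for i j using supp_zero[OF s(1), of i j] that by auto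
      ultimately have "sym_part (snd p) = snd p"
        using two by (intro mt_eqI) (auto simp: sym_part_def mult_2[symmetric])
      then show ?thesis by (simp add: Pr_def cut_id[OF s(3)])
    qed
    have sa: "sym_part (s + t) = sym_part s + sym_part t" for s t :: "'a mt"
      by (intro mt_eqI) (simp add: sym_part_def add_divide_distrib)
    have ss: "sym_part (mscale c s) = mscale c (sym_part s)" for s :: "'a mt" and c
      by (intro mt_eqI) (simp add: sym_part_def distrib_left add_divide_distrib)
    show "Pr (p + p') = Pr p + Pr p'" for p p' by (simp add: Pr_def cut_add sa)
    show "Pr (pscale c p) = pscale c (Pr p)" for c p by (simp add: Pr_def cut_scale ss pscale_def)
    have add: "sp_mat n (p + p') = sp_mat n p + sp_mat n p'" for p p' :: "'a mt \<times> 'a mt"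
      by (intro eq_matI) (auto simp: sp_mat_def)
    have scale: "sp_mat n (pscale c p) = c \<cdot>\<^sub>m sp_mat n p" for p :: "'a mt \<times> 'a mt" and c
      by (intro eq_matI) (auto simp: sp_mat_def pscale_def)
    have zero: "sp_mat n (0 :: 'a mt \<times> 'a mt) = 0\<^sub>m (2 * n) (2 * n)"
      by (intro eq_matI) (auto simp: sp_mat_def)
    show "\<Psi> (sp_mat n (p + p')) = \<Psi> (sp_mat n p) + \<Psi> (sp_mat n p')" for p p'
      unfolding add by (rule \<Psi>(3)[OF C C])
    show "\<Psi> (sp_mat n (pscale c p)) = c \<cdot>\<^sub>m \<Psi> (sp_mat n p)" for c p
      unfolding scale by (rule \<Psi>(4)[OF C])
    show "\<Psi> (sp_mat n 0) = 0\<^sub>m (2 * n) (2 * n)" unfolding zero by (rule \<Psi>(6))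
    show "\<Psi> (sp_mat n (sbr {..<n} (form_act L) p p')) = lie_bracket (\<Psi> (sp_mat n p)) (\<Psi> (sp_mat n p'))"
      if "p \<in> ?Q" "p' \<in> ?Q" for p p'
      unfolding sp_mat_bracket[OF that] by (rule \<Psi>(5)[OF C C])
    show "sbr {..<n} (form_act L) p p' \<in> ?Q" if "p \<in> ?Q" "p' \<in> ?Q" for p p'
    proof -
      have "comm {..<n} (fst p) (fst p') \<in> supp R"
        unfolding R_def using that by (intro comm_supp trans_sw) (auto simp: R_def mem_Times_iff)
      moreover have "form_act L (fst p') (snd p) - form_act L (fst p) (snd p') \<in> forms L 1"
        using that by (intro M.subspace_diff S_subspace form_act_forms) (auto simp: mem_Times_iff)
      ultimately show ?thesis by (simp add: sbr_def)
    qed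
  qed
qed

end

section \<open>The negative transpose\<close>

text \<open>
  An automorphism of the symplectic algebra that exchanges the two compositions of a seaweed.
\<close>

definition neg_tp :: "'a::field mat \<Rightarrow> 'a mat" where
  "neg_tp M = - transpose_mat M"

lemma neg_tp_neg_tp: "M \<in> carrier_mat m m \<Longrightarrow> neg_tp (neg_tp M) = M"
  by (intro eq_matI) (auto simp: neg_tp_def)

lemma neg_tp_sp:
  fixes M :: "'a::field mat"
  assumes M: "M \<in> sp n" shows "neg_tp M \<in> sp n"
  unfolding sp_iff
proof (intro conjI allI impI)
  have c: "M \<in> carrier_mat (2 * n) (2 * n)" using M sp_iff by blast
  then show "neg_tp M \<in> carrier_mat (2 * n) (2 * n)" by (simp add: neg_tp_def)
  fix i j assume ij: "i < 2 * n" "j < 2 * n"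
  define i' j' where "i' = 2 * n - 1 - i" and "j' = 2 * n - 1 - j"
  have r: "i' < 2 * n" "j' < 2 * n" using ij by (auto simp: i'_def j'_def)
  have "M $$ (j, i) = (if (j < n) = (i < n) then - (M $$ (i', j')) else M $$ (i', j'))"
    using M ij unfolding sp_iff i'_def j'_def by blast
  then show "neg_tp M $$ (i, j) = (if (i < n) = (j < n) then - (neg_tp M $$ (2 * n - 1 - j, 2 * n - 1 - i)) else neg_tp M $$ (2 * n - 1 - j, 2 * n - 1 - i))"
    unfolding i'_def[symmetric] j'_def[symmetric] using c ij r by (auto simp: neg_tp_def)
qed

lemma neg_tp_seaweed_C:
  assumes "sum_list a \<le> n" "sum_list b \<le> n" and M: "M \<in> seaweed_C n a b"
  shows "neg_tp M \<in> seaweed_C n b a"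
proof -
  have sp: "M \<in> sp n" and z: "\<And>i j. i < 2 * n \<Longrightarrow> j < 2 * n \<Longrightarrow> M $$ (i, j) \<noteq> 0 \<Longrightarrow>
    \<not> (\<exists>c\<in>bd (symmetrized n a). j < c \<and> c \<le> i) \<and> \<not> (\<exists>c\<in>bd (symmetrized n b). i < c \<and> c \<le> j)"
    using M unfolding seaweed_C_bd[OF assms(1,2)] by blast+
  have c: "M \<in> carrier_mat (2 * n) (2 * n)" using sp sp_iff by blast
  have e: "neg_tp M $$ (i, j) = - (M $$ (j, i))" if "i < 2 * n" "j < 2 * n" for i j
    using c that by (simp add: neg_tp_def)
  show ?thesis
    unfolding seaweed_C_bd[OF assms(2,1)]
  proof (intro conjI allI impI)
    fix i j assume ij: "i < 2 * n" "j < 2 * n" "neg_tp M $$ (i, j) \<noteq> 0"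
    then have "M $$ (j, i) \<noteq> 0" using e by simp
    from z[OF ij(2,1) this] show "\<not> (\<exists>c\<in>bd (symmetrized n b). j < c \<and> c \<le> i)" "\<not> (\<exists>c\<in>bd (symmetrized n a). i < c \<and> c \<le> j)"
      by blast+
  qed (rule neg_tp_sp[OF sp])
qed

lemma bij_neg_tp:
  assumes "sum_list a \<le> n" "sum_list b \<le> n"
  shows "bij_betw neg_tp (seaweed_C n a b) (seaweed_C n b a :: 'a::field mat set)"
proof (rule bij_betw_byWitness[where f' = neg_tp])
  have "M \<in> carrier_mat (2 * n) (2 * n)" if "M \<in> seaweed_C n a b \<or> M \<in> seaweed_C n b a" for M :: "'a mat"
    using that sp_iff[of M n] unfolding seaweed_C_def by blast
  then show "\<forall>M\<in>seaweed_C n a b. neg_tp (neg_tp M) = (M :: 'a mat)" "\<forall>M\<in>seaweed_C n b a. neg_tp (neg_tp M) = (M :: 'a mat)"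
    using neg_tp_neg_tp by blast+
qed (use neg_tp_seaweed_C[OF assms] neg_tp_seaweed_C[OF assms(2,1)] in auto)

section \<open>Frobenius seaweeds of symplectic and special linear algebras\<close>

text \<open>
  The second part is what makes the property one of the unordered pair of compositions.
\<close>

lemma frobenius_sp_seaweed_iff:
  assumes k: "1 \<le> k" "k \<le> n" and a: "sum_list a = n - k" and b: "sum_list b = n" and two: "(2::'a::field) \<noteq> 0"
  shows "frobenius (2 * n) (seaweed_C n a b :: 'a mat set) \<longleftrightarrow>
      frob {..<n} (sw {..<n} (blk (a @ [k])) (blk b)) (form_act {n - k..<n}) (forms {n - k..<n} (1::'a))"
    and "frobenius (2 * n) (seaweed_C n b a :: 'a mat set) \<longleftrightarrow> frobenius (2 * n) (seaweed_C n a b :: 'a mat set)"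
proof -
  have c: "(seaweed_C n a b :: 'a mat set) \<subseteq> carrier_mat (2 * n) (2 * n)" "(seaweed_C n b a :: 'a mat set) \<subseteq> carrier_mat (2 * n) (2 * n)"
    unfolding seaweed_C_def using sp_iff[of _ n, where 'a = 'a] by blast+
  show 1: "frobenius (2 * n) (seaweed_C n a b :: 'a mat set) \<longleftrightarrow>
      frob {..<n} (sw {..<n} (blk (a @ [k])) (blk b)) (form_act {n - k..<n}) (forms {n - k..<n} (1::'a))"
    by (rule transport_C[OF k a b two, where \<Psi> = "\<lambda>x. x"]) (use c in \<open>auto simp: bij_betw_def\<close>)
  have "frobenius (2 * n) (seaweed_C n b a :: 'a mat set) \<longleftrightarrow>
      frob {..<n} (sw {..<n} (blk (a @ [k])) (blk b)) (form_act {n - k..<n}) (forms {n - k..<n} (1::'a))"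
  proof (rule transport_C[OF k a b two, where \<Psi> = neg_tp])
    show "bij_betw neg_tp (seaweed_C n a b) (seaweed_C n b a :: 'a mat set)"
      using a b by (intro bij_neg_tp) simp_all
    fix x y :: "'a mat" assume x: "x \<in> carrier_mat (2 * n) (2 * n)"
    show "neg_tp (c \<cdot>\<^sub>m x) = c \<cdot>\<^sub>m neg_tp x" for c using x by (intro eq_matI) (auto simp: neg_tp_def)
    assume y: "y \<in> carrier_mat (2 * n) (2 * n)"
    show "neg_tp (x + y) = neg_tp x + neg_tp y" using x y by (intro eq_matI) (auto simp: neg_tp_def)
    show "neg_tp (lie_bracket x y) = lie_bracket (neg_tp x) (neg_tp y)"
      using x y
      by (intro eq_matI) (auto simp: neg_tp_def lie_bracket_def scalar_prod_def mult.commute intro!: sum.cong)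
  next
    show "neg_tp (0\<^sub>m (2 * n) (2 * n)) = (0\<^sub>m (2 * n) (2 * n) :: 'a mat)" by (intro eq_matI) (auto simp: neg_tp_def)
  qed (rule c)
  with 1 show "frobenius (2 * n) (seaweed_C n b a :: 'a mat set) \<longleftrightarrow> frobenius (2 * n) (seaweed_C n a b :: 'a mat set)"
    by simp
qed

lemma frobenius_C_iff_A_1:
  assumes n: "1 \<le> n" and a: "sum_list a = n - 1" and b: "sum_list b = n"
  shows "frobenius (2 * n) (seaweed_C n a b :: 'a::field_char_0 mat set) \<longleftrightarrow>
    frobenius n (seaweed_A n (a @ [1]) b \<inter> sl n :: 'a mat set)"
proof -
  have L: "{n - 1..<n} = {n - 1}" using n by auto
  have s: "sum_list (a @ [1]) = n" using a n by simp
  have two: "(2::'a) \<noteq> 0" by simp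
  have "frob {..<n} (sw {..<n} (blk (a @ [1])) (blk b)) (form_act {n - 1}) (forms {n - 1} (1::'a)) \<longleftrightarrow>
    frob_sl {..<n} (sw {..<n} (blk (a @ [1])) (blk b)) TYPE('a)"
    using n by (intro frob_sym_line_iff) (auto simp: sw_def)
  also have "\<dots> \<longleftrightarrow> frobenius n (seaweed_A n (a @ [1]) b \<inter> sl n :: 'a mat set)"
    using n by (intro frobenius_sl_seaweed_iff[OF s b, symmetric]) auto
  finally show ?thesis unfolding frobenius_sp_seaweed_iff(1)[OF order_refl n a b two] L .
qed

lemma frobenius_C_iff_A_2:
  assumes n: "2 \<le> n" and a: "sum_list a = n - 2" and b: "sum_list b = n"
  shows "frobenius (2 * n) (seaweed_C n a b :: 'a::field_char_0 mat set) \<longleftrightarrow>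
    frobenius n (seaweed_A n (a @ [2]) b \<inter> sl n :: 'a mat set)"
proof -
  let ?L = "{n - 2..<n}"
  let ?R = "sw {..<n} (blk (a @ [2])) (blk b)"
  have L: "?L = {n - 2, n - 1}" "n - 2 \<noteq> n - 1" using n by auto
  have s: "sum_list (a @ [2]) = n" using a n by simp
  have bda: "bd (a @ [2]) = insert n (bd a)" using a n sum_bd[of a] by (auto simp: bd_append bd_Cons)
  have top: "?L = {i \<in> {..<n}. \<forall>j\<in>{..<n}. blk (a @ [2]) j \<le> blk (a @ [2]) i}"
  proof (intro equalityI subsetI CollectI conjI ballI)
    fix i j assume i: "i \<in> ?L" and j: "j \<in> {..<n}"
    have "\<not> (\<exists>c\<in>bd (a @ [2]). i < c \<and> c \<le> j)" using i j bd_le[of _ a] a unfolding bda by fastforce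
    then show "blk (a @ [2]) j \<le> blk (a @ [2]) i" unfolding blk_less[symmetric] by simp
  next
    fix i assume i: "i \<in> {i \<in> {..<n}. \<forall>j\<in>{..<n}. blk (a @ [2]) j \<le> blk (a @ [2]) i}"
    show "i \<in> ?L"
    proof (rule ccontr)
      assume "i \<notin> ?L"
      then have "i < n - 2" using i by auto
      moreover have "n - 2 \<in> bd (a @ [2])" using sum_bd[of a] a unfolding bda by simp
      ultimately have "blk (a @ [2]) i < blk (a @ [2]) (n - 1)"
        unfolding blk_less using n by (intro bexI[of _ "n - 2"]) auto
      moreover have "blk (a @ [2]) (n - 1) \<le> blk (a @ [2]) i" using i n by auto
      ultimately show False by simp
    qed
  qed auto
  have inf: "infinite (UNIV :: 'a set)" by (rule infinite_UNIV_char_0)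
  have two: "(2::'a) \<noteq> 0" by simp
  have "card ?L = 2" using n by simp
  from frob_sym_iff_alt[OF inf two _ mono_blk mono_blk top this]
  have "frob {..<n} ?R (form_act ?L) (forms ?L (1::'a)) \<longleftrightarrow> frob {..<n} ?R (form_act ?L) (forms ?L (- 1 :: 'a))"
    by simp
  also have "\<dots> \<longleftrightarrow> frob_sl {..<n} ?R TYPE('a)"
    unfolding L(1) using n by (intro frob_alt_plane_iff) (auto simp: sw_def)
  also have "\<dots> \<longleftrightarrow> frobenius n (seaweed_A n (a @ [2]) b \<inter> sl n :: 'a mat set)"
    using n by (intro frobenius_sl_seaweed_iff[OF s b, symmetric]) auto
  finally show ?thesis using frobenius_sp_seaweed_iff(1)[OF _ n a b two] by simp
qed

section \<open>Seaweeds with a middle block on both sides\<close>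

text \<open>
  With the signs \<open>\<sigma>\<close> and the reflection \<open>r\<close> of indices the symplectic condition reads \<open>X i j = - \<sigma> i
  \<sigma> j X (r j) (r i)\<close>: the matrix is the negative of its adjoint, and taking adjoints reverses
  products.
\<close>

lemma sp_bracket:
  fixes M N :: "'a::field mat"
  assumes M: "M \<in> sp n" and N: "N \<in> sp n" shows "lie_bracket M N \<in> sp n"
proof -
  define \<sigma> :: "nat \<Rightarrow> 'a" where "\<sigma> i = (if i < n then 1 else - 1)" for i
  define r where "r i = 2 * n - 1 - i" for i
  have ss: "\<sigma> k * \<sigma> k = 1" for k by (simp add: \<sigma>_def)
  have rr: "r i < 2 * n" "r (r i) = i" if "i < 2 * n" for i using that by (auto simp: r_def)
  have crit: "X \<in> sp n \<longleftrightarrow> X \<in> carrier_mat (2 * n) (2 * n) \<and>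
      (\<forall>i<2 * n. \<forall>j<2 * n. X $$ (i, j) = - (\<sigma> i * \<sigma> j * X $$ (r j, r i)))" for X
  proof -
    have "(if (i < n) = (j < n) then - (X $$ (r j, r i)) else X $$ (r j, r i)) = - (\<sigma> i * \<sigma> j * X $$ (r j, r i))" for i j
      by (simp add: \<sigma>_def)
    then show ?thesis unfolding sp_iff r_def[symmetric] by simp
  qed
  have c: "M \<in> carrier_mat (2 * n) (2 * n)" "N \<in> carrier_mat (2 * n) (2 * n)" using M N crit by blast+
  have prod: "(X * Y) $$ (i, j) = \<sigma> i * \<sigma> j * (Y * X) $$ (r j, r i)"
    if X: "X \<in> sp n" and Y: "Y \<in> sp n" and ij: "i < 2 * n" "j < 2 * n" for X Y i j
  proof -
    have cc: "X \<in> carrier_mat (2 * n) (2 * n)" "Y \<in> carrier_mat (2 * n) (2 * n)" using X Y crit by blast+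
    have x: "X $$ (i, k) = - (\<sigma> i * \<sigma> k * X $$ (r k, r i))" if "k < 2 * n" for k using X ij that unfolding crit by blast
    have y: "Y $$ (k, j) = - (\<sigma> k * \<sigma> j * Y $$ (r j, r k))" if "k < 2 * n" for k using Y ij that unfolding crit by blast
    have "(X * Y) $$ (i, j) = (\<Sum>k<2 * n. X $$ (i, k) * Y $$ (k, j))"
      using cc ij by (simp add: scalar_prod_def atLeast0LessThan)
    also have "\<dots> = (\<Sum>k<2 * n. \<sigma> i * \<sigma> j * (Y $$ (r j, r k) * X $$ (r k, r i)))"
    proof (rule sum.cong[OF refl])
      fix k assume "k \<in> {..<2 * n}"
      then have "X $$ (i, k) * Y $$ (k, j) = (\<sigma> k * \<sigma> k) * (\<sigma> i * \<sigma> j * (Y $$ (r j, r k) * X $$ (r k, r i)))"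
        using x[of k] y[of k] by simp
      then show "X $$ (i, k) * Y $$ (k, j) = \<sigma> i * \<sigma> j * (Y $$ (r j, r k) * X $$ (r k, r i))" unfolding ss by simp
    qed
    also have "\<dots> = (\<Sum>k<2 * n. \<sigma> i * \<sigma> j * (Y $$ (r j, k) * X $$ (k, r i)))"
      by (rule sum.reindex_bij_witness[of _ r r]) (use rr in auto)
    also have "\<dots> = \<sigma> i * \<sigma> j * (Y * X) $$ (r j, r i)"
      using cc rr(1)[OF ij(1)] rr(1)[OF ij(2)] by (simp add: scalar_prod_def atLeast0LessThan sum_distrib_left)
    finally show ?thesis .
  qed
  have d: "M * N \<in> carrier_mat (2 * n) (2 * n)" "N * M \<in> carrier_mat (2 * n) (2 * n)" using c by auto
  have br: "lie_bracket M N $$ (i, j) = (M * N) $$ (i, j) - (N * M) $$ (i, j)" if "i < 2 * n" "j < 2 * n" for i j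
    using d that by (simp add: lie_bracket_def del: index_mult_mat)
  show ?thesis
    unfolding crit
  proof (intro conjI allI impI)
    show "lie_bracket M N \<in> carrier_mat (2 * n) (2 * n)" unfolding lie_bracket_def by (rule minus_carrier_mat[OF d(2)])
    fix i j assume ij: "i < 2 * n" "j < 2 * n"
    show "lie_bracket M N $$ (i, j) = - (\<sigma> i * \<sigma> j * lie_bracket M N $$ (r j, r i))"
      unfolding br[OF ij] br[OF rr(1)[OF ij(2)] rr(1)[OF ij(1)]] prod[OF M N ij] prod[OF N M ij]
      by (simp add: algebra_simps)
  qed
qed

lemma seaweed_C_subalgebra:
  assumes "sum_list a \<le> n" "sum_list b \<le> n"
  shows "mat_subalgebra (2 * n) (seaweed_C n a b :: 'a::field mat set)"
proof -
  let ?q = "seaweed_C n a b :: 'a mat set"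
  let ?P = "\<lambda>i j. \<not> (\<exists>c\<in>bd (symmetrized n a). j < c \<and> c \<le> i) \<and> \<not> (\<exists>c\<in>bd (symmetrized n b). i < c \<and> c \<le> j)"
  note iff = seaweed_C_bd[OF assms]
  have c: "M \<in> carrier_mat (2 * n) (2 * n)" if "M \<in> ?q" for M using that unfolding iff sp_iff by blast
  have P: "?P i j" if "M \<in> ?q" "i < 2 * n" "j < 2 * n" "M $$ (i, j) \<noteq> 0" for M i j using that unfolding iff by blast
  have Ptrans: "?P i j" if "?P i k" "?P k j" for i j k
    using that unfolding blk_less[symmetric] by (simp add: not_less)
  have sp: "M \<in> sp n" if "M \<in> ?q" for M using that unfolding iff by blast
  have prod: "?P i j" if "M \<in> ?q" "N \<in> ?q" "i < 2 * n" "j < 2 * n" "(M * N) $$ (i, j) \<noteq> 0" for M N i j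
  proof -
    have "(M * N) $$ (i, j) = (\<Sum>k<2 * n. M $$ (i, k) * N $$ (k, j))"
      using c[OF that(1)] c[OF that(2)] that(3,4) by (simp add: scalar_prod_def atLeast0LessThan)
    with that(5) obtain k where "k < 2 * n" "M $$ (i, k) * N $$ (k, j) \<noteq> 0"
      by (metis (no_types, lifting) lessThan_iff sum.neutral)
    then have "?P i k" "?P k j" using P[OF that(1) that(3), of k] P[OF that(2) _ that(4), of k] by auto
    then show ?thesis by (rule Ptrans)
  qed
  show ?thesis
    unfolding mat_subalgebra_def
  proof (intro conjI ballI allI subsetI)
    show "M \<in> carrier_mat (2 * n) (2 * n)" if "M \<in> ?q" for M using c[OF that] .
    show "0\<^sub>m (2 * n) (2 * n) \<in> ?q" unfolding iff sp_iff by auto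
    fix M N :: "'a mat" assume M: "M \<in> ?q" 
    show "s \<cdot>\<^sub>m M \<in> ?q" for s
      unfolding iff
    proof (intro conjI allI impI)
      have "s \<cdot>\<^sub>m M \<in> carrier_mat (2 * n) (2 * n)" using c[OF M] by simp
      moreover have "(s \<cdot>\<^sub>m M) $$ (i, j) = (if (i < n) = (j < n) then - ((s \<cdot>\<^sub>m M) $$ (2 * n - 1 - j, 2 * n - 1 - i)) else (s \<cdot>\<^sub>m M) $$ (2 * n - 1 - j, 2 * n - 1 - i))"
        if ij: "i < 2 * n" "j < 2 * n" for i j
      proof -
        have "2 * n - 1 - i < 2 * n" "2 * n - 1 - j < 2 * n" using ij by auto
        moreover have "M $$ (i, j) = (if (i < n) = (j < n) then - (M $$ (2 * n - 1 - j, 2 * n - 1 - i)) else M $$ (2 * n - 1 - j, 2 * n - 1 - i))"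
          using sp[OF M] ij unfolding sp_iff by blast
        ultimately show ?thesis using ij c[OF M] by simp
      qed
      ultimately show "s \<cdot>\<^sub>m M \<in> sp n" unfolding sp_iff by blast
    next
      fix i j assume ij: "i < 2 * n" "j < 2 * n" "(s \<cdot>\<^sub>m M) $$ (i, j) \<noteq> 0"
      then have "M $$ (i, j) \<noteq> 0" using c[OF M] by auto
      from P[OF M ij(1,2) this] show "\<not> (\<exists>c\<in>bd (symmetrized n a). j < c \<and> c \<le> i)" "\<not> (\<exists>c\<in>bd (symmetrized n b). i < c \<and> c \<le> j)" by blast+
    qed
    assume N: "N \<in> ?q"
    show "M + N \<in> ?q"
      unfolding iff
    proof (intro conjI allI impI)
      have "M + N \<in> carrier_mat (2 * n) (2 * n)" using c[OF M] c[OF N] by simp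
      moreover have "(M + N) $$ (i, j) = (if (i < n) = (j < n) then - ((M + N) $$ (2 * n - 1 - j, 2 * n - 1 - i)) else (M + N) $$ (2 * n - 1 - j, 2 * n - 1 - i))"
        if ij: "i < 2 * n" "j < 2 * n" for i j
      proof -
        have "2 * n - 1 - i < 2 * n" "2 * n - 1 - j < 2 * n" using ij by auto
        moreover have "M $$ (i, j) = (if (i < n) = (j < n) then - (M $$ (2 * n - 1 - j, 2 * n - 1 - i)) else M $$ (2 * n - 1 - j, 2 * n - 1 - i))"
          using sp[OF M] ij unfolding sp_iff by blast
        moreover have "N $$ (i, j) = (if (i < n) = (j < n) then - (N $$ (2 * n - 1 - j, 2 * n - 1 - i)) else N $$ (2 * n - 1 - j, 2 * n - 1 - i))"
          using sp[OF N] ij unfolding sp_iff by blast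
        ultimately show ?thesis using ij c[OF M] c[OF N] by simp
      qed
      ultimately show "M + N \<in> sp n" unfolding sp_iff by blast
    next
      fix i j assume ij: "i < 2 * n" "j < 2 * n" "(M + N) $$ (i, j) \<noteq> 0"
      then have "M $$ (i, j) \<noteq> 0 \<or> N $$ (i, j) \<noteq> 0" using c[OF M] c[OF N] by auto
      then have "?P i j" using P[OF M ij(1,2)] P[OF N ij(1,2)] by blast
      then show "\<not> (\<exists>c\<in>bd (symmetrized n a). j < c \<and> c \<le> i)" "\<not> (\<exists>c\<in>bd (symmetrized n b). i < c \<and> c \<le> j)" by blast+
    qed
    show "lie_bracket M N \<in> ?q"
      unfolding iff
    proof (intro conjI allI impI)
      show "lie_bracket M N \<in> sp n" by (rule sp_bracket[OF sp[OF M] sp[OF N]])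
      fix i j assume ij: "i < 2 * n" "j < 2 * n" "lie_bracket M N $$ (i, j) \<noteq> 0"
      have d: "M * N \<in> carrier_mat (2 * n) (2 * n)" "N * M \<in> carrier_mat (2 * n) (2 * n)" using c[OF M] c[OF N] by auto
      have "lie_bracket M N $$ (i, j) = (M * N) $$ (i, j) - (N * M) $$ (i, j)"
        using d ij(1,2) by (simp add: lie_bracket_def del: index_mult_mat)
      then have "(M * N) $$ (i, j) \<noteq> 0 \<or> (N * M) $$ (i, j) \<noteq> 0" using ij(3) by auto
      then have "?P i j" using prod[OF M N ij(1,2)] prod[OF N M ij(1,2)] by blast
      then show "\<not> (\<exists>c\<in>bd (symmetrized n a). j < c \<and> c \<le> i)" "\<not> (\<exists>c\<in>bd (symmetrized n b). i < c \<and> c \<le> j)" by blast+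
    qed
  qed
qed

text \<open>
  Both compositions leave the middle block \<open>{n - 1, n}\<close>, so the matrices \<open>X c1 c2 c3\<close> supported
  there form a copy of \<open>sl 2\<close>, and an element \<open>y\<close> of the seaweed acts on it through its own middle
  block. The algebra \<open>sl 2\<close> has dimension three, so no functional on it has trivial stabilizer.
\<close>

lemma not_frobenius_middle:
  assumes n: "1 \<le> n" and a: "sum_list a = n - 1" and b: "sum_list b = n - 1" and two: "(2::'a::field) \<noteq> 0"
  shows "\<not> frobenius (2 * n) (seaweed_C n a b :: 'a mat set)"
proof
  let ?q = "seaweed_C n a b :: 'a mat set"
  define u v where "u = n - 1" and "v = n"
  have uv: "u < v" "v < 2 * n" "u < 2 * n" "u < n" "\<not> v < n" "2 * n - 1 - u = v" "2 * n - 1 - v = u" "Suc u = v" "u \<noteq> v" "v \<noteq> u"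
    using n by (auto simp: u_def v_def)
  have ab: "sum_list a \<le> n" "sum_list b \<le> n" using a b by simp_all
  note iff = seaweed_C_bd[OF ab]
  have bdm: "c \<le> u \<or> v < c" "u \<in> bd (symmetrized n e)" "v + 1 \<in> bd (symmetrized n e)"
    if "c \<in> bd (symmetrized n e)" "sum_list e = n - 1" for c e
  proof -
    have s: "bd (symmetrized n e) = bd e \<union> (\<lambda>c. 2 * n - c) ` bd e" using that(2) by (intro bd_symmetrized) simp
    have le: "c \<le> n - 1" if "c \<in> bd e" for c using bd_le[OF that] \<open>sum_list e = n - 1\<close> by simp
    have "n - 1 \<in> bd e" using sum_bd[of e] that(2) by simp
    then show "u \<in> bd (symmetrized n e)" "v + 1 \<in> bd (symmetrized n e)"
      unfolding s using n by (auto simp: u_def v_def intro: image_eqI[of _ _ "n - 1"])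
    show "c \<le> u \<or> v < c" using that(1) le n unfolding s by (force simp: u_def v_def)
  qed
  have z: "0 \<in> bd (symmetrized n a)" "0 \<in> bd (symmetrized n b)" by simp_all
  assume fr: "frobenius (2 * n) ?q"
  then obtain \<gamma> where g: "\<gamma> \<in> linear_functionals ?q"
    and nd: "\<And>x. x \<in> ?q \<Longrightarrow> (\<forall>y\<in>?q. \<gamma> (lie_bracket x y) = 0) \<Longrightarrow> x = 0\<^sub>m (2 * n) (2 * n)"
    using frobenius_iff[OF seaweed_C_subalgebra[OF ab]] by blast
  define X :: "'a \<Rightarrow> 'a \<Rightarrow> 'a \<Rightarrow> 'a mat" where "X c1 c2 c3 = mat (2 * n) (2 * n) (\<lambda>(i, j).
     if i = u \<and> j = u then c3 else if i = u \<and> j = v then c1 else if i = v \<and> j = u then c2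
     else if i = v \<and> j = v then - c3 else 0)" for c1 c2 c3
  have Xe: "X c1 c2 c3 $$ (i, j) = (if i = u \<and> j = u then c3 else if i = u \<and> j = v then c1 else if i = v \<and> j = u then c2
     else if i = v \<and> j = v then - c3 else 0)" if "i < 2 * n" "j < 2 * n" for i j c1 c2 c3
    using that by (simp add: X_def)
  have Xv: "X c1 c2 c3 $$ (u, u) = c3" "X c1 c2 c3 $$ (u, v) = c1" "X c1 c2 c3 $$ (v, u) = c2" "X c1 c2 c3 $$ (v, v) = - c3" for c1 c2 c3
    using Xe[OF uv(3,3)] Xe[OF uv(3,2)] Xe[OF uv(2,3)] Xe[OF uv(2,2)] uv(9,10) by simp_all
  have X0: "X c1 c2 c3 $$ (i, j) = 0" if "i < 2 * n" "j < 2 * n" "i \<notin> {u, v} \<or> j \<notin> {u, v}" for i j c1 c2 c3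
  proof -
    have "\<not> (i = u \<and> j = u)" "\<not> (i = u \<and> j = v)" "\<not> (i = v \<and> j = u)" "\<not> (i = v \<and> j = v)"
      using that(3) by blast+
    then show ?thesis unfolding Xe[OF that(1,2)] by (simp only: if_False)
  qed
  have pos: thesis if "i \<notin> {u, v} \<or> j \<notin> {u, v} \<Longrightarrow> thesis" "i = u \<Longrightarrow> j = u \<Longrightarrow> thesis" "i = u \<Longrightarrow> j = v \<Longrightarrow> thesis"
    "i = v \<Longrightarrow> j = u \<Longrightarrow> thesis" "i = v \<Longrightarrow> j = v \<Longrightarrow> thesis" for i j thesis
    using that by blast
  have Xc: "X c1 c2 c3 \<in> carrier_mat (2 * n) (2 * n)" for c1 c2 c3 by (simp add: X_def)
  have Xq: "X c1 c2 c3 \<in> ?q" for c1 c2 c3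
    unfolding iff sp_iff
  proof (intro conjI allI impI Xc)
    fix i j assume ij: "i < 2 * n" "j < 2 * n"
    define i' j' where "i' = 2 * n - 1 - i" and "j' = 2 * n - 1 - j"
    have r: "i' = u \<longleftrightarrow> i = v" "i' = v \<longleftrightarrow> i = u" "j' = u \<longleftrightarrow> j = v" "j' = v \<longleftrightarrow> j = u" "i' < 2 * n" "j' < 2 * n"
      unfolding i'_def j'_def u_def v_def using ij n by arith+
    show "X c1 c2 c3 $$ (i, j) = (if (i < n) = (j < n) then - (X c1 c2 c3 $$ (2 * n - 1 - j, 2 * n - 1 - i)) else X c1 c2 c3 $$ (2 * n - 1 - j, 2 * n - 1 - i))"
      unfolding i'_def[symmetric] j'_def[symmetric]
    proof (rule pos[of i j])
      assume h: "i \<notin> {u, v} \<or> j \<notin> {u, v}"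
      then have "j' \<notin> {u, v} \<or> i' \<notin> {u, v}" using r(1-4) by blast
      then show "X c1 c2 c3 $$ (i, j) = (if (i < n) = (j < n) then - (X c1 c2 c3 $$ (j', i')) else X c1 c2 c3 $$ (j', i'))"
        using X0[OF ij h] X0[OF r(6,5)] by simp
    next
      assume h: "i = u" "j = u"
      then have "i' = v" "j' = v" using r(2,4) by blast+
      with h show "X c1 c2 c3 $$ (i, j) = (if (i < n) = (j < n) then - (X c1 c2 c3 $$ (j', i')) else X c1 c2 c3 $$ (j', i'))"
        by (simp add: Xv)
    next
      assume h: "i = u" "j = v"
      then have "i' = v" "j' = u" using r(2,3) by blast+
      with h uv(4,5) show "X c1 c2 c3 $$ (i, j) = (if (i < n) = (j < n) then - (X c1 c2 c3 $$ (j', i')) else X c1 c2 c3 $$ (j', i'))"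
        by (simp add: Xv)
    next
      assume h: "i = v" "j = u"
      then have "i' = u" "j' = v" using r(1,4) by blast+
      with h uv(4,5) show "X c1 c2 c3 $$ (i, j) = (if (i < n) = (j < n) then - (X c1 c2 c3 $$ (j', i')) else X c1 c2 c3 $$ (j', i'))"
        by (simp add: Xv)
    next
      assume h: "i = v" "j = v"
      then have "i' = u" "j' = u" using r(1,3) by blast+
      with h show "X c1 c2 c3 $$ (i, j) = (if (i < n) = (j < n) then - (X c1 c2 c3 $$ (j', i')) else X c1 c2 c3 $$ (j', i'))"
        by (simp add: Xv)
    qed
    assume "X c1 c2 c3 $$ (i, j) \<noteq> 0"
    then have "i \<in> {u, v}" "j \<in> {u, v}" using X0[OF ij] by blast+
    then have "i = u \<or> i = v" "j = u \<or> j = v" by blast+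
    then have iv: "u \<le> i" "i \<le> v" "u \<le> j" "j \<le> v" using uv(1) by linarith+
    show "\<not> (\<exists>c\<in>bd (symmetrized n a). j < c \<and> c \<le> i)"
    proof (rule notI, elim bexE)
      fix c assume "c \<in> bd (symmetrized n a)" "j < c \<and> c \<le> i"
      with bdm(1)[OF this(1) a] iv show False by linarith
    qed
    show "\<not> (\<exists>c\<in>bd (symmetrized n b). i < c \<and> c \<le> j)"
    proof (rule notI, elim bexE)
      fix c assume "c \<in> bd (symmetrized n b)" "i < c \<and> c \<le> j"
      with bdm(1)[OF this(1) b] iv show False by linarith
    qed
  qed
  have br: "lie_bracket (X c1 c2 c3) y = X (2 * (c3 * y $$ (u, v) - c1 * y $$ (u, u))) (2 * (c2 * y $$ (u, u) - c3 * y $$ (v, u)))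
       (c1 * y $$ (v, u) - c2 * y $$ (u, v))" if y: "y \<in> ?q" for c1 c2 c3 y
  proof (rule eq_matI)
    have yc: "y \<in> carrier_mat (2 * n) (2 * n)" using y unfolding iff sp_iff by blast
    have yv: "y $$ (v, v) = - (y $$ (u, u))" using y uv unfolding iff sp_iff by metis
    have yP: "\<not> (\<exists>c\<in>bd (symmetrized n a). j < c \<and> c \<le> i) \<and> \<not> (\<exists>c\<in>bd (symmetrized n b). i < c \<and> c \<le> j)"
      if "i < 2 * n" "j < 2 * n" "y $$ (i, j) \<noteq> 0" for i j
      using y that unfolding iff by blast
    have side: "u \<le> i" "i \<le> v" "j < u \<or> v < j" if "i \<in> {u, v}" "j \<notin> {u, v}" for i j
      using that uv(1,8) by auto
    have far: "y $$ (i, j) = 0" if "i < 2 * n" "j < 2 * n" "i \<in> {u, v}" "j \<notin> {u, v}" for i j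
    proof (rule ccontr)
      assume nz: "y $$ (i, j) \<noteq> 0"
      note yy = yP[OF that(1,2) nz] and sd = side[OF that(3,4)]
      show False
      proof (cases "j < u")
        case True
        then show False using yy bdm(2)[OF z(1) a] sd(1) by blast
      next
        case False
        then have "i < v + 1" "v + 1 \<le> j" using sd by auto
        then show False using yy bdm(3)[OF z(2) b] by blast
      qed
    qed
    have far': "y $$ (j, i) = 0" if "i < 2 * n" "j < 2 * n" "i \<in> {u, v}" "j \<notin> {u, v}" for i j
    proof (rule ccontr)
      assume nz: "y $$ (j, i) \<noteq> 0"
      note yy = yP[OF that(2,1) nz] and sd = side[OF that(3,4)]
      show False
      proof (cases "j < u")
        case True
        then show False using yy bdm(2)[OF z(2) b] sd(1) by blast
      next
        case False
        then have "i < v + 1" "v + 1 \<le> j" using sd by auto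
        then show False using yy bdm(3)[OF z(1) a] by blast
      qed
    qed
    let ?X = "X c1 c2 c3"
    have d: "?X * y \<in> carrier_mat (2 * n) (2 * n)" "y * ?X \<in> carrier_mat (2 * n) (2 * n)" by (rule mult_carrier_mat[OF Xc yc], rule mult_carrier_mat[OF yc Xc])
    show "dim_row (lie_bracket ?X y) = dim_row (X (2 * (c3 * y $$ (u, v) - c1 * y $$ (u, u))) (2 * (c2 * y $$ (u, u) - c3 * y $$ (v, u)))
       (c1 * y $$ (v, u) - c2 * y $$ (u, v)))" "dim_col (lie_bracket ?X y) = dim_col (X (2 * (c3 * y $$ (u, v) - c1 * y $$ (u, u))) (2 * (c2 * y $$ (u, u) - c3 * y $$ (v, u)))
       (c1 * y $$ (v, u) - c2 * y $$ (u, v)))"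
      using yc Xc[of c1 c2 c3] by (simp_all add: lie_bracket_def X_def)
    fix i j assume "i < dim_row (X (2 * (c3 * y $$ (u, v) - c1 * y $$ (u, u))) (2 * (c2 * y $$ (u, u) - c3 * y $$ (v, u)))
       (c1 * y $$ (v, u) - c2 * y $$ (u, v)))" "j < dim_col (X (2 * (c3 * y $$ (u, v) - c1 * y $$ (u, u))) (2 * (c2 * y $$ (u, u) - c3 * y $$ (v, u)))
       (c1 * y $$ (v, u) - c2 * y $$ (u, v)))"
    then have ij: "i < 2 * n" "j < 2 * n" by (simp_all add: X_def)
    have two_terms: "(\<Sum>k<2 * n. f k) = f u + f v" if "\<And>k. k \<notin> {u, v} \<Longrightarrow> k < 2 * n \<Longrightarrow> f k = 0" for f :: "nat \<Rightarrow> 'a"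
    proof -
      have "(\<Sum>k<2 * n. f k) = (\<Sum>k\<in>{u, v}. f k)" using that uv by (intro sum.mono_neutral_right) auto
      then show ?thesis using uv by simp
    qed
    have "(?X * y) $$ (i, j) = (\<Sum>k<2 * n. ?X $$ (i, k) * y $$ (k, j))"
      using Xc[of c1 c2 c3] yc ij by (simp add: scalar_prod_def atLeast0LessThan)
    also have "\<dots> = ?X $$ (i, u) * y $$ (u, j) + ?X $$ (i, v) * y $$ (v, j)"
      by (rule two_terms) (use ij in \<open>auto simp: Xe\<close>)
    finally have p1: "(?X * y) $$ (i, j) = ?X $$ (i, u) * y $$ (u, j) + ?X $$ (i, v) * y $$ (v, j)" .
    have "(y * ?X) $$ (i, j) = (\<Sum>k<2 * n. y $$ (i, k) * ?X $$ (k, j))"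
      using Xc[of c1 c2 c3] yc ij by (simp add: scalar_prod_def atLeast0LessThan)
    also have "\<dots> = y $$ (i, u) * ?X $$ (u, j) + y $$ (i, v) * ?X $$ (v, j)"
      by (rule two_terms) (use ij in \<open>auto simp: Xe\<close>)
    finally have p2: "(y * ?X) $$ (i, j) = y $$ (i, u) * ?X $$ (u, j) + y $$ (i, v) * ?X $$ (v, j)" .
    have "lie_bracket ?X y $$ (i, j) = (?X * y) $$ (i, j) - (y * ?X) $$ (i, j)"
      using d ij by (simp add: lie_bracket_def del: index_mult_mat)
    also have "\<dots> = X (2 * (c3 * y $$ (u, v) - c1 * y $$ (u, u))) (2 * (c2 * y $$ (u, u) - c3 * y $$ (v, u)))
       (c1 * y $$ (v, u) - c2 * y $$ (u, v)) $$ (i, j)"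
    proof -
      consider "i \<notin> {u, v}" | "i \<in> {u, v}" "j \<notin> {u, v}" | "i = u" "j = u" | "i = u" "j = v" | "i = v" "j = u" | "i = v" "j = v"
        by blast
      then show ?thesis
      proof cases
        case 1
        then have "y $$ (i, u) = 0" "y $$ (i, v) = 0" using far'[OF uv(3) ij(1)] far'[OF uv(2) ij(1)] by simp_all
        with 1 show ?thesis unfolding p1 p2 using X0[OF ij] X0[OF ij(1) uv(3)] X0[OF ij(1) uv(2)] by simp
      next
        case 2
        then have "y $$ (u, j) = 0" "y $$ (v, j) = 0" using far[OF uv(3) ij(2)] far[OF uv(2) ij(2)] by simp_all
        with 2 show ?thesis unfolding p1 p2 using X0[OF ij] X0[OF uv(3) ij(2)] X0[OF uv(2) ij(2)] by simp
      next
        case 3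
        show ?thesis unfolding p1 p2 unfolding 3 Xv by (simp add: algebra_simps)
      next
        case 4
        show ?thesis unfolding p1 p2 unfolding 4 Xv yv by (simp add: algebra_simps)
      next
        case 5
        show ?thesis unfolding p1 p2 unfolding 5 Xv yv by (simp add: algebra_simps)
      next
        case 6
        show ?thesis unfolding p1 p2 unfolding 6 Xv yv by (simp add: algebra_simps)
      qed
    qed
    finally show "lie_bracket ?X y $$ (i, j) = X (2 * (c3 * y $$ (u, v) - c1 * y $$ (u, u))) (2 * (c2 * y $$ (u, u) - c3 * y $$ (v, u)))
       (c1 * y $$ (v, u) - c2 * y $$ (u, v)) $$ (i, j)" .
  qed
  define \<alpha> \<beta> \<eta> where "\<alpha> = \<gamma> (X 1 0 0)" and "\<beta> = \<gamma> (X 0 1 0)" and "\<eta> = \<gamma> (X 0 0 1)"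
  have gX: "\<gamma> (X c1 c2 c3) = c1 * \<alpha> + c2 * \<beta> + c3 * \<eta>" for c1 c2 c3
  proof -
    have "X c1 c2 c3 = c1 \<cdot>\<^sub>m X 1 0 0 + (c2 \<cdot>\<^sub>m X 0 1 0 + c3 \<cdot>\<^sub>m X 0 0 1)"
    proof (rule eq_matI)
      fix i j assume "i < dim_row (c1 \<cdot>\<^sub>m X 1 0 0 + (c2 \<cdot>\<^sub>m X 0 1 0 + c3 \<cdot>\<^sub>m X 0 0 1))" "j < dim_col (c1 \<cdot>\<^sub>m X 1 0 0 + (c2 \<cdot>\<^sub>m X 0 1 0 + c3 \<cdot>\<^sub>m X 0 0 1))"
      then have ij: "i < 2 * n" "j < 2 * n" by (simp_all add: X_def)
      have "(c1 \<cdot>\<^sub>m X 1 0 0 + (c2 \<cdot>\<^sub>m X 0 1 0 + c3 \<cdot>\<^sub>m X 0 0 1)) $$ (i, j)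
        = c1 * X 1 0 0 $$ (i, j) + (c2 * X 0 1 0 $$ (i, j) + c3 * X 0 0 1 $$ (i, j))"
        using ij Xc[of 1 0 0] Xc[of 0 1 0] Xc[of 0 0 1] by simp
      also have "\<dots> = X c1 c2 c3 $$ (i, j)"
        by (rule pos[of i j]) (simp_all only: X0[OF ij] Xv, simp_all)
      finally show "X c1 c2 c3 $$ (i, j) = (c1 \<cdot>\<^sub>m X 1 0 0 + (c2 \<cdot>\<^sub>m X 0 1 0 + c3 \<cdot>\<^sub>m X 0 0 1)) $$ (i, j)" by (rule sym)
    qed (simp_all add: X_def)
    moreover have "c1 \<cdot>\<^sub>m X 1 0 0 \<in> ?q" "c2 \<cdot>\<^sub>m X 0 1 0 \<in> ?q" "c3 \<cdot>\<^sub>m X 0 0 1 \<in> ?q" "c2 \<cdot>\<^sub>m X 0 1 0 + c3 \<cdot>\<^sub>m X 0 0 1 \<in> ?q"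
      using seaweed_C_subalgebra[OF ab, where 'a = 'a] Xq by (simp_all add: mat_subalgebra_def)
    ultimately show ?thesis using g Xq by (simp add: linear_functionals_def \<alpha>_def \<beta>_def \<eta>_def)
  qed
  have stab: "X c1 c2 c3 = 0\<^sub>m (2 * n) (2 * n)"
    if "\<And>d1 d2 d3. 2 * (c3 * d1 - c1 * d3) * \<alpha> + 2 * (c2 * d3 - c3 * d2) * \<beta> + (c1 * d2 - c2 * d1) * \<eta> = 0" for c1 c2 c3
    using that by (intro nd[OF Xq] ballI) (simp only: br gX)
  have ents: "c1 = 0 \<and> c2 = 0 \<and> c3 = 0" if "X c1 c2 c3 = 0\<^sub>m (2 * n) (2 * n)" for c1 c2 c3
  proof -
    have "X c1 c2 c3 $$ (u, v) = 0" "X c1 c2 c3 $$ (v, u) = 0" "X c1 c2 c3 $$ (u, u) = 0" using uv by (simp_all add: that)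
    then show ?thesis using uv by (simp add: Xe)
  qed
  \<comment> \<open>This element is dual to \<open>\<gamma>\<close> under the trace form of \<open>sl 2\<close>, up to a scalar, and hence stabilizes it.\<close>
  have "X (2 * \<beta>) (2 * \<alpha>) \<eta> = 0\<^sub>m (2 * n) (2 * n)" by (rule stab) (simp add: algebra_simps)
  from ents[OF this] have abe: "\<alpha> = 0" "\<beta> = 0" "\<eta> = 0" using two by simp_all
  have "X 1 0 0 = 0\<^sub>m (2 * n) (2 * n)" by (rule stab) (simp add: abe)
  from ents[OF this] show False by simp
qed

section \<open>Central arcs\<close>

text \<open>
  Only the interval of length \<open>2 * (n - sum_list a)\<close> in the middle has arcs that cross the centre,
  and all its arcs do.
\<close>

lemma card_central_arcs:
  assumes "sum_list a \<le> n"
  shows "card (central_arcs n (arcs (symmetrized n a))) = n - sum_list a"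
proof -
  define c where "c = symmetrized n a"
  define d where "d = n - sum_list a"
  have s: "bd c = bd a \<union> (\<lambda>c. 2 * n - c) ` bd a" unfolding c_def using assms by (rule bd_symmetrized)
  have le: "e \<le> n - d" if "e \<in> bd a" for e using bd_le[OF that] assms by (simp add: d_def)
  have nd: "n - d \<in> bd a" using sum_bd[of a] assms by (simp add: d_def)
  have dn: "d \<le> n" by (simp add: d_def)
  have "central_arcs n (arcs c) = (\<lambda>t. (n - d + t, n + d - 1 - t)) ` {..<d}"
  proof (intro equalityI subsetI)
    fix x assume "x \<in> central_arcs n (arcs c)"
    then obtain k t where x: "x = (part_start c k + t, part_start c (Suc k) - 1 - t)" and k: "k < length c"
      and lt: "part_start c k + t < n" "n \<le> part_start c (Suc k) - 1 - t"
      by (auto simp: central_arcs_def arcs_def)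
    have gap: "e \<le> part_start c k \<or> part_start c (Suc k) \<le> e" if e: "e \<in> bd c" for e
    proof -
      obtain m where m: "e = part_start c m" using e by (auto simp: bd_def)
      show ?thesis using part_start_mono[of m k c] part_start_mono[of "Suc k" m c] m by (cases "m \<le> k") auto
    qed
    have mem: "part_start c k \<in> bd c" "part_start c (Suc k) \<in> bd c" using k by (auto simp: bd_def)
    have "n - d \<in> bd c" "n + d \<in> bd c"
    proof -
      show "n - d \<in> bd c" using nd s by blast
      have "n + d = 2 * n - (n - d)" using dn by simp
      then show "n + d \<in> bd c" using nd s by blast
    qed
    from gap[OF this(1)] gap[OF this(2)] have g1: "n - d \<le> part_start c k" "part_start c (Suc k) \<le> n + d" using lt dn by auto
    have "part_start c k \<le> n - d" using mem(1) lt le unfolding s by force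
    moreover have "n + d \<le> part_start c (Suc k)" using mem(2) lt le dn unfolding s by force
    ultimately have "part_start c k = n - d" "part_start c (Suc k) = n + d" using g1 by auto
    with x lt show "x \<in> (\<lambda>t. (n - d + t, n + d - 1 - t)) ` {..<d}" by auto
  next
    fix x assume "x \<in> (\<lambda>t. (n - d + t, n + d - 1 - t)) ` {..<d}"
    then obtain t where t: "t < d" "x = (n - d + t, n + d - 1 - t)" by auto
    then have c: "c = a @ [2 * d] @ rev a" by (simp add: c_def symmetrized_def d_def[symmetric])
    have ps: "part_start c (length a) = n - d" "part_start c (Suc (length a)) = n + d"
      using assms by (auto simp: c part_start_def d_def)
    have "x \<in> arcs c"
      unfolding arcs_def using t ps c dn by (intro CollectI exI[of _ "length a"] exI[of _ "n - d"] exI[of _ "n + d - 1"] exI[of _ t]) auto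
    then show "x \<in> central_arcs n (arcs c)" using t dn by (auto simp: central_arcs_def)
  qed
  moreover have "inj_on (\<lambda>t. (n - d + t, n + d - 1 - t)) {..<d}" by (auto simp: inj_on_def)
  ultimately show ?thesis by (simp add: c_def[symmetric] card_image d_def[symmetric])
qed

lemma num_central_arcs_eq:
  "sum_list a \<le> n \<Longrightarrow> sum_list b \<le> n \<Longrightarrow> num_central_arcs n a b = (n - sum_list a) + (n - sum_list b)"
  by (simp add: num_central_arcs_def meander_graph_C_def card_central_arcs)

section \<open>Seaweeds determine their compositions\<close>

lemma bd_inject:
  assumes "\<forall>p\<in>set a. 0 < p" "\<forall>p\<in>set a'. 0 < p" "bd a = bd a'"
  shows "a = a'"
  using assms
proof (induction a arbitrary: a')
  case Nil
  show ?case
  proof (cases a')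
    case (Cons x xs)
    have "x \<in> bd a'" using Cons by (auto simp: bd_Cons)
    then have "x = 0" using Nil(3) by auto
    with Nil(2) Cons show ?thesis by simp
  qed simp
next
  case (Cons x xs)
  show ?case
  proof (cases a')
    case Nil
    have "x \<in> bd (x # xs)" by (auto simp: bd_Cons)
    then have "x = 0" using Nil Cons.prems(3) by auto
    with Cons.prems(1) show ?thesis by simp
  next
    case a': (Cons y ys)
    have xy: "0 < x" "0 < y" using Cons.prems a' by auto
    have eq: "insert 0 ((+) x ` bd xs) = insert 0 ((+) y ` bd ys)" using Cons.prems a' by (simp add: bd_Cons)
    have "x \<in> insert 0 ((+) x ` bd xs)" by auto
    then have "y \<le> x" using xy unfolding eq by auto
    moreover have "y \<in> insert 0 ((+) y ` bd ys)" by auto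
    then have "x \<le> y" using xy unfolding eq[symmetric] by auto
    ultimately have "x = y" by simp
    have "0 \<notin> (+) x ` bd xs" "0 \<notin> (+) x ` bd ys" using xy by auto
    moreover have "insert 0 ((+) x ` bd xs) = insert 0 ((+) x ` bd ys)"
      using eq by (simp only: \<open>x = y\<close>)
    ultimately have "(+) x ` bd xs = (+) x ` bd ys" by (rule insert_ident[THEN iffD1])
    then have "bd xs = bd ys" using inj_image_eq_iff[of "(+) x" "bd xs" "bd ys"] by simp
    moreover have "\<forall>p\<in>set xs. 0 < p" "\<forall>p\<in>set ys. 0 < p" using Cons.prems a' by auto
    ultimately have "xs = ys" by (intro Cons.IH)
    with a' \<open>x = y\<close> show ?thesis by simp
  qed
qed

text \<open>
  A position \<open>c\<close> strictly inside is a boundary for the first composition iff the matrix unit at \<open>(c,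
  c - 1)\<close> is not in the seaweed, and for the second iff the one at \<open>(c - 1, c)\<close> is not.
\<close>

lemma bd_seaweed_sl_subset:
  assumes s: "sum_list a = n" "sum_list b = n" "sum_list a' = n" "sum_list b' = n"
    and eq: "seaweed_A n a b \<inter> sl n = (seaweed_A n a' b' \<inter> sl n :: 'a::field mat set)"
  shows "bd a' \<subseteq> bd a" and "bd b' \<subseteq> bd b"
proof -
  have E: "mat n n (\<lambda>p. if p = (i, j) then 1 else 0) \<in> (sl n :: 'a mat set)" if "i \<noteq> j" for i j
    using that by (auto simp: sl_def intro!: sum.neutral)
  have mem: "mat n n (\<lambda>p. if p = (i, j) then 1 else 0) \<in> (seaweed_A n e f :: 'a mat set) \<longleftrightarrow>
    \<not> (\<exists>c\<in>bd e. j < c \<and> c \<le> i) \<and> \<not> (\<exists>c\<in>bd f. i < c \<and> c \<le> j)"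
    if "sum_list e = n" "sum_list f = n" "i < n" "j < n" for i j e f
    unfolding seaweed_A_bd[OF that(1,2)] using that(3,4) by auto
  have tr: "\<not> (\<exists>c\<in>bd a. j < c \<and> c \<le> i) \<and> \<not> (\<exists>c\<in>bd b. i < c \<and> c \<le> j) \<longleftrightarrow>
    \<not> (\<exists>c\<in>bd a'. j < c \<and> c \<le> i) \<and> \<not> (\<exists>c\<in>bd b'. i < c \<and> c \<le> j)"
    if "i \<noteq> j" "i < n" "j < n" for i j
    using eq E[OF that(1)] mem[OF s(1,2) that(2,3)] mem[OF s(3,4) that(2,3)] by blast
  show "bd a' \<subseteq> bd a"
  proof
    fix c assume c: "c \<in> bd a'"
    show "c \<in> bd a"
    proof (cases "0 < c \<and> c < n")
      case True
      then have "\<exists>e\<in>bd a'. c - 1 < e \<and> e \<le> c" using c by auto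
      then have "(\<exists>e\<in>bd a. c - 1 < e \<and> e \<le> c) \<or> (\<exists>e\<in>bd b. c < e \<and> e \<le> c - 1)" using tr[of c "c - 1"] True by auto
      then obtain e where "e \<in> bd a" "c - 1 < e" "e \<le> c" by force
      then show ?thesis using True by (metis One_nat_def Suc_pred le_antisym less_eq_Suc_le)
    next
      case False
      then have "c = 0 \<or> c = n" using bd_le[OF c] s by auto
      then show ?thesis using sum_bd[of a] s by auto
    qed
  qed
  show "bd b' \<subseteq> bd b"
  proof
    fix c assume c: "c \<in> bd b'"
    show "c \<in> bd b"
    proof (cases "0 < c \<and> c < n")
      case True
      then have "\<exists>e\<in>bd b'. c - 1 < e \<and> e \<le> c" using c by auto
      then have "(\<exists>e\<in>bd a. c < e \<and> e \<le> c - 1) \<or> (\<exists>e\<in>bd b. c - 1 < e \<and> e \<le> c)" using tr[of "c - 1" c] True by auto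
      then obtain e where "e \<in> bd b" "c - 1 < e" "e \<le> c" by force
      then show ?thesis using True by (metis One_nat_def Suc_pred le_antisym less_eq_Suc_le)
    next
      case False
      then have "c = 0 \<or> c = n" using bd_le[OF c] s by auto
      then show ?thesis using sum_bd[of b] s by auto
    qed
  qed
qed

lemma seaweed_A_sl_inject:
  assumes "composition_of n a" "composition_of n b" "composition_of n a'" "composition_of n b'"
    and eq: "seaweed_A n a b \<inter> sl n = (seaweed_A n a' b' \<inter> sl n :: 'a::field mat set)"
  shows "a = a' \<and> b = b'"
proof -
  have s: "sum_list a = n" "sum_list b = n" "sum_list a' = n" "sum_list b' = n" using assms by (auto simp: composition_of_def)
  have "bd a = bd a'" "bd b = bd b'"
    using bd_seaweed_sl_subset[OF s eq] bd_seaweed_sl_subset[OF s(3,4,1,2) eq[symmetric]] by auto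
  then show ?thesis using assms bd_inject by (auto simp: composition_of_def)
qed

text \<open>
  As for traceless seaweeds, with the matrix unit at \<open>(c, c - 1)\<close> made symplectic by adding its
  mirror image.
\<close>

lemma bd_seaweed_C_subset:
  assumes s: "sum_list a \<le> n" "sum_list b \<le> n" "sum_list a' \<le> n" "sum_list b' \<le> n"
    and eq: "seaweed_C n a b = (seaweed_C n a' b' :: 'a::field mat set)"
  shows "bd a' \<subseteq> bd a"
proof
  fix c assume c: "c \<in> bd a'"
  show "c \<in> bd a"
  proof (cases "c = 0")
    case False
    have cn: "0 < c" "c \<le> n" using False bd_le[OF c] s by auto
    \<comment> \<open>For \<open>c = n\<close> the two positions coincide, and the first case gives the entry \<open>1\<close>.\<close>
    define M :: "'a mat" where "M = mat (2 * n) (2 * n) (\<lambda>(i, j). if i = c \<and> j = c - 1 then 1 else if i = 2 * n - c \<and> j = 2 * n - 1 - c then - 1 else 0)"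
    have bda: "bd (symmetrized n e) = bd e \<union> (\<lambda>c. 2 * n - c) ` bd e" if "sum_list e \<le> n" for e
      using that by (rule bd_symmetrized)
    have Me: "M $$ (i, j) = (if i = c \<and> j = c - 1 then 1 else if i = 2 * n - c \<and> j = 2 * n - 1 - c then - 1 else 0)"
      if "i < 2 * n" "j < 2 * n" for i j using that by (simp add: M_def)
    have Msp: "M \<in> sp n"
      unfolding sp_iff
    proof (intro conjI allI impI)
      show "M \<in> carrier_mat (2 * n) (2 * n)" by (simp add: M_def)
      fix i j assume ij: "i < 2 * n" "j < 2 * n"
      have r: "2 * n - 1 - j = c \<longleftrightarrow> j = 2 * n - 1 - c" "2 * n - 1 - i = c - 1 \<longleftrightarrow> i = 2 * n - c"
        "2 * n - 1 - j = 2 * n - c \<longleftrightarrow> j = c - 1" "2 * n - 1 - i = 2 * n - 1 - c \<longleftrightarrow> i = c"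
        "2 * n - 1 - j < 2 * n" "2 * n - 1 - i < 2 * n"
        using ij cn by auto
      show "M $$ (i, j) = (if (i < n) = (j < n) then - (M $$ (2 * n - 1 - j, 2 * n - 1 - i)) else M $$ (2 * n - 1 - j, 2 * n - 1 - i))"
      proof -
        consider "i = c" "j = c - 1" "c = n" | "i = c" "j = c - 1" "c < n" | "i = 2 * n - c" "j = 2 * n - 1 - c" "c < n"
          | "\<not> (i = c \<and> j = c - 1)" "\<not> (i = 2 * n - c \<and> j = 2 * n - 1 - c)"
          using cn by force
        then show ?thesis unfolding Me[OF ij] Me[OF r(5,6)] r(1-4)
        proof cases
          case 4
          then show "(if i = c \<and> j = c - 1 then 1 else if i = 2 * n - c \<and> j = 2 * n - 1 - c then - 1 else 0) =
            (if (i < n) = (j < n) then - (if j = 2 * n - 1 - c \<and> i = 2 * n - c then 1 else if j = c - 1 \<and> i = c then - 1 else 0)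
             else if j = 2 * n - 1 - c \<and> i = 2 * n - c then 1 else if j = c - 1 \<and> i = c then - 1 else (0::'a))"
            by auto
        qed (use cn in auto)
      qed
    qed
    have adj: "(\<exists>x\<in>bd (symmetrized n e). c - 1 < x \<and> x \<le> c) \<longleftrightarrow> c \<in> bd e" if "sum_list e \<le> n" for e
    proof
      assume "\<exists>x\<in>bd (symmetrized n e). c - 1 < x \<and> x \<le> c"
      then obtain x where x: "x \<in> bd (symmetrized n e)" "c - 1 < x" "x \<le> c" by blast
      have "x = c" using x cn by simp
      with x(1) have "c \<in> bd e \<or> (\<exists>y\<in>bd e. c = 2 * n - y)" unfolding bda[OF that] by auto
      then show "c \<in> bd e"
      proof
        assume "\<exists>y\<in>bd e. c = 2 * n - y"
        then obtain y where y: "y \<in> bd e" "c = 2 * n - y" by blast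
        have "y \<le> n" using bd_le[OF y(1)] that by simp
        then have "y = c" using y(2) cn by linarith
        with y(1) show ?thesis by (simp only:)
      qed
    next
      assume "c \<in> bd e"
      then show "\<exists>x\<in>bd (symmetrized n e). c - 1 < x \<and> x \<le> c" unfolding bda[OF that] using cn by (intro bexI[of _ c]) auto
    qed
    have adj': "(\<exists>x\<in>bd (symmetrized n e). 2 * n - 1 - c < x \<and> x \<le> 2 * n - c) \<longrightarrow> c \<in> bd e" if "sum_list e \<le> n" for e
    proof
      assume "\<exists>x\<in>bd (symmetrized n e). 2 * n - 1 - c < x \<and> x \<le> 2 * n - c"
      then obtain x where x: "x \<in> bd (symmetrized n e)" "2 * n - 1 - c < x" "x \<le> 2 * n - c" by blast
      have "x = 2 * n - c" using x cn by simp
      with x(1) have "2 * n - c \<in> bd e \<or> (\<exists>y\<in>bd e. 2 * n - c = 2 * n - y)" unfolding bda[OF that] by auto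
      then show "c \<in> bd e"
      proof
        assume h: "2 * n - c \<in> bd e"
        then have "2 * n - c = c" using bd_le[OF h] that cn by simp
        with h show ?thesis by simp
      next
        assume "\<exists>y\<in>bd e. 2 * n - c = 2 * n - y"
        then obtain y where y: "y \<in> bd e" "2 * n - c = 2 * n - y" by blast
        have "y \<le> n" using bd_le[OF y(1)] that by simp
        then have "y = c" using y(2) cn by linarith
        with y(1) show ?thesis by (simp only:)
      qed
    qed
    have mem: "M \<in> seaweed_C n e f \<longleftrightarrow> c \<notin> bd e" if ef: "sum_list e \<le> n" "sum_list f \<le> n" for e f
    proof
      assume "M \<in> seaweed_C n e f"
      moreover have "M $$ (c, c - 1) \<noteq> 0" "c < 2 * n" "c - 1 < 2 * n" using cn by (auto simp: M_def)
      ultimately have "\<not> (\<exists>x\<in>bd (symmetrized n e). c - 1 < x \<and> x \<le> c)" unfolding seaweed_C_bd[OF ef] by blast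
      then show "c \<notin> bd e" unfolding adj[OF ef(1)] .
    next
      assume nc: "c \<notin> bd e"
      show "M \<in> seaweed_C n e f"
        unfolding seaweed_C_bd[OF ef]
      proof (intro conjI allI impI Msp)
        fix i j assume ij: "i < 2 * n" "j < 2 * n" "M $$ (i, j) \<noteq> 0"
        then have d: "(i = c \<and> j = c - 1) \<or> (i = 2 * n - c \<and> j = 2 * n - 1 - c)" unfolding Me[OF ij(1,2)] by (auto split: if_splits)
        then show "\<not> (\<exists>x\<in>bd (symmetrized n e). j < x \<and> x \<le> i)"
          using nc adj[OF ef(1)] adj'[OF ef(1)] by blast
        show "\<not> (\<exists>x\<in>bd (symmetrized n f). i < x \<and> x \<le> j)" using d cn by auto
      qed
    qed
    show ?thesis using mem[OF s(1,2)] mem[OF s(3,4)] c unfolding eq by blast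
  qed simp
qed

lemma seaweed_C_inject:
  assumes p: "\<forall>x\<in>set a. 0 < x" "\<forall>x\<in>set b. 0 < x" "\<forall>x\<in>set a'. 0 < x" "\<forall>x\<in>set b'. 0 < x"
    and s: "sum_list a \<le> n" "sum_list b \<le> n" "sum_list a' \<le> n" "sum_list b' \<le> n"
    and eq: "seaweed_C n a b = (seaweed_C n a' b' :: 'a::field mat set)"
  shows "a = a' \<and> b = b'"
proof -
  have eq': "seaweed_C n b a = (seaweed_C n b' a' :: 'a mat set)"
    using bij_neg_tp[OF s(1,2), where 'a = 'a] bij_neg_tp[OF s(3,4), where 'a = 'a] eq by (metis bij_betw_imp_surj_on)
  have "bd a = bd a'"
    using bd_seaweed_C_subset[OF s eq] bd_seaweed_C_subset[OF s(3,4,1,2) eq[symmetric]] by blast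
  moreover have "bd b = bd b'"
    using bd_seaweed_C_subset[OF s(2,1,4,3) eq'] bd_seaweed_C_subset[OF s(4,3,2,1) eq'[symmetric]] by blast
  ultimately show ?thesis using p bd_inject by blast
qed

section \<open>The bijections\<close>

text \<open>
  An unordered pair contains at most one seaweed in which the first composition sums to \<open>n - k\<close>,
  because \<open>n - k < n\<close>; so the assignment is well defined on unordered pairs, and injective because
  traceless seaweeds determine their compositions.
\<close>

lemma bijection_from_equivalence:
  assumes k: "1 \<le> k" "k \<le> n"
    and iff: "\<And>a b. sum_list a = n - k \<Longrightarrow> sum_list b = n \<Longrightarrow>
      frobenius (2 * n) (seaweed_C n a b :: 'a::field_char_0 mat set) \<longleftrightarrow> frobenius n (seaweed_A n (a @ [k]) b \<inter> sl n :: 'a mat set)"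
    and sums: "\<And>a b. composition_of (sum_list a) a \<Longrightarrow> composition_of (sum_list b) b \<Longrightarrow> sum_list a \<le> n \<Longrightarrow> sum_list b \<le> n \<Longrightarrow>
      frobenius (2 * n) (seaweed_C n a b :: 'a mat set) \<Longrightarrow> (n - sum_list a) + (n - sum_list b) = k \<Longrightarrow>
      sum_list a = n \<or> sum_list b = n"
  shows "\<exists>\<Phi> :: 'a mat set set \<Rightarrow> 'a mat set.
        (\<forall>X\<in>(frobenius_set n k :: 'a mat set set set). \<exists>a b. composition_of (n - k) a \<and> composition_of n b \<and>
           X = seaweed_C_class n a b) \<and>
        (\<forall>a b. composition_of (n - k) a \<and> composition_of n b \<and>
           (seaweed_C_class n a b :: 'a mat set set) \<in> frobenius_set n k \<longrightarrow>
           \<Phi> (seaweed_C_class n a b) = seaweed_A n (a @ [k]) b \<inter> sl n) \<and>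
        bij_betw \<Phi> (frobenius_set n k) (frobenius_sl_last n k)"
proof -
  let ?F = "frobenius_set n k :: 'a mat set set set"
  have two: "(2::'a) \<noteq> 0" by simp
  have swap: "seaweed_C_class n a b = seaweed_C_class n b a" for a b
    by (simp add: seaweed_C_class_def insert_commute)
  have rep: "\<exists>a b. composition_of (n - k) a \<and> composition_of n b \<and> X = seaweed_C_class n a b \<and>
      frobenius (2 * n) (seaweed_C n a b :: 'a mat set)" if "X \<in> ?F" for X
  proof -
    obtain a b where X: "X = seaweed_C_class n a b" and c: "\<exists>r\<le>n. composition_of r a" "\<exists>s\<le>n. composition_of s b"
      and fr: "frobenius (2 * n) (seaweed_C n a b :: 'a mat set)" and num: "num_central_arcs n a b = k"
    proof -
      have "\<exists>a b. X = seaweed_C_class n a b \<and> (\<exists>r\<le>n. composition_of r a) \<and> (\<exists>s\<le>n. composition_of s b) \<and>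
          frobenius (2 * n) (seaweed_C n a b :: 'a mat set) \<and> num_central_arcs n a b = k"
        using \<open>X \<in> ?F\<close> by (simp only: frobenius_set_def mem_Collect_eq)
      then show thesis using that by blast
    qed
    have ab: "composition_of (sum_list a) a" "composition_of (sum_list b) b" "sum_list a \<le> n" "sum_list b \<le> n"
      using c by (auto simp: composition_of_def)
    have e: "(n - sum_list a) + (n - sum_list b) = k" using num num_central_arcs_eq[OF ab(3,4)] by simp
    from sums[OF ab fr e] show ?thesis
    proof
      assume "sum_list b = n"
      then show ?thesis using X ab fr e by (intro exI[of _ a] exI[of _ b]) auto
    next
      assume an: "sum_list a = n"
      then have bn: "sum_list b = n - k" using e ab by auto
      then show ?thesis
        using X ab fr an frobenius_sp_seaweed_iff(2)[OF k bn an two] swap[of a b]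
        by (intro exI[of _ b] exI[of _ a]) (auto simp: composition_of_def)
    qed
  qed
  have uniq: "a = a' \<and> b = b'"
    if c: "composition_of (n - k) a" "composition_of n b" "composition_of (n - k) a'" "composition_of n b'"
      and eq: "seaweed_C_class n a b = (seaweed_C_class n a' b' :: 'a mat set set)" for a b a' b'
  proof -
    have p: "\<forall>x\<in>set a. 0 < x" "\<forall>x\<in>set b. 0 < x" "\<forall>x\<in>set a'. 0 < x" "\<forall>x\<in>set b'. 0 < x"
      and s: "sum_list a = n - k" "sum_list b = n" "sum_list a' = n - k" "sum_list b' = n"
      using c by (auto simp: composition_of_def)
    have "seaweed_C n a b = (seaweed_C n a' b' :: 'a mat set) \<or> seaweed_C n a b = (seaweed_C n b' a' :: 'a mat set)"
      using eq by (auto simp: seaweed_C_class_def)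
    then show ?thesis
    proof
      assume "seaweed_C n a b = (seaweed_C n a' b' :: 'a mat set)"
      then show ?thesis using s by (intro seaweed_C_inject[OF p]) auto
    next
      assume "seaweed_C n a b = (seaweed_C n b' a' :: 'a mat set)"
      then have "a = b'" using seaweed_C_inject[OF p(1,2,4,3), of n] s by auto
      then show ?thesis using s k by simp
    qed
  qed
  have mem: "seaweed_C_class n a b \<in> ?F \<longleftrightarrow> frobenius (2 * n) (seaweed_C n a b :: 'a mat set)"
    if c: "composition_of (n - k) a" "composition_of n b" for a b
  proof
    assume "seaweed_C_class n a b \<in> ?F"
    from rep[OF this] obtain a' b' where ab': "composition_of (n - k) a'" "composition_of n b'"
      "seaweed_C_class n a b = (seaweed_C_class n a' b' :: 'a mat set set)" "frobenius (2 * n) (seaweed_C n a' b' :: 'a mat set)"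
      by blast
    with uniq[OF c ab'(1,2,3)] show "frobenius (2 * n) (seaweed_C n a b :: 'a mat set)" by simp
  next
    assume fr: "frobenius (2 * n) (seaweed_C n a b :: 'a mat set)"
    have "num_central_arcs n a b = k" using num_central_arcs_eq[of a n b] c k by (auto simp: composition_of_def)
    then have "(\<exists>r\<le>n. composition_of r a) \<and> (\<exists>s\<le>n. composition_of s b) \<and>
          frobenius (2 * n) (seaweed_C n a b :: 'a mat set) \<and> num_central_arcs n a b = k"
      using fr c diff_le_self[of n k] by blast
    then show "seaweed_C_class n a b \<in> ?F" unfolding frobenius_set_def by blast
  qed
  have ext: "composition_of n (a @ [k])" if "composition_of (n - k) a" for a using that k by (auto simp: composition_of_def)
  define \<Phi> :: "'a mat set set \<Rightarrow> 'a mat set" where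
    "\<Phi> X = (THE Y. \<exists>a b. composition_of (n - k) a \<and> composition_of n b \<and> X = seaweed_C_class n a b \<and>
        Y = seaweed_A n (a @ [k]) b \<inter> sl n)" for X
  have \<Phi>: "\<Phi> (seaweed_C_class n a b) = seaweed_A n (a @ [k]) b \<inter> sl n"
    if c: "composition_of (n - k) a" "composition_of n b" for a b
    unfolding \<Phi>_def
  proof (rule the_equality)
    fix Y :: "'a mat set"
    assume "\<exists>a' b'. composition_of (n - k) a' \<and> composition_of n b' \<and> seaweed_C_class n a b = (seaweed_C_class n a' b' :: 'a mat set set) \<and>
        Y = seaweed_A n (a' @ [k]) b' \<inter> sl n"
    with uniq[OF c] show "Y = seaweed_A n (a @ [k]) b \<inter> sl n" by blast
  qed (use c in blast)
  have "bij_betw \<Phi> ?F (frobenius_sl_last n k)"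
    unfolding bij_betw_def
  proof
    show "inj_on \<Phi> ?F"
    proof (rule inj_onI)
      fix X X' assume X: "X \<in> ?F" and X': "X' \<in> ?F" and e: "\<Phi> X = \<Phi> X'"
      obtain a b where ab: "composition_of (n - k) a" "composition_of n b" "X = seaweed_C_class n a b" using rep[OF X] by blast
      obtain a' b' where ab': "composition_of (n - k) a'" "composition_of n b'" "X' = seaweed_C_class n a' b'" using rep[OF X'] by blast
      have "seaweed_A n (a @ [k]) b \<inter> sl n = (seaweed_A n (a' @ [k]) b' \<inter> sl n :: 'a mat set)"
        using e \<Phi>[OF ab(1,2)] \<Phi>[OF ab'(1,2)] ab(3) ab'(3) by simp
      from seaweed_A_sl_inject[OF ext[OF ab(1)] ab(2) ext[OF ab'(1)] ab'(2) this] ab(3) ab'(3) show "X = X'" by simp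
    qed
    show "\<Phi> ` ?F = frobenius_sl_last n k"
    proof (intro equalityI subsetI)
      fix Y assume "Y \<in> \<Phi> ` ?F"
      then obtain X where X: "X \<in> ?F" "Y = \<Phi> X" by blast
      obtain a b where ab: "composition_of (n - k) a" "composition_of n b" "X = seaweed_C_class n a b"
        "frobenius (2 * n) (seaweed_C n a b :: 'a mat set)" using rep[OF X(1)] by blast
      have "frobenius n (seaweed_A n (a @ [k]) b \<inter> sl n :: 'a mat set)"
        using iff[of a b] ab by (auto simp: composition_of_def)
      moreover have "Y = seaweed_A n (a @ [k]) b \<inter> sl n" using \<Phi>[OF ab(1,2)] X(2) ab(3) by simp
      ultimately show "Y \<in> frobenius_sl_last n k"
        unfolding frobenius_sl_last_def using ext[OF ab(1)] ab(2) by (intro CollectI exI[of _ "a @ [k]"] exI[of _ b]) simp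
    next
      fix Y :: "'a mat set" assume "Y \<in> frobenius_sl_last n k"
      then obtain a' b where Y: "Y = seaweed_A n a' b \<inter> sl n" and c: "composition_of n a'" "composition_of n b"
        and l: "a' \<noteq> []" "last a' = k" and fr: "frobenius n (seaweed_A n a' b \<inter> sl n :: 'a mat set)"
        unfolding frobenius_sl_last_def by blast
      define a where "a = butlast a'"
      have a': "a' = a @ [k]" using l append_butlast_last_id[of a'] by (simp add: a_def)
      have ac: "composition_of (n - k) a" using c(1) by (auto simp: a' composition_of_def)
      have "frobenius (2 * n) (seaweed_C n a b :: 'a mat set)"
        using iff[of a b] fr ac c(2) by (auto simp: a' composition_of_def)
      then have "seaweed_C_class n a b \<in> ?F" using mem[OF ac c(2)] by blast
      moreover have "Y = \<Phi> (seaweed_C_class n a b)" using \<Phi>[OF ac c(2)] Y a' by simp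
      ultimately show "Y \<in> \<Phi> ` ?F" by blast
    qed
  qed
  then show ?thesis using rep \<Phi> by (intro exI[of _ \<Phi>]) blast
qed

theorem mainTheorem3:
  shows
    "(\<forall>n\<ge>1. \<exists>\<Phi> :: 'a :: {alg_closed_field, field_char_0} mat set set \<Rightarrow> 'a mat set.
        (\<forall>X\<in>(frobenius_set n 1 :: 'a mat set set set). \<exists>a b. composition_of (n - 1) a \<and> composition_of n b \<and>
           X = seaweed_C_class n a b) \<and>
        (\<forall>a b. composition_of (n - 1) a \<and> composition_of n b \<and>
           (seaweed_C_class n a b :: 'a mat set set) \<in> frobenius_set n 1 \<longrightarrow>
           \<Phi> (seaweed_C_class n a b) = seaweed_A n (a @ [1]) b \<inter> sl n) \<and>
        bij_betw \<Phi> (frobenius_set n 1) (frobenius_sl_last n 1)) \<and>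
     (\<forall>n\<ge>2. \<exists>\<Phi> :: 'a mat set set \<Rightarrow> 'a mat set.
        (\<forall>X\<in>(frobenius_set n 2 :: 'a mat set set set). \<exists>a b. composition_of (n - 2) a \<and> composition_of n b \<and>
           X = seaweed_C_class n a b) \<and>
        (\<forall>a b. composition_of (n - 2) a \<and> composition_of n b \<and>
           (seaweed_C_class n a b :: 'a mat set set) \<in> frobenius_set n 2 \<longrightarrow>
           \<Phi> (seaweed_C_class n a b) = seaweed_A n (a @ [2]) b \<inter> sl n) \<and>
        bij_betw \<Phi> (frobenius_set n 2) (frobenius_sl_last n 2))"
proof (intro conjI allI impI)
  fix n :: nat assume n: "1 \<le> n"
  show "\<exists>\<Phi> :: 'a mat set set \<Rightarrow> 'a mat set.
        (\<forall>X\<in>(frobenius_set n 1 :: 'a mat set set set). \<exists>a b. composition_of (n - 1) a \<and> composition_of n b \<and>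
           X = seaweed_C_class n a b) \<and>
        (\<forall>a b. composition_of (n - 1) a \<and> composition_of n b \<and>
           (seaweed_C_class n a b :: 'a mat set set) \<in> frobenius_set n 1 \<longrightarrow>
           \<Phi> (seaweed_C_class n a b) = seaweed_A n (a @ [1]) b \<inter> sl n) \<and>
        bij_betw \<Phi> (frobenius_set n 1) (frobenius_sl_last n 1)"
    using n by (intro bijection_from_equivalence frobenius_C_iff_A_1) auto
next
  fix n :: nat assume n: "2 \<le> n"
  show "\<exists>\<Phi> :: 'a mat set set \<Rightarrow> 'a mat set.
        (\<forall>X\<in>(frobenius_set n 2 :: 'a mat set set set). \<exists>a b. composition_of (n - 2) a \<and> composition_of n b \<and>
           X = seaweed_C_class n a b) \<and>
        (\<forall>a b. composition_of (n - 2) a \<and> composition_of n b \<and>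
           (seaweed_C_class n a b :: 'a mat set set) \<in> frobenius_set n 2 \<longrightarrow>
           \<Phi> (seaweed_C_class n a b) = seaweed_A n (a @ [2]) b \<inter> sl n) \<and>
        bij_betw \<Phi> (frobenius_set n 2) (frobenius_sl_last n 2)"
  proof (rule bijection_from_equivalence)
    fix a b assume s: "sum_list a \<le> n" "sum_list b \<le> n" "(n - sum_list a) + (n - sum_list b) = 2"
      and fr: "frobenius (2 * n) (seaweed_C n a b :: 'a mat set)"
    show "sum_list a = n \<or> sum_list b = n"
    proof (rule ccontr)
      assume "\<not> ?thesis"
      then have "sum_list a = n - 1" "sum_list b = n - 1" using s by auto
      with not_frobenius_middle[of n a b, where 'a = 'a] n fr show False by simp
    qed
  qed (use n frobenius_C_iff_A_2[OF n, where 'a = 'a] in \<open>simp_all del: One_nat_def\<close>)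
qed

end
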